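(* Let $m,\kappa,c,\omega_H,T$ be positive real constants and let $\psi\colon\mathbb{R}^2\to\mathbb{R}$ be smooth. Let $M$ be a 2-dimensional compact smooth submanifold of $\mathbb{R}^2$ with connected boundary $\partial M$, let $A(M)$ be the area of $M$, and let $\nu$ be the outward-pointing unit normal vector field along $\partial M$. Let $u\colon\mathbb{R}\to\partial M$ be a smooth, zero-mean, $T$-periodic curve with nowhere vanishing derivative whose restriction to the open interval $(0,T)$ is injective, and let $U\colon\mathbb{R}\to\mathbb{R}^2$ be the zero-mean anti-derivative of $u$. Define $$\bar\psi_M(q):=\frac{1}{A(M)}\int_M\psi(q+p)\,\mathrm{d}p,\qquad \bar z_M(q):=\frac1T\int_0^T\psi(q+u(\tau))\,\mathrm{d}\tau,\qquad q\in\mathbb{R}^2.$$ Suppose there exists $\bar q_M^\ast\in\mathbb{R}^2$ such that the double integrator $$m\,\ddot{\bar q}=-\kappa\,\dot{\bar q}+c\,\nabla\bar\psi_M(\bar q)$$ with state $[\bar q,\dot{\bar q}]^\top\in\mathbb{R}^2\times\mathbb{R}^2$ is GAS w.r.t. $[\bar q_M^\ast,0]^\top$. Then the system, with state $[\tilde q,\dot{\tilde q},\tilde\eta]^\top\in\mathbb{R}^2\times\mathbb{R}^2\times\mathbb{R}$ and parameter $\epsilon>0$, $$\begin{aligned} m\,\ddot{\tilde q}&=-\kappa\,\dot{\tilde q}+\tfrac{cT}{A(M)}\,\psi\big(\tilde q+u(\tfrac{t}{\epsilon})-\epsilon\tfrac{\kappa}{m}U(\tfrac{t}{\epsilon})\big)\,\big|\dot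 u(\tfrac{t}{\epsilon})\big|\,\nu\big(u(\tfrac{t}{\epsilon})\big)\\&\qquad-\tfrac{cT}{A(M)}\,\tilde\eta\,\big|\dot u(\tfrac{t}{\epsilon})\big|\,\nu\big(u(\tfrac{t}{\epsilon})\big)+\tfrac{\kappa^2}{m}\,u(\tfrac{t}{\epsilon}),\\ \dot{\tilde\eta}&=-\omega_H\,\tilde\eta+\omega_H\,\psi\big(\tilde q+u(\tfrac{t}{\epsilon})-\epsilon\tfrac{\kappa}{m}U(\tfrac{t}{\epsilon})\big),\end{aligned}$$ is SGPUAS w.r.t. $[\bar q_M^\ast,0,\bar z_M(\bar q_M^\ast)]^\top$.
   Context: $|\cdot|$ is the Euclidean norm. The displayed system is the closed-loop source-seeking system $m\ddot q=-\kappa\dot q+m\frac{1}{\epsilon^2}\ddot u(\frac t\epsilon)+\frac{cT}{A(M)}(\psi(q)-\eta)|\dot u(\frac t\epsilon)|\nu(u(\frac t\epsilon))$, $\dot\eta=-\omega_H\eta+\omega_H\psi(q)$, written in the coordinates $\tilde q=q-u(\frac t\epsilon)+\epsilon\frac{\kappa}{m}U(\frac t\epsilon)$, $\tilde\eta=\eta$. "Zero-mean" for a $T$-periodic function means its integral over $[0,T]$ vanishes. Under the stated assumptions, the restriction of $u$ to $(0,T)$ is a parametrization of $\partial M$ up to the point $u(0)=u(T)$. $\mathcal{KL}$ is the set of continuous functions $\beta\colon\mathbb{R}_{\geq0}\times\mathbb{R}_{\geq0}\to\mathbb{R}_{\geq0}$ such that for each $t\ge0$, $\beta(0,t)=0$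 and $\beta(\cdot,t)$ is strictly increasing, and for each $r\ge0$, $\beta(r,\cdot)$ is non-increasing with $\beta(r,t)\to0$ as $t\to\infty$. SGPUAS (semi-globally practically uniformly asymptotically stable): Consider a system $\dot{x}=g(x,t,\epsilon,\delta)$ with smooth $g\colon\mathbb{R}^N\times\mathbb{R}\times\mathbb{R}_{>0}\times\mathbb{R}_{>0}\to\mathbb{R}^N$, state $x$, time $t$, and parameters $\epsilon,\delta>0$. It is SGPUAS w.r.t. $x^\ast\in\mathbb{R}^N$ if there exists $\beta\in\mathcal{KL}$ such that, for all $r,\sigma>0$, there exists $\delta_0>0$ such that, for every $\delta\in(0,\delta_0)$, there exists $\epsilon_0>0$ such that, for every $\epsilon\in(0,\epsilon_0)$, every $x_0\in\mathbb{R}^N$ with $|x_0-x^\ast|\leq r$, and every $t_0\in\mathbb{R}$, the solution $x$ with $x(t_0)=x_0$ satisfies $|x(t)-x^\ast|\leq\beta(|x_0-x^\ast|,t-t_0)+\sigma$ for every $t\geq t_0$. The system in the claim depends only on $\epsilon$ and not on $\delta$, so the definition is applied with $g$ constant in $\delta$ (the quantifiers over $\delta$ are vacuous). GAS (globally asymptotically stable) is the same property for a time- and parameter-independent system, i.e. the usual global asymptotic stability of $x^\ast$. Second-order equations are read as first-order systems in position and velocity. *)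

theory Defs
  imports "HOL-Analysis.Analysis"
begin

section \<open>Smooth maps\<close>

text \<open>\<open>Ck_on k S f\<close>: \<open>f\<close> is \<open>k\<close> times continuously differentiable on the open set \<open>S\<close>, with
  derivatives taken iteratively along fixed directions \<open>v\<close>. All uses below have \<open>S\<close> open.\<close>

primrec Ck_on ::
  "nat \<Rightarrow> 'a::real_normed_vector set \<Rightarrow> ('a \<Rightarrow> 'b::real_normed_vector) \<Rightarrow> bool" where
  "Ck_on 0 S f \<longleftrightarrow> continuous_on S f"
| "Ck_on (Suc k) S f \<longleftrightarrow>
     (\<forall>x\<in>S. f differentiable (at x)) \<and> (\<forall>v. Ck_on k S (\<lambda>x. frechet_derivative f (at x) v))"

definition smooth_on ::
  "'a::real_normed_vector set \<Rightarrow> ('a \<Rightarrow> 'b::real_normed_vector) \<Rightarrow> bool" where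
  "smooth_on S f \<longleftrightarrow> (\<forall>k. Ck_on k S f)"

definition diffeomorphism ::
  "'a::real_normed_vector set \<Rightarrow> 'b::real_normed_vector set \<Rightarrow> ('a \<Rightarrow> 'b) \<Rightarrow> ('b \<Rightarrow> 'a) \<Rightarrow> bool" where
  "diffeomorphism V W \<phi> \<phi>' \<longleftrightarrow>
     open V \<and> open W \<and> homeomorphism V W \<phi> \<phi>' \<and> smooth_on V \<phi> \<and> smooth_on W \<phi>'"

text \<open>The gradient, via the library relation \<open>GDERIV\<close>; meaningful only where \<open>f\<close> is differentiable.\<close>

definition grad :: "('a::real_inner \<Rightarrow> real) \<Rightarrow> 'a \<Rightarrow> 'a" where
  "grad f x = (THE D. GDERIV f x :> D)"


section \<open>Two-dimensional submanifolds of the plane with boundary\<close>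

text \<open>A chart of \<open>M\<close> around \<open>p\<close> is an ambient diffeomorphism that flattens \<open>M\<close> to the closed half-plane
  \<open>x $ 1 \<ge> 0\<close>. Interior points are covered too: there \<open>W\<close> may be chosen inside the open half-plane.\<close>

definition half_plane :: "(real^2) set" where
  "half_plane = {x. 0 \<le> x $ 1}"

definition submanifold_chart ::
  "(real^2) set \<Rightarrow> real^2 \<Rightarrow> (real^2) set \<Rightarrow> (real^2) set \<Rightarrow> (real^2 \<Rightarrow> real^2) \<Rightarrow> (real^2 \<Rightarrow> real^2) \<Rightarrow> bool"
where
  "submanifold_chart M p V W \<phi> \<phi>' \<longleftrightarrow>
     p \<in> V \<and> diffeomorphism V W \<phi> \<phi>' \<and> \<phi> ` (M \<inter> V) = half_plane \<inter> W"

definition smooth_submanifold_with_boundary :: "(real^2) set \<Rightarrow> bool" where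
  "smooth_submanifold_with_boundary M \<longleftrightarrow>
     (\<forall>p\<in>M. \<exists>V W \<phi> \<phi>'. submanifold_chart M p V W \<phi> \<phi>')"

definition boundary_chart ::
  "(real^2) set \<Rightarrow> real^2 \<Rightarrow> (real^2) set \<Rightarrow> (real^2) set \<Rightarrow> (real^2 \<Rightarrow> real^2) \<Rightarrow> (real^2 \<Rightarrow> real^2) \<Rightarrow> bool"
where
  "boundary_chart M p V W \<phi> \<phi>' \<longleftrightarrow> submanifold_chart M p V W \<phi> \<phi>' \<and> \<phi> p $ 1 = 0"

definition manifold_boundary :: "(real^2) set \<Rightarrow> (real^2) set" where
  "manifold_boundary M = {p \<in> M. \<exists>V W \<phi> \<phi>'. boundary_chart M p V W \<phi> \<phi>'}"

text \<open>In a boundary chart at \<open>p\<close>, the tangent space of the boundary consists of the \<open>v\<close> whose image under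
  the derivative of \<open>\<phi>\<close> has first component zero, and the outward-pointing vectors are those whose image
  has negative first component. Neither depends on the chart.\<close>

definition outward_unit_normal :: "(real^2) set \<Rightarrow> real^2 \<Rightarrow> real^2 \<Rightarrow> bool" where
  "outward_unit_normal M p n \<longleftrightarrow>
     norm n = 1 \<and>
     (\<exists>V W \<phi> \<phi>'. boundary_chart M p V W \<phi> \<phi>' \<and>
        (\<forall>v. frechet_derivative \<phi> (at p) v $ 1 = 0 \<longrightarrow> n \<bullet> v = 0) \<and>
        frechet_derivative \<phi> (at p) n $ 1 < 0)"


section \<open>Stability\<close>

definition class_KL :: "(real \<Rightarrow> real \<Rightarrow> real) set" where
  "class_KL = {\<beta>.
     continuous_on ({0..} \<times> {0..}) (\<lambda>(r, t). \<beta> r t) \<and>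
     (\<forall>r\<ge>0. \<forall>t\<ge>0. 0 \<le> \<beta> r t) \<and>
     (\<forall>t\<ge>0. \<beta> 0 t = 0 \<and> strict_mono_on {0..} (\<lambda>r. \<beta> r t)) \<and>
     (\<forall>r\<ge>0. antimono_on {0..} (\<beta> r) \<and> (\<beta> r \<longlongrightarrow> 0) at_top)}"

definition solves_forward ::
  "('a::real_normed_vector \<Rightarrow> real \<Rightarrow> 'a) \<Rightarrow> real \<Rightarrow> 'a \<Rightarrow> (real \<Rightarrow> 'a) \<Rightarrow> bool" where
  "solves_forward f t0 x0 x \<longleftrightarrow>
     x t0 = x0 \<and> (\<forall>t\<ge>t0. (x has_vector_derivative f (x t) t) (at t within {t0..}))"

text \<open>The arguments of \<open>g\<close> are, in this order, state, time, \<open>\<epsilon>\<close> and \<open>\<delta>\<close>. For smooth \<open>g\<close> solutions are unique;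
  that the solution exists for all \<open>t \<ge> t0\<close> is part of the property, and is demanded separately so
  that the bound cannot hold vacuously.\<close>

definition SGPUAS ::
  "('a::euclidean_space \<Rightarrow> real \<Rightarrow> real \<Rightarrow> real \<Rightarrow> 'a) \<Rightarrow> 'a \<Rightarrow> bool" where
  "SGPUAS g xs \<longleftrightarrow>
     (\<exists>\<beta>\<in>class_KL. \<forall>r>0. \<forall>\<sigma>>0. \<exists>\<delta>0>0. \<forall>\<delta>\<in>{0<..<\<delta>0}. \<exists>\<epsilon>0>0. \<forall>\<epsilon>\<in>{0<..<\<epsilon>0}.
        \<forall>x0. norm (x0 - xs) \<le> r \<longrightarrow> (\<forall>t0.
          (\<exists>x. solves_forward (\<lambda>y t. g y t \<epsilon> \<delta>) t0 x0 x) \<and>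
          (\<forall>x. solves_forward (\<lambda>y t. g y t \<epsilon> \<delta>) t0 x0 x \<longrightarrow>
             (\<forall>t\<ge>t0. norm (x t - xs) \<le> \<beta> (norm (x0 - xs)) (t - t0) + \<sigma>))))"

definition GAS :: "('a::euclidean_space \<Rightarrow> 'a) \<Rightarrow> 'a \<Rightarrow> bool" where
  "GAS f xs \<longleftrightarrow> SGPUAS (\<lambda>x t \<epsilon> \<delta>. f x) xs"

text \<open>The usual form of global asymptotic stability: the slack \<open>\<sigma>\<close> disappears.\<close>

lemma GAS_iff:
  "GAS f xs \<longleftrightarrow>
     (\<exists>\<beta>\<in>class_KL. \<forall>x0 t0.
        (\<exists>x. solves_forward (\<lambda>y t. f y) t0 x0 x) \<and>
        (\<forall>x. solves_forward (\<lambda>y t. f y) t0 x0 x \<longrightarrow>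
           (\<forall>t\<ge>t0. norm (x t - xs) \<le> \<beta> (norm (x0 - xs)) (t - t0))))"
proof -
  define P where "P \<beta> \<sigma> x0 t0 \<longleftrightarrow>
      (\<exists>x. solves_forward (\<lambda>y t. f y) t0 x0 x) \<and>
      (\<forall>x. solves_forward (\<lambda>y t. f y) t0 x0 x \<longrightarrow>
         (\<forall>t\<ge>t0. norm (x t - xs) \<le> \<beta> (norm (x0 - xs)) (t - t0) + \<sigma>))"
    for \<beta> :: "real \<Rightarrow> real \<Rightarrow> real" and \<sigma> x0 t0
  have vacuous: "(\<exists>d>0::real. \<forall>\<delta>\<in>{0<..<d}. Q) \<longleftrightarrow> Q" for Q
  proof
    assume "\<exists>d>0::real. \<forall>\<delta>\<in>{0<..<d}. Q"
    then obtain d :: real where "d > 0" "\<forall>\<delta>\<in>{0<..<d}. Q" by blast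
    moreover from \<open>d > 0\<close> have "d / 2 \<in> {0<..<d}" by simp
    ultimately show Q by blast
  qed (use zero_less_one[where ?'a = real] in blast)
  have radius: "(\<forall>r>0. \<forall>\<sigma>>0. \<forall>x0. norm (x0 - xs) \<le> r \<longrightarrow> (\<forall>t0. P \<beta> \<sigma> x0 t0))
      \<longleftrightarrow> (\<forall>x0 t0. \<forall>\<sigma>>0. P \<beta> \<sigma> x0 t0)" for \<beta>
  proof
    assume *: "\<forall>r>0. \<forall>\<sigma>>0. \<forall>x0. norm (x0 - xs) \<le> r \<longrightarrow> (\<forall>t0. P \<beta> \<sigma> x0 t0)"
    show "\<forall>x0 t0. \<forall>\<sigma>>0. P \<beta> \<sigma> x0 t0"
    proof (intro allI impI)
      fix x0 t0 and \<sigma> :: real assume "\<sigma> > 0"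
      moreover have "norm (x0 - xs) + 1 > 0" by (simp add: add_nonneg_pos)
      moreover have "norm (x0 - xs) \<le> norm (x0 - xs) + 1" by simp
      ultimately show "P \<beta> \<sigma> x0 t0" using * by blast
    qed
  qed blast
  have slack: "(\<forall>\<sigma>>0. P \<beta> \<sigma> x0 t0) \<longleftrightarrow> P \<beta> 0 x0 t0" for \<beta> x0 t0
  proof
    assume *: "\<forall>\<sigma>>0. P \<beta> \<sigma> x0 t0"
    have "norm (x t - xs) \<le> \<beta> (norm (x0 - xs)) (t - t0) + 0"
      if "solves_forward (\<lambda>y t. f y) t0 x0 x" "t0 \<le> t" for x t
      unfolding add_0_right
    proof (rule field_le_epsilon)
      fix \<sigma> :: real assume "\<sigma> > 0"
      then show "norm (x t - xs) \<le> \<beta> (norm (x0 - xs)) (t - t0) + \<sigma>"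
        using * that unfolding P_def by blast
    qed
    moreover have "P \<beta> 1 x0 t0" using * by simp
    ultimately show "P \<beta> 0 x0 t0" unfolding P_def by blast
  next
    assume *: "P \<beta> 0 x0 t0"
    show "\<forall>\<sigma>>0. P \<beta> \<sigma> x0 t0"
    proof (intro allI impI)
      fix \<sigma> :: real assume "\<sigma> > 0"
      then have "a \<le> b + 0 \<Longrightarrow> a \<le> b + \<sigma>" for a b :: real by linarith
      with * show "P \<beta> \<sigma> x0 t0" unfolding P_def by blast
    qed
  qed
  have "GAS f xs \<longleftrightarrow> (\<exists>\<beta>\<in>class_KL. \<forall>x0 t0. P \<beta> 0 x0 t0)"
    unfolding GAS_def SGPUAS_def P_def[symmetric] vacuous radius slack ..
  then show ?thesis unfolding P_def add_0_right .
qed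


section \<open>Averaged signals and the two systems\<close>

definition area :: "(real^2) set \<Rightarrow> real" where
  "area M = measure lebesgue M"

definition psi_bar :: "(real^2) set \<Rightarrow> (real^2 \<Rightarrow> real) \<Rightarrow> real^2 \<Rightarrow> real" where
  "psi_bar M \<psi> q = 1 / area M * integral M (\<lambda>p. \<psi> (q + p))"

definition z_bar :: "real \<Rightarrow> (real \<Rightarrow> real^2) \<Rightarrow> (real^2 \<Rightarrow> real) \<Rightarrow> real^2 \<Rightarrow> real" where
  "z_bar T u \<psi> q = 1 / T * integral {0..T} (\<lambda>\<tau>. \<psi> (q + u \<tau>))"

text \<open>First-order forms: the states are (position, velocity) and (position, velocity, filter state), and the
  second-order equations are divided by the mass \<open>m\<close>.\<close>

definition double_integrator ::
  "real \<Rightarrow> real \<Rightarrow> real \<Rightarrow> (real^2 \<Rightarrow> real) \<Rightarrow> (real^2) \<times> (real^2) \<Rightarrow> (real^2) \<times> (real^2)" where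
  "double_integrator m \<kappa> c J = (\<lambda>(q, v).
     (v, (1 / m) *\<^sub>R (- \<kappa> *\<^sub>R v + c *\<^sub>R grad J q)))"

definition source_seeking_system ::
  "real \<Rightarrow> real \<Rightarrow> real \<Rightarrow> real \<Rightarrow> real \<Rightarrow> (real^2 \<Rightarrow> real) \<Rightarrow> (real^2) set \<Rightarrow> (real^2 \<Rightarrow> real^2) \<Rightarrow>
   (real \<Rightarrow> real^2) \<Rightarrow> (real \<Rightarrow> real^2) \<Rightarrow>
   (real^2) \<times> (real^2) \<times> real \<Rightarrow> real \<Rightarrow> real \<Rightarrow> (real^2) \<times> (real^2) \<times> real" where
  "source_seeking_system m \<kappa> c \<omega>\<^sub>H T \<psi> M \<nu> u U = (\<lambda>(q, v, \<eta>) t \<epsilon>.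
     let s = t / \<epsilon>;
         y = \<psi> (q + u s - (\<epsilon> * (\<kappa> / m)) *\<^sub>R U s);
         n = norm (vector_derivative u (at s)) *\<^sub>R \<nu> (u s)
     in (v,
         (1 / m) *\<^sub>R
           (- \<kappa> *\<^sub>R v
            + (c * T / area M * y) *\<^sub>R n
            - (c * T / area M * \<eta>) *\<^sub>R n
            + (\<kappa>\<^sup>2 / m) *\<^sub>R u s),
         - \<omega>\<^sub>H * \<eta> + \<omega>\<^sub>H * y))"

end

theory Submission
  imports Defs
begin

text \<open>
  By the divergence theorem, the mean over one period of
  \<open>\<psi> (q + u) * |u'| * \<nu> (u)\<close> is \<open>1 / T\<close> times the integral of \<open>\<nabla>\<psi> (q + p)\<close> over \<open>M\<close>, and the mean of
  \<open>|u'| * \<nu> (u)\<close> vanishes. Hence the averaged system is the given double integrator, which drives the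
  filter \<open>\<eta>' = - \<omega>\<^sub>H \<eta> + \<omega>\<^sub>H z_bar q\<close>; this cascade inherits a class KL bound \<open>\<beta>\<close>. On every time
  interval of fixed length and uniformly over initial values in a ball, solutions of the oscillating
  system are \<open>O(\<epsilon>)\<close>-close to averaged ones. Choosing the length so large that \<open>\<beta>\<close> has decayed
  below the tolerance, the comparison can be restarted at the end of each interval, which gives
  the estimate with the same \<open>\<beta>\<close> for all times.
\<close>

section \<open>Ordinary differential equations\<close>

text \<open>The vector fields are only locally Lipschitz, so neither global existence nor uniform
  constants come for free. The oscillating field is therefore composed with the closest-point
  projection onto a ball: the modified system has global solutions and uniform constants, and the
  averaging estimate keeps its solution inside the ball, where both systems agree. Only the averaged
  solution needs an a priori bound, which \<open>\<beta>\<close> supplies. The constants do not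
  depend on the initial time, because the mean may be taken over a period starting anywhere.

  The term with \<open>U\<close> is an \<open>O(\<epsilon>)\<close> perturbation: zero mean of
  \<open>u\<close> makes \<open>U\<close> periodic, hence bounded.

  For the divergence theorem, the coordinates near a boundary point are the curve parameter and a
  fixed normal direction instead of a chart, so the line integral along \<open>u\<close> appears
  directly. Charts serve to show that \<open>u\<close> fills the frontier near each of its points,
  that normals are orthogonal to \<open>u\<close>, and on which side \<open>M\<close> lies. Cut-off
  functions reduce the global statement to such boxes and to balls inside \<open>M\<close>.\<close>

lemma gronwall:
  fixes \<phi> :: "real \<Rightarrow> real"
  assumes cont: "continuous_on {a..b} \<phi>" and "0 \<le> L"
    and le: "\<And>t. t \<in> {a..b} \<Longrightarrow> \<phi> t \<le> c + L * integral {a..t} \<phi>"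
    and t: "t \<in> {a..b}"
  shows "\<phi> t \<le> c * exp (L * (t - a))"
proof -
  \<comment> \<open>\<open>W\<close> is the right-hand side of the hypothesis times an integrating
    factor. Its derivative is \<open>L * exp (- L * (s - a))\<close> times the difference of
    \<open>\<phi> s\<close> and that right-hand side, hence nonpositive, and
    \<open>W a = c\<close>.\<close>
  define W where "W s = exp (- L * (s - a)) * (c + L * integral {a..s} \<phi>)" for s
  have W: "(W has_real_derivative exp (- L * (s - a)) * (L * \<phi> s - L * (c + L * integral {a..s} \<phi>)))
      (at s within {a..b})" if "s \<in> {a..b}" for s
  proof -
    have "((\<lambda>s. exp (- L * (s - a))) has_real_derivative exp (- L * (s - a)) * (- L)) (at s within {a..b})"
      by (auto intro!: derivative_eq_intros)
    moreover have "((\<lambda>s. c + L * integral {a..s} \<phi>) has_real_derivative 0 + L * \<phi> s) (at s within {a..b})"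
      by (intro DERIV_add DERIV_const DERIV_cmult integral_has_real_derivative[OF cont that])
    ultimately have "(W has_real_derivative exp (- L * (s - a)) * (- L) * (c + L * integral {a..s} \<phi>)
        + (0 + L * \<phi> s) * exp (- L * (s - a))) (at s within {a..b})"
      unfolding W_def by (rule DERIV_mult)
    then show ?thesis by (simp add: algebra_simps)
  qed
  have "W t \<le> W a"
  proof (rule DERIV_nonpos_imp_decreasing_open[where f=W and a=a and b=t])
    show "a \<le> t" using t by simp
    show "continuous_on {a..t} W"
    proof (rule continuous_on_subset[of "{a..b}"])
      show "continuous_on {a..b} W"
        unfolding W_def
        by (intro continuous_intros indefinite_integral_continuous_1 integrable_continuous_real cont)
    qed (use t in auto)
  next
    fix s assume s: "a < s" "s < t"
    then have "s \<in> {a..b}" and "at s within {a..b} = at s" using t by (auto intro!: at_within_interior)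
    then have "(W has_real_derivative exp (- L * (s - a)) * (L * \<phi> s - L * (c + L * integral {a..s} \<phi>))) (at s)"
      using W[of s] by simp
    moreover have "L * \<phi> s \<le> L * (c + L * integral {a..s} \<phi>)"
      using le[OF \<open>s \<in> {a..b}\<close>] \<open>0 \<le> L\<close> by (intro mult_left_mono) auto
    then have "exp (- L * (s - a)) * (L * \<phi> s - L * (c + L * integral {a..s} \<phi>)) \<le> 0"
      by (intro mult_nonneg_nonpos) auto
    ultimately show "\<exists>y. (W has_real_derivative y) (at s) \<and> y \<le> 0" by blast
  qed
  then have "exp (- L * (t - a)) * (c + L * integral {a..t} \<phi>) \<le> c" by (simp add: W_def)
  moreover have "X \<le> c * exp z" if "exp (- z) * X \<le> c" for X z :: real
    using that by (simp add: exp_minus field_simps)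
  ultimately have "c + L * integral {a..t} \<phi> \<le> c * exp (L * (t - a))" by simp
  with le[OF t] show ?thesis by (rule order_trans)
qed

text \<open>\<open>F x t\<close> is compared with \<open>F x0 t0\<close> through
  \<open>F x0 t\<close>; the Lipschitz bound is uniform in time and controls the first difference.
  The result makes \<open>F (x s) s\<close> continuous in \<open>s\<close> along every continuous
  path, so that the integrands below are integrable.\<close>

lemma continuous_on_pair_lipschitz:
  fixes F :: "'a::real_normed_vector \<Rightarrow> real \<Rightarrow> 'b::real_normed_vector"
  assumes cont: "\<And>x. continuous_on UNIV (F x)"
    and lip: "\<And>x y t. norm (F x t - F y t) \<le> L * norm (x - y)"
  shows "continuous_on UNIV (\<lambda>(x, t). F x t)"
proof -
  have "((\<lambda>p. F (fst p) (snd p)) \<longlongrightarrow> F x0 t0) (at (x0, t0))" for x0 t0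
  proof -
    have f: "(fst \<longlongrightarrow> x0) (at (x0, t0))" and s: "(snd \<longlongrightarrow> t0) (at (x0, t0))"
      using tendsto_fst[OF tendsto_ident_at[of "(x0, t0)" UNIV]] tendsto_snd[OF tendsto_ident_at[of "(x0, t0)" UNIV]]
      by simp_all
    have "isCont (F x0) t0" using cont[of x0] by (simp add: continuous_on_eq_continuous_at)
    from isCont_tendsto_compose[OF this s]
    have 1: "((\<lambda>p. F x0 (snd p)) \<longlongrightarrow> F x0 t0) (at (x0, t0))" .
    have "((\<lambda>p. L * norm (fst p - x0)) \<longlongrightarrow> 0) (at (x0, t0))"
      by (rule tendsto_mult_right_zero[OF tendsto_norm_zero[OF LIM_zero[OF f]]])
    moreover have "\<forall>\<^sub>F p in at (x0, t0). norm (F (fst p) (snd p) - F x0 (snd p)) \<le> L * norm (fst p - x0)"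
      using lip by (intro always_eventually allI)
    ultimately have "((\<lambda>p. F (fst p) (snd p) - F x0 (snd p)) \<longlongrightarrow> 0) (at (x0, t0))"
      by (rule Lim_null_comparison[rotated])
    from tendsto_add[OF this 1] show ?thesis by simp
  qed
  then show ?thesis
    by (auto simp: continuous_on_def case_prod_unfold)
qed

lemma solves_forward_integral:
  fixes F :: "'a::banach \<Rightarrow> real \<Rightarrow> 'a"
  assumes "solves_forward F t0 x0 x" "t0 \<le> t"
  shows "((\<lambda>s. F (x s) s) has_integral x t - x0) {t0..t}"
proof -
  have "((\<lambda>s. F (x s) s) has_integral x t - x t0) {t0..t}"
  proof (rule fundamental_theorem_of_calculus)
    fix s assume "s \<in> {t0..t}"
    then have "(x has_vector_derivative F (x s) s) (at s within {t0..})"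
      using assms by (simp add: solves_forward_def)
    then show "(x has_vector_derivative F (x s) s) (at s within {t0..t})"
      by (rule has_vector_derivative_within_subset) auto
  qed (fact assms)
  then show ?thesis using assms by (simp add: solves_forward_def)
qed

lemma solves_forward_continuous_on:
  assumes "solves_forward F t0 x0 x"
  shows "continuous_on {t0..} x"
  using assms unfolding solves_forward_def
  by (intro continuous_on_vector_derivative) auto

lemma integral_has_vector_derivative_atLeast:
  fixes f :: "real \<Rightarrow> 'a::banach"
  assumes "continuous_on {a..} f" "a \<le> t"
  shows "((\<lambda>u. integral {a..u} f) has_vector_derivative f t) (at t within {a..})"
proof -
  have "((\<lambda>u. integral {a..u} f) has_vector_derivative f t) (at t within {a..t+1})"
    using assms by (intro integral_has_vector_derivative) (auto intro: continuous_on_subset)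
  moreover have "at t within {a..t+1} = at t within {a..}"
    by (rule at_within_nhd[of t "{..<t+1}"]) auto
  ultimately show ?thesis by simp
qed

lemma solves_forwardI:
  fixes F :: "'a::banach \<Rightarrow> real \<Rightarrow> 'a"
  assumes "continuous_on {t0..} (\<lambda>s. F (x s) s)"
    and x: "\<And>t. t0 \<le> t \<Longrightarrow> x t = x0 + integral {t0..t} (\<lambda>s. F (x s) s)"
  shows "solves_forward F t0 x0 x"
  unfolding solves_forward_def
proof (intro conjI allI impI)
  show "x t0 = x0" using x[of t0] by simp
  fix t assume t: "t0 \<le> t"
  have "((\<lambda>t. x0 + integral {t0..t} (\<lambda>s. F (x s) s)) has_vector_derivative 0 + F (x t) t) (at t within {t0..})"
    by (intro has_vector_derivative_add has_vector_derivative_const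
        integral_has_vector_derivative_atLeast assms t)
  then have "((\<lambda>t. x0 + integral {t0..t} (\<lambda>s. F (x s) s)) has_vector_derivative F (x t) t) (at t within {t0..})"
    by simp
  then show "(x has_vector_derivative F (x t) t) (at t within {t0..})"
    by (rule has_vector_derivative_transform[rotated 2]) (use t x in auto)
qed

text \<open>The weight \<open>exp (- 2 * L * (t - t0))\<close> makes the Picard operator a contraction on the whole
  half-line, so no continuation of local solutions is needed.\<close>

lemma solves_forward_exists:
  fixes F :: "'a::banach \<Rightarrow> real \<Rightarrow> 'a"
  assumes cont: "\<And>x. continuous_on UNIV (F x)"
    and lip: "\<And>x y t. norm (F x t - F y t) \<le> L * norm (x - y)"
    and bound: "\<And>x t. norm (F x t) \<le> K"
  shows "\<exists>x. solves_forward F t0 x0 x"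
proof -
  define l where "l = \<bar>L\<bar> + 1"
  have l: "l > 0" by (simp add: l_def)
  have lip': "norm (F x t - F y t) \<le> l * norm (x - y)" for x y t
    using order_trans[OF lip mult_right_mono[of L l]] by (simp add: l_def)
  have K: "0 \<le> K" using bound[of x0 0] norm_ge_zero order_trans by blast
  note joint = continuous_on_pair_lipschitz[of F, OF cont lip]
  define w where "w t = exp (2 * l * (t - t0))" for t
  have w: "w t > 0" for t by (simp add: w_def)
  have wc: "continuous_on S w" for S unfolding w_def by (intro continuous_intros)
  have Fc: "continuous_on S (\<lambda>s. F (w s *\<^sub>R apply_bcontfun y s) s)" for S and y :: "real \<Rightarrow>\<^sub>C 'a"
    using continuous_on_compose2[OF joint, of S "\<lambda>s. (w s *\<^sub>R apply_bcontfun y s, s)"]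
    by (simp add: continuous_intros wc)
  define I where "I y t = integral {t0..t} (\<lambda>s. F (w s *\<^sub>R apply_bcontfun y s) s)" for y t
  have Inorm: "norm (I y t) \<le> K * (t - t0)" if "t0 \<le> t" for y t
    unfolding I_def using that bound
    by (intro integral_bound) (auto intro!: Fc)
  have Ic: "continuous_on UNIV (\<lambda>t. I y (max t0 t))" for y
  proof -
    have "continuous_on {t0..} (I y)"
      unfolding I_def
      by (rule continuous_on_vector_derivative[OF integral_has_vector_derivative_atLeast[OF Fc]]) auto
    then show ?thesis
      by (rule continuous_on_compose2) (auto intro!: continuous_intros)
  qed
  \<comment> \<open>The unknown is the weighted function \<open>y = x / w\<close>, which is bounded.
    Bounded continuous functions live on the whole line, so \<open>max t0 t\<close> extends the
    operator constantly to times before \<open>t0\<close>.\<close>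
  define T where "T y t = (1 / w (max t0 t)) *\<^sub>R (x0 + I y (max t0 t))" for y t
  have Tb: "T y \<in> bcontfun" for y
  proof (rule bcontfun_normI)
    show "continuous_on UNIV (T y)"
      unfolding T_def
      by (intro continuous_intros Ic continuous_on_compose2[OF wc[of UNIV]])
         (use w in \<open>auto simp: less_le\<close>)
    fix t
    define \<tau> where "\<tau> = max t0 t - t0"
    have \<tau>: "\<tau> \<ge> 0" by (simp add: \<tau>_def)
    \<comment> \<open>By \<open>exp z \<ge> 1 + z\<close> the weight dominates both the constant
      \<open>x0\<close> and the linear growth \<open>K * \<tau>\<close> of the integral.\<close>
    have w1: "w (max t0 t) \<ge> 1" and w2: "w (max t0 t) \<ge> 2 * l * \<tau>"
      using exp_ge_add_one_self[of "2 * l * \<tau>"] mult_nonneg_nonneg[of "2 * l" \<tau>] l \<tau>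
      unfolding w_def \<tau>_def by linarith+
    have "norm (T y t) \<le> (1 / w (max t0 t)) * (norm x0 + K * \<tau>)"
      unfolding T_def norm_scaleR using w[of "max t0 t"] Inorm[of "max t0 t" y]
      by (auto simp: \<tau>_def intro!: divide_right_mono norm_triangle_le)
    also have "\<dots> = norm x0 / w (max t0 t) + (K / (2 * l)) * (2 * l * \<tau> / w (max t0 t))"
      using l by (simp add: add_divide_distrib)
    also have "\<dots> \<le> norm x0 / 1 + K / (2 * l) * 1"
      using w1 w2 l K w[of "max t0 t"]
      by (intro add_mono mult_left_mono divide_left_mono) (auto simp: divide_le_eq)
    finally show "norm (T y t) \<le> norm x0 + K / (2 * l)" by simp
  qed
  have "dist (Bcontfun (T y)) (Bcontfun (T z)) \<le> 1/2 * dist y z" for y z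
  proof (rule dist_bound)
    fix t
    define r where "r = max t0 t"
    have r: "t0 \<le> r" by (simp add: r_def)
    define D where "D = dist y z"
    have "norm (I y r - I z r) = norm (integral {t0..r} (\<lambda>s. F (w s *\<^sub>R apply_bcontfun y s) s - F (w s *\<^sub>R apply_bcontfun z s) s))"
      unfolding I_def using Fc by (subst Henstock_Kurzweil_Integration.integral_diff) (auto intro!: integrable_continuous_real)
    moreover have "norm (integral {t0..r} (\<lambda>s. F (w s *\<^sub>R apply_bcontfun y s) s - F (w s *\<^sub>R apply_bcontfun z s) s))
        \<le> integral {t0..r} (\<lambda>s. l * D * w s)"
    proof (rule Henstock_Kurzweil_Integration.integral_norm_bound_integral)
      fix s assume "s \<in> {t0..r}"
      have "norm (F (w s *\<^sub>R apply_bcontfun y s) s - F (w s *\<^sub>R apply_bcontfun z s) s) \<le> l * norm (w s *\<^sub>R (apply_bcontfun y s - apply_bcontfun z s))"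
        using lip' by (metis scaleR_diff_right)
      also have "\<dots> = l * w s * dist (apply_bcontfun y s) (apply_bcontfun z s)"
        using w[of s] by (simp add: dist_norm)
      also have "\<dots> \<le> l * w s * D"
        unfolding D_def using l w[of s] by (intro mult_left_mono dist_bounded) auto
      finally show "norm (F (w s *\<^sub>R apply_bcontfun y s) s - F (w s *\<^sub>R apply_bcontfun z s) s) \<le> l * D * w s"
        by (simp add: ac_simps)
    qed (auto intro!: integrable_continuous_real Fc continuous_intros wc)
    \<comment> \<open>Since \<open>w' = 2 * l * w\<close>, integrating \<open>l * w\<close> gains
      the factor \<open>1 / 2\<close>. This is the contraction constant and the reason for the
      exponent \<open>2 * l\<close>.\<close>
    moreover have "((\<lambda>s. l * D * w s) has_integral (D / 2 * w r - D / 2 * w t0)) {t0..r}"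
    proof (intro fundamental_theorem_of_calculus[OF r])
      fix s
      have "(w has_real_derivative w s * (2 * l)) (at s within {t0..r})"
        unfolding w_def by (auto intro!: derivative_eq_intros)
      from DERIV_cmult[OF this, of "D / 2"]
      show "((\<lambda>s. D / 2 * w s) has_vector_derivative l * D * w s) (at s within {t0..r})"
        by (simp add: has_real_derivative_iff_has_vector_derivative ac_simps)
    qed
    then have "integral {t0..r} (\<lambda>s. l * D * w s) = D / 2 * w r - D / 2 * w t0"
      by (rule integral_unique)
    moreover have "0 \<le> D / 2 * w t0" using w[of t0] by (simp add: D_def)
    ultimately have *: "norm (I y r - I z r) \<le> D / 2 * w r" by linarith
    have "T y t - T z t = (1 / w r) *\<^sub>R (I y r - I z r)"
      unfolding T_def r_def by (simp add: scaleR_diff_right scaleR_add_right)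
    then have "dist (T y t) (T z t) = norm (I y r - I z r) / w r"
      unfolding dist_norm using w[of r] by simp
    moreover have "norm (I y r - I z r) / w r \<le> D / 2" using * w[of r] by (simp add: pos_divide_le_eq)
    moreover have "apply_bcontfun (Bcontfun (T x)) = T x" for x
      using Tb by (rule Bcontfun_inverse)
    ultimately show "dist (apply_bcontfun (Bcontfun (T y)) t) (apply_bcontfun (Bcontfun (T z)) t) \<le> 1/2 * dist y z"
      by (simp add: D_def)
  qed
  then have "\<exists>!y. Bcontfun (T y) = y"
    by (intro banach_fix_type[of "1/2"] allI) simp_all
  then obtain y where "Bcontfun (T y) = y" by (elim ex1E)
  then have "apply_bcontfun y = T y" using Bcontfun_inverse[OF Tb[of y]] by simp
  then have y: "apply_bcontfun y t = T y t" for t by simp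
  have "solves_forward F t0 x0 (\<lambda>t. w t *\<^sub>R apply_bcontfun y t)"
  proof (rule solves_forwardI)
    fix t assume t: "t0 \<le> t"
    show "w t *\<^sub>R apply_bcontfun y t = x0 + integral {t0..t} (\<lambda>s. F (w s *\<^sub>R apply_bcontfun y s) s)"
      unfolding y[of t] T_def I_def[symmetric] using t w[of t] by (simp add: max_def)
  qed (rule Fc)
  then show ?thesis by blast
qed

section \<open>Averaging\<close>

lemma periodic_add_int:
  fixes w :: "real \<Rightarrow> 'a"
  assumes per: "\<And>t. w (t + T) = w t"
  shows "w (t + of_int k * T) = w t"
proof -
  have nat: "w (t + of_nat n * T) = w t" for t n
  proof (induction n)
    case (Suc n)
    have "t + of_nat (Suc n) * T = (t + of_nat n * T) + T" by (simp add: algebra_simps)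
    then show ?case using Suc per by metis
  qed simp
  show ?thesis
  proof (cases k rule: int_cases2)
    case (nonpos n)
    then show ?thesis using nat[of "t - of_nat n * T" n] by simp
  qed (use nat in simp)
qed

lemma period_representative:
  fixes t T :: real
  assumes "0 < T"
  obtains k :: int where "0 \<le> t + of_int k * T" "t + of_int k * T < T"
proof
  show "0 \<le> t + of_int (- \<lfloor>t / T\<rfloor>) * T" "t + of_int (- \<lfloor>t / T\<rfloor>) * T < T"
    using floor_divide_lower[OF assms, of t] floor_divide_upper[OF assms, of t]
    by (simp_all add: distrib_right)
qed

text \<open>An antiderivative \<open>A\<close> of \<open>f\<close> satisfies
  \<open>(A (t + p) - A t)' = f (t + p) - f t = 0\<close>. Starting it at \<open>min a b\<close>
  keeps both points in the half-line where \<open>A\<close> is differentiable with derivative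
  \<open>f\<close>.\<close>

lemma integral_periodic_shift:
  fixes f :: "real \<Rightarrow> 'a::banach"
  assumes cont: "continuous_on UNIV f" and per: "\<And>s. f (s + p) = f s" and "0 \<le> p"
  shows "integral {a..a + p} f = integral {b..b + p} f"
proof -
  define l where "l = min a b"
  define A where "A t = integral {l..t} f" for t
  have A: "(A has_vector_derivative f t) (at t within {l..})" if "l \<le> t" for t
    unfolding A_def using that cont
    by (intro integral_has_vector_derivative_atLeast) (auto intro: continuous_on_subset)
  have shift: "((\<lambda>t. A (t + p)) has_vector_derivative f t) (at t within {l..})" if "l \<le> t" for t
  proof -
    have "((\<lambda>t. t + p) has_vector_derivative 1) (at t within {l..})"
      by (auto intro!: derivative_eq_intros)
    moreover have "(A has_vector_derivative f (t + p)) (at (t + p) within (\<lambda>t. t + p) ` {l..})"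
      by (rule has_vector_derivative_within_subset[OF A]) (use that \<open>0 \<le> p\<close> in auto)
    ultimately have "(A \<circ> (\<lambda>t. t + p) has_vector_derivative 1 *\<^sub>R f (t + p)) (at t within {l..})"
      by (rule vector_diff_chain_within)
    then show ?thesis by (simp add: o_def per)
  qed
  obtain c where "\<And>t. t \<in> {l..} \<Longrightarrow> A (t + p) - A t = c"
  proof (rule has_vector_derivative_zero_constant[of "{l..}" "\<lambda>t. A (t + p) - A t"])
    fix t assume "t \<in> {l..}"
    then show "((\<lambda>t. A (t + p) - A t) has_vector_derivative 0) (at t within {l..})"
      using has_vector_derivative_diff[OF shift A, of t] by simp
  qed (auto simp: convex_real_interval)
  moreover have "integral {t..t + p} f = A (t + p) - A t" if "l \<le> t" for t
  proof -
    have "integral {l..t} f + integral {t..t + p} f = integral {l..t + p} f"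
      using that \<open>0 \<le> p\<close> continuous_on_subset[OF cont]
      by (intro Henstock_Kurzweil_Integration.integral_combine integrable_continuous_real) auto
    then show ?thesis unfolding A_def by (simp add: algebra_simps)
  qed
  ultimately show ?thesis unfolding l_def by (metis atLeast_iff min.cobounded1 min.cobounded2)
qed

text \<open>Freezing \<open>x\<close> at its value at the beginning of each period costs \<open>O(p\<^sup>2)\<close> per period, hence
  \<open>O(p)\<close> in total.\<close>

lemma norm_integral_averaging_le:
  fixes h :: "'a::real_normed_vector \<Rightarrow> real \<Rightarrow> 'b::banach" and x :: "real \<Rightarrow> 'a"
  assumes p: "0 < p" and L: "0 \<le> L" and K: "0 \<le> K"
    and cont: "\<And>y. continuous_on UNIV (h y)"
    and per: "\<And>y s. h y (s + p) = h y s"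
    and mean: "\<And>y. integral {0..p} (h y) = 0"
    and lip: "\<And>y z s. norm (h y s - h z s) \<le> L * norm (y - z)"
    and bound: "\<And>y s. norm (h y s) \<le> B"
    and x: "\<And>s t. a \<le> s \<Longrightarrow> s \<le> t \<Longrightarrow> norm (x t - x s) \<le> K * (t - s)"
    and ab: "a \<le> b"
  shows "norm (integral {a..b} (\<lambda>s. h (x s) s)) \<le> (L * K * (b - a) + B) * p"
proof -
  have xc: "continuous_on {a..} x"
  proof (rule continuous_on_subset)
    have "norm (x t - x s) \<le> K * \<bar>t - s\<bar>" if "s \<in> {a..}" "t \<in> {a..}" for s t
      using x[of s t] x[of t s] that norm_minus_commute[of "x t" "x s"] by (cases "s \<le> t") auto
    then show "continuous_on {a..} x"
      by (intro lipschitz_on_continuous_on[of K] lipschitz_onI)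
         (auto simp: dist_norm K norm_minus_commute abs_minus_commute)
  qed simp
  have hc: "continuous_on S (\<lambda>s. h (x s) s)" if "S \<subseteq> {a..}" for S
    using continuous_on_compose2[OF continuous_on_pair_lipschitz[of h, OF cont lip], of S "\<lambda>s. (x s, s)"]
      continuous_on_subset[OF xc that] by (simp add: continuous_intros)
  have int: "(\<lambda>s. h (x s) s) integrable_on {c..d}" if "a \<le> c" for c d
    using that by (intro integrable_continuous_real hc) auto
  have period: "norm (integral {t..t + p} (\<lambda>s. h (x s) s)) \<le> L * K * p * p" if "a \<le> t" for t
  proof -
    have "integral {t..t + p} (h (x t)) = 0"
      using integral_periodic_shift[OF cont[of "x t"] per, where a=t and b=0] mean p by simp
    then have "integral {t..t + p} (\<lambda>s. h (x s) s) = integral {t..t + p} (\<lambda>s. h (x s) s - h (x t) s)"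
      using int[OF that] continuous_on_subset[OF cont]
      by (subst Henstock_Kurzweil_Integration.integral_diff) (auto intro!: integrable_continuous_real)
    also have "norm \<dots> \<le> (L * (K * p)) * (t + p - t)"
    proof (rule integral_bound)
      show "continuous_on {t..t + p} (\<lambda>s. h (x s) s - h (x t) s)"
        using that continuous_on_subset[OF cont] by (intro continuous_on_diff hc) auto
      fix s assume s: "s \<in> {t..t + p}"
      have "norm (h (x s) s - h (x t) s) \<le> L * norm (x s - x t)" by (rule lip)
      also have "\<dots> \<le> L * (K * (s - t))" using s that x[of t s] L by (intro mult_left_mono) auto
      also have "\<dots> \<le> L * (K * p)" using s K L by (intro mult_left_mono) auto
      finally show "norm (h (x s) s - h (x t) s) \<le> L * (K * p)" .
    qed (use p in simp)
    finally show ?thesis by (simp add: ac_simps)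
  qed
  have periods: "norm (integral {a..a + real k * p} (\<lambda>s. h (x s) s)) \<le> real k * (L * K * p * p)" for k
  proof (induction k)
    case (Suc k)
    have kp: "0 \<le> real k * p" using p by simp
    have eq: "a + real (Suc k) * p = a + real k * p + p" by (simp add: algebra_simps)
    have "integral {a..a + real k * p} (\<lambda>s. h (x s) s) + integral {a + real k * p..a + real k * p + p} (\<lambda>s. h (x s) s)
        = integral {a..a + real k * p + p} (\<lambda>s. h (x s) s)"
      using kp p int by (intro Henstock_Kurzweil_Integration.integral_combine) auto
    then have "norm (integral {a..a + real (Suc k) * p} (\<lambda>s. h (x s) s))
        \<le> real k * (L * K * p * p) + L * K * p * p"
      unfolding eq using norm_triangle_mono[OF Suc period[of "a + real k * p"]] kp by simp
    then show ?case by (simp add: algebra_simps)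
  qed simp
  \<comment> \<open>\<open>k\<close> complete periods fit into the interval. The remaining piece is
    no longer than \<open>p\<close> and is estimated by \<open>B\<close> alone, which is the source
    of the summand \<open>B * p\<close>.\<close>
  define k where "k = nat \<lfloor>(b - a) / p\<rfloor>"
  have "real k \<le> (b - a) / p" "(b - a) / p < real k + 1"
    using ab p by (auto simp: k_def)
  then have k: "real k * p \<le> b - a" "b - a < real k * p + p"
    using p by (auto simp: field_simps)
  define c where "c = a + real k * p"
  have c: "a \<le> c" "c \<le> b" "b - c \<le> p" using k p by (auto simp: c_def)
  have B: "0 \<le> B" using bound norm_ge_zero order_trans by blast
  have "norm (integral {c..b} (\<lambda>s. h (x s) s)) \<le> B * (b - c)"
    using c bound by (intro integral_bound hc) auto
  also have "\<dots> \<le> B * p" using B c by (intro mult_left_mono)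
  finally have rest: "norm (integral {c..b} (\<lambda>s. h (x s) s)) \<le> B * p" .
  have "real k * (L * K * p * p) = L * K * (real k * p) * p" by simp
  also have "\<dots> \<le> L * K * (b - a) * p" using k L K p by (intro mult_right_mono mult_left_mono) auto
  finally have main: "norm (integral {a..c} (\<lambda>s. h (x s) s)) \<le> L * K * (b - a) * p"
    using periods[of k] by (simp add: c_def)
  have "integral {a..b} (\<lambda>s. h (x s) s) = integral {a..c} (\<lambda>s. h (x s) s) + integral {c..b} (\<lambda>s. h (x s) s)"
    using c int by (subst Henstock_Kurzweil_Integration.integral_combine) auto
  then have "norm (integral {a..b} (\<lambda>s. h (x s) s)) \<le> L * K * (b - a) * p + B * p"
    using norm_triangle_mono[OF main rest] by simp
  then show ?thesis by (simp add: distrib_right)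
qed

text \<open>The time argument of \<open>f\<close> is the fast time \<open>t / \<epsilon>\<close>,
  and its explicit \<open>\<epsilon>\<close> is a regular perturbation; the field at
  \<open>\<epsilon> = 0\<close> is the one whose mean over a period is \<open>g\<close>. Bounds are
  given ball by ball, as the field is only locally Lipschitz. Since \<open>g\<close> is autonomous,
  averaged solutions started at time 0 cover all initial times.\<close>

locale averaged_system =
  fixes f :: "'a::euclidean_space \<Rightarrow> real \<Rightarrow> real \<Rightarrow> 'a" and g :: "'a \<Rightarrow> 'a"
    and T :: real and xs :: 'a and \<beta> :: "real \<Rightarrow> real \<Rightarrow> real"
  assumes T_pos: "0 < T"
    and cont: "\<And>x \<epsilon>. 0 \<le> \<epsilon> \<Longrightarrow> \<epsilon> \<le> 1 \<Longrightarrow> continuous_on UNIV (\<lambda>s. f x s \<epsilon>)"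
    and local_bounds: "\<And>R. \<exists>L K C. \<forall>\<epsilon>\<in>{0..1}. \<forall>s. \<forall>x\<in>cball xs R. \<forall>y\<in>cball xs R.
      norm (f x s \<epsilon> - f y s \<epsilon>) \<le> L * norm (x - y) \<and> norm (f x s \<epsilon>) \<le> K \<and>
      norm (f x s \<epsilon> - f x s 0) \<le> C * \<epsilon>"
    and periodic: "\<And>x s. f x (s + T) 0 = f x s 0"
    and mean: "\<And>x. ((\<lambda>s. f x s 0) has_integral T *\<^sub>R g x) {0..T}"
    and KL: "\<beta> \<in> class_KL"
    and averaged_solution: "\<And>x0. \<exists>y. solves_forward (\<lambda>z t. g z) 0 x0 y \<and>
      (\<forall>t\<ge>0. norm (y t - xs) \<le> \<beta> (norm (x0 - xs)) t)"
begin

lemma beta_mono: "0 \<le> r \<Longrightarrow> r \<le> r' \<Longrightarrow> 0 \<le> t \<Longrightarrow> t \<le> t' \<Longrightarrow> \<beta> r t' \<le> \<beta> r' t"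
proof -
  assume *: "0 \<le> r" "r \<le> r'" "0 \<le> t" "t \<le> t'"
  then have "\<beta> r t' \<le> \<beta> r t"
    using KL unfolding class_KL_def monotone_on_def by auto
  also have "\<dots> \<le> \<beta> r' t"
    using KL * unfolding class_KL_def
    by (cases "r = r'") (auto simp: strict_mono_on_def intro: less_imp_le)
  finally show ?thesis .
qed

text \<open>The difference of the two velocities splits into three parts: the zero-mean oscillation
  \<open>h\<close> along \<open>x\<close>, controlled by averaging; the regular perturbation, at
  most \<open>C * \<epsilon>\<close>; and \<open>g (P x) - g (P y)\<close>, at most \<open>L\<close>
  times the error and absorbed by Gronwall. The projection makes the constants valid along
  \<open>x\<close> wherever it goes, while \<open>y\<close> stays in the ball, so that projecting it
  changes nothing.\<close>

lemma averaging_error_bound: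
  assumes R: "0 < R" and \<epsilon>: "0 < \<epsilon>" "\<epsilon> \<le> 1" and \<Theta>: "0 \<le> \<Theta>"
    and const: "0 \<le> L" "0 \<le> C" "0 \<le> K"
    and bounds: "\<And>\<epsilon> s x y. 0 \<le> \<epsilon> \<Longrightarrow> \<epsilon> \<le> 1 \<Longrightarrow> x \<in> cball xs R \<Longrightarrow> y \<in> cball xs R \<Longrightarrow>
      norm (f x s \<epsilon> - f y s \<epsilon>) \<le> L * norm (x - y) \<and> norm (f x s \<epsilon>) \<le> K \<and>
      norm (f x s \<epsilon> - f x s 0) \<le> C * \<epsilon>"
    and x: "solves_forward (\<lambda>z t. f (closest_point (cball xs R) z) (t / \<epsilon>) \<epsilon>) t0 x0 x"
    and y: "solves_forward (\<lambda>z t. g z) 0 x0 y"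
    and yR: "\<And>t. t \<in> {0..\<Theta>} \<Longrightarrow> y t \<in> cball xs R"
    and t: "t \<in> {t0..t0 + \<Theta>}"
  shows "norm (x t - y (t - t0)) \<le> \<epsilon> * ((C * \<Theta> + (2 * L * K * \<Theta> + 2 * K) * T) * exp (L * \<Theta>))"
proof -
  define P where "P = closest_point (cball xs R)"
  have PR: "P z \<in> cball xs R" for z
    unfolding P_def using R by (intro closest_point_in_set) auto
  have P_id: "P z = z" if "z \<in> cball xs R" for z
    unfolding P_def using that by (rule closest_point_self)
  have P_lip: "norm (P z - P w) \<le> norm (z - w)" for z w
    unfolding P_def using closest_point_lipschitz[of "cball xs R" z w] R by (simp add: dist_norm)
  have f_cont: "continuous_on UNIV (\<lambda>t. f z (t / \<epsilon>) e)" if "0 \<le> e" "e \<le> 1" for z e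
    by (rule continuous_on_compose2[OF cont[OF that]]) (use \<epsilon> in \<open>auto intro!: continuous_intros\<close>)
  \<comment> \<open>As a mean of \<open>f\<close> over a period, \<open>g\<close> inherits the
    constants \<open>L\<close> and \<open>K\<close>; the difference \<open>h\<close> then has
    \<open>2 * L\<close> and \<open>2 * K\<close>.\<close>
  have g_lip: "norm (g z - g w) \<le> L * norm (z - w)" if "z \<in> cball xs R" "w \<in> cball xs R" for z w
  proof -
    have "norm (T *\<^sub>R g z - T *\<^sub>R g w) \<le> (L * norm (z - w)) * measure lborel (cbox 0 T)"
      by (rule has_integral_bound[OF _ has_integral_diff[OF mean mean, unfolded box_real(2)[symmetric]]])
         (use bounds[of 0 z w] that const in auto)
    then have "T * norm (g z - g w) \<le> T * (L * norm (z - w))"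
      using T_pos by (simp add: scaleR_diff_right[symmetric] ac_simps)
    then show ?thesis using T_pos by simp
  qed
  have g_bound: "norm (g z) \<le> K" if "z \<in> cball xs R" for z
  proof -
    have "norm (T *\<^sub>R g z) \<le> K * measure lborel (cbox 0 T)"
      by (rule has_integral_bound[OF _ mean[unfolded box_real(2)[symmetric]]])
         (use bounds[of 0 z z] that const in auto)
    then show ?thesis using T_pos by (simp add: ac_simps)
  qed
  define F where "F z t = f (P z) (t / \<epsilon>) \<epsilon>" for z t
  define h where "h z t = f (P z) (t / \<epsilon>) 0 - g (P z)" for z t
  have x: "solves_forward F t0 x0 x" using x unfolding F_def P_def .
  have xc: "continuous_on {t0..} x" by (rule solves_forward_continuous_on[OF x])
  have yc: "continuous_on {0..} y" by (rule solves_forward_continuous_on[OF y])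
  have F_lip: "norm (F z s - F w s) \<le> L * norm (z - w)" for z w s
    unfolding F_def using bounds[of \<epsilon> "P z" "P w" "s / \<epsilon>"] PR \<epsilon> const
      mult_left_mono[OF P_lip[of z w], of L] by auto
  have F_cont: "continuous_on UNIV (F z)" for z
    unfolding F_def using f_cont \<epsilon> by simp
  have Fx_cont: "continuous_on {t0..b} (\<lambda>s. F (x s) s)" for b
    using continuous_on_compose2[OF continuous_on_pair_lipschitz[of F, OF F_cont F_lip], of "{t0..b}" "\<lambda>s. (x s, s)"]
      continuous_on_subset[OF xc] by (simp add: continuous_intros)
  have x_lip: "norm (x b - x a) \<le> K * (b - a)" if "t0 \<le> a" "a \<le> b" for a b
  proof -
    have "((\<lambda>s. F (x s) s) has_integral x b - x a) {a..b}"
    proof (rule fundamental_theorem_of_calculus[OF that(2)])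
      fix s assume "s \<in> {a..b}"
      then have "(x has_vector_derivative F (x s) s) (at s within {t0..})"
        using x that by (simp add: solves_forward_def)
      then show "(x has_vector_derivative F (x s) s) (at s within {a..b})"
        by (rule has_vector_derivative_within_subset) (use that in auto)
    qed
    from has_integral_bound[OF const(3) this[unfolded box_real(2)[symmetric]]]
    show ?thesis using bounds[of \<epsilon> "P (x _)" "P (x _)"] PR \<epsilon> that by (simp add: F_def)
  qed
  have h_lip: "norm (h z s - h w s) \<le> 2 * L * norm (z - w)" for z w s
  proof -
    have "norm (h z s - h w s) \<le> norm (f (P z) (s / \<epsilon>) 0 - f (P w) (s / \<epsilon>) 0) + norm (g (P z) - g (P w))"
      unfolding h_def using norm_triangle_ineq4[of "f (P z) (s / \<epsilon>) 0 - f (P w) (s / \<epsilon>) 0" "g (P z) - g (P w)"]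
      by (simp add: algebra_simps)
    also have "\<dots> \<le> L * norm (P z - P w) + L * norm (P z - P w)"
      using bounds[of 0 "P z" "P w"] g_lip[of "P z" "P w"] PR by (intro add_mono) auto
    also have "\<dots> \<le> 2 * L * norm (z - w)"
      using mult_left_mono[OF P_lip[of z w], of L] const by simp
    finally show ?thesis .
  qed
  have h_cont: "continuous_on UNIV (h z)" for z
    unfolding h_def using f_cont by (intro continuous_intros) auto
  have hx_cont: "continuous_on {t0..b} (\<lambda>s. h (x s) s)" for b
    using continuous_on_compose2[OF continuous_on_pair_lipschitz[of h, OF h_cont h_lip], of "{t0..b}" "\<lambda>s. (x s, s)"]
      continuous_on_subset[OF xc] by (simp add: continuous_intros)
  have avg: "norm (integral {t0..b} (\<lambda>s. h (x s) s)) \<le> ((2 * L) * K * (b - t0) + 2 * K) * (\<epsilon> * T)"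
    if "t0 \<le> b" for b
  proof (rule norm_integral_averaging_le[where p="\<epsilon> * T" and h=h])
    show "h z (s + \<epsilon> * T) = h z s" for z s
      using periodic[of "P z" "s / \<epsilon>"] \<epsilon> by (simp add: h_def add_divide_distrib)
    show "norm (h z s) \<le> 2 * K" for z s
      unfolding h_def using norm_triangle_ineq4[of "f (P z) (s / \<epsilon>) 0" "g (P z)"]
        bounds[of 0 "P z" "P z" "s / \<epsilon>"] g_bound[of "P z"] PR by auto
    show "integral {0..\<epsilon> * T} (h z) = 0" for z
    proof -
      \<comment> \<open>The substitution \<open>s = t / \<epsilon>\<close> turns one period in fast
        time into the slow interval \<open>{0..\<epsilon> * T}\<close>.\<close>
      have "((\<lambda>s. f (P z) ((1 / \<epsilon>) *\<^sub>R s + 0) 0) has_integral (1 / \<bar>1 / \<epsilon>\<bar> ^ DIM(real)) *\<^sub>R (T *\<^sub>R g (P z)))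
          ((\<lambda>s. (1 / (1 / \<epsilon>)) *\<^sub>R s + - ((1 / (1 / \<epsilon>)) *\<^sub>R 0)) ` cbox 0 T)"
        by (rule has_integral_affinity) (use mean \<epsilon> in auto)
      then have "((\<lambda>s. f (P z) (s / \<epsilon>) 0) has_integral (\<epsilon> * T) *\<^sub>R g (P z)) {0..\<epsilon> * T}"
        using \<epsilon> T_pos by (simp add: image_mult_atLeastAtMost)
      moreover have "((\<lambda>s. g (P z)) has_integral (\<epsilon> * T) *\<^sub>R g (P z)) {0..\<epsilon> * T}"
        using has_integral_const_real[of "g (P z)" 0 "\<epsilon> * T"] \<epsilon> T_pos by simp
      ultimately have "(h z has_integral (\<epsilon> * T) *\<^sub>R g (P z) - (\<epsilon> * T) *\<^sub>R g (P z)) {0..\<epsilon> * T}"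
        unfolding h_def by (rule has_integral_diff)
      then have "(h z has_integral 0) {0..\<epsilon> * T}" by simp
      then show ?thesis by (rule integral_unique)
    qed
  qed (use \<epsilon> T_pos const h_cont h_lip x_lip that in auto)
  define \<phi> where "\<phi> s = norm (x s - y (s - t0))" for s
  have ys: "continuous_on {t0..b} (\<lambda>s. y (s - t0))" for b
    by (rule continuous_on_compose2[OF yc]) (auto intro!: continuous_intros)
  have \<phi>_cont: "continuous_on {t0..t0 + \<Theta>} \<phi>"
    unfolding \<phi>_def using continuous_on_subset[OF xc] ys by (intro continuous_intros) auto
  define D where "D = \<epsilon> * (C * \<Theta> + (2 * L * K * \<Theta> + 2 * K) * T)"
  have "\<phi> b \<le> D + L * integral {t0..b} \<phi>" if b: "b \<in> {t0..t0 + \<Theta>}" for b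
  proof -
    have b0: "t0 \<le> b" using b by simp
    have yb: "y (s - t0) \<in> cball xs R" if "s \<in> {t0..b}" for s
      using that b yR[of "s - t0"] by auto
    have Ix: "((\<lambda>s. F (x s) s) has_integral x b - x0) {t0..b}"
      by (rule solves_forward_integral[OF x b0])
    have "((\<lambda>s. g (y (s - t0))) has_integral y (b - t0) - y (t0 - t0)) {t0..b}"
    proof (rule fundamental_theorem_of_calculus[OF b0])
      fix s assume s: "s \<in> {t0..b}"
      have "((\<lambda>s. s - t0) has_vector_derivative 1) (at s within {t0..b})"
        by (auto intro!: derivative_eq_intros)
      moreover have "(y has_vector_derivative g (y (s - t0))) (at (s - t0) within (\<lambda>s. s - t0) ` {t0..b})"
      proof (rule has_vector_derivative_within_subset)
        show "(y has_vector_derivative g (y (s - t0))) (at (s - t0) within {0..})"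
          using y s by (simp add: solves_forward_def)
      qed auto
      ultimately have "(y \<circ> (\<lambda>s. s - t0) has_vector_derivative 1 *\<^sub>R g (y (s - t0))) (at s within {t0..b})"
        by (rule vector_diff_chain_within)
      then show "((\<lambda>s. y (s - t0)) has_vector_derivative g (y (s - t0))) (at s within {t0..b})"
        by (simp add: o_def)
    qed
    moreover have "y 0 = x0" using y by (simp add: solves_forward_def)
    ultimately have Iy: "((\<lambda>s. g (y (s - t0))) has_integral y (b - t0) - x0) {t0..b}" by simp
    have Ih: "((\<lambda>s. h (x s) s) has_integral integral {t0..b} (\<lambda>s. h (x s) s)) {t0..b}"
      by (intro integrable_integral integrable_continuous_real hx_cont)
    have I\<phi>: "(\<phi> has_integral integral {t0..b} \<phi>) {t0..b}"
      using b by (intro integrable_integral integrable_continuous_real continuous_on_subset[OF \<phi>_cont]) auto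
    define rest where "rest s = F (x s) s - g (y (s - t0)) - h (x s) s" for s
    have Ir: "(rest has_integral (x b - x0) - (y (b - t0) - x0) - integral {t0..b} (\<lambda>s. h (x s) s)) {t0..b}"
      unfolding rest_def by (intro has_integral_diff Ix Iy Ih)
    have Ib: "((\<lambda>s. C * \<epsilon> + L * \<phi> s) has_integral (b - t0) *\<^sub>R (C * \<epsilon>) + L * integral {t0..b} \<phi>) {t0..b}"
      using has_integral_const_real[of "C * \<epsilon>" t0 b] b0
      by (intro has_integral_add has_integral_mult_right I\<phi>) auto
    have "norm (rest s) \<le> C * \<epsilon> + L * \<phi> s" if "s \<in> {t0..b}" for s
    proof -
      have "rest s = (f (P (x s)) (s / \<epsilon>) \<epsilon> - f (P (x s)) (s / \<epsilon>) 0) + (g (P (x s)) - g (P (y (s - t0))))"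
        unfolding rest_def F_def h_def using P_id[OF yb[OF that]] by simp
      also have "norm \<dots> \<le> C * \<epsilon> + L * norm (P (x s) - P (y (s - t0)))"
        using bounds[of \<epsilon> "P (x s)" "P (x s)"] PR \<epsilon> g_lip[OF PR PR] by (intro norm_triangle_mono) auto
      also have "\<dots> \<le> C * \<epsilon> + L * \<phi> s"
        unfolding \<phi>_def using const by (intro add_left_mono mult_left_mono P_lip)
      finally show ?thesis .
    qed
    then have "norm (integral {t0..b} rest) \<le> integral {t0..b} (\<lambda>s. C * \<epsilon> + L * \<phi> s)"
      using Ir Ib by (intro Henstock_Kurzweil_Integration.integral_norm_bound_integral) auto
    then have "norm ((x b - x0) - (y (b - t0) - x0) - integral {t0..b} (\<lambda>s. h (x s) s))
        \<le> (b - t0) * (C * \<epsilon>) + L * integral {t0..b} \<phi>"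
      using integral_unique[OF Ir] integral_unique[OF Ib] by simp
    moreover have "\<phi> b \<le> norm ((x b - x0) - (y (b - t0) - x0) - integral {t0..b} (\<lambda>s. h (x s) s))
        + norm (integral {t0..b} (\<lambda>s. h (x s) s))"
      unfolding \<phi>_def using norm_triangle_ineq[of "(x b - x0) - (y (b - t0) - x0) - integral {t0..b} (\<lambda>s. h (x s) s)"
        "integral {t0..b} (\<lambda>s. h (x s) s)"] by simp
    moreover have "(b - t0) * (C * \<epsilon>) \<le> \<Theta> * (C * \<epsilon>)"
      using b const \<epsilon> by (intro mult_right_mono) auto
    moreover have "((2 * L) * K * (b - t0) + 2 * K) * (\<epsilon> * T) \<le> ((2 * L) * K * \<Theta> + 2 * K) * (\<epsilon> * T)"
      using b const \<epsilon> T_pos by (intro mult_right_mono add_right_mono mult_left_mono) auto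
    moreover have "D = \<Theta> * (C * \<epsilon>) + ((2 * L) * K * \<Theta> + 2 * K) * (\<epsilon> * T)"
      by (simp add: D_def algebra_simps)
    ultimately show ?thesis using avg[OF b0] by linarith
  qed
  from gronwall[OF \<phi>_cont const(1) this t]
  have "\<phi> t \<le> D * exp (L * (t - t0))" .
  also have "\<dots> \<le> D * exp (L * \<Theta>)"
  proof -
    have "0 \<le> D" unfolding D_def using \<epsilon> const \<Theta> T_pos by simp
    then show ?thesis using t const by (intro mult_left_mono) (auto intro!: mult_left_mono)
  qed
  finally show ?thesis by (simp add: \<phi>_def D_def ac_simps)
qed

end

lemma solves_forward_restart:
  assumes "solves_forward F t0 x0 x" "t0 \<le> t1"
  shows "solves_forward F t1 (x t1) x"
  unfolding solves_forward_def
proof (intro conjI allI impI)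
  fix t assume t: "t1 \<le> t"
  then have "(x has_vector_derivative F (x t) t) (at t within {t0..})"
    using assms by (simp add: solves_forward_def)
  then show "(x has_vector_derivative F (x t) t) (at t within {t1..})"
    by (rule has_vector_derivative_within_subset) (use assms in auto)
qed simp

text \<open>On a compact interval both trajectories lie in a common ball with one Lipschitz
  constant, and Gronwall with initial error 0 applies. \<open>SGPUAS\<close> quantifies over all
  solutions, so the estimate for a constructed one has to be transferred to every other.\<close>

lemma solves_forward_unique:
  fixes F :: "'a::euclidean_space \<Rightarrow> real \<Rightarrow> 'a"
  assumes lip: "\<And>R. \<exists>L. \<forall>t. \<forall>y\<in>cball c R. \<forall>z\<in>cball c R. norm (F y t - F z t) \<le> L * norm (y - z)"
    and y: "solves_forward F t0 x0 y" and z: "solves_forward F t0 x0 z" and t: "t0 \<le> t"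
  shows "y t = z t"
proof -
  have cont: "continuous_on {t0..t} y" "continuous_on {t0..t} z"
    using solves_forward_continuous_on[OF y] solves_forward_continuous_on[OF z]
    by (auto intro: continuous_on_subset)
  then have "compact (y ` {t0..t} \<union> z ` {t0..t})"
    by (intro compact_Un compact_continuous_image) auto
  then obtain R where R: "y ` {t0..t} \<union> z ` {t0..t} \<subseteq> cball c R"
    using bounded_subset_ballD[OF compact_imp_bounded, of _ c] ball_subset_cball by (metis order_trans)
  obtain L where L: "\<And>s v w. v \<in> cball c R \<Longrightarrow> w \<in> cball c R \<Longrightarrow> norm (F v s - F w s) \<le> L * norm (v - w)"
    using lip[of R] by blast
  define \<phi> where "\<phi> s = norm (y s - z s)" for s
  have \<phi>: "continuous_on {t0..t} \<phi>" unfolding \<phi>_def by (intro continuous_intros cont)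
  have "\<phi> b \<le> 0 + \<bar>L\<bar> * integral {t0..b} \<phi>" if b: "b \<in> {t0..t}" for b
  proof -
    have b0: "t0 \<le> b" using b by simp
    have I: "((\<lambda>s. F (y s) s - F (z s) s) has_integral (y b - x0) - (z b - x0)) {t0..b}"
      by (intro has_integral_diff solves_forward_integral y z b0)
    have I\<phi>: "((\<lambda>s. \<bar>L\<bar> * \<phi> s) has_integral \<bar>L\<bar> * integral {t0..b} \<phi>) {t0..b}"
      using b by (intro has_integral_mult_right integrable_integral integrable_continuous_real
          continuous_on_subset[OF \<phi>]) auto
    have "norm (integral {t0..b} (\<lambda>s. F (y s) s - F (z s) s)) \<le> integral {t0..b} (\<lambda>s. \<bar>L\<bar> * \<phi> s)"
    proof (rule Henstock_Kurzweil_Integration.integral_norm_bound_integral)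
      fix s assume s: "s \<in> {t0..b}"
      have "norm (F (y s) s - F (z s) s) \<le> L * \<phi> s"
        unfolding \<phi>_def using b s by (intro L subsetD[OF R]) auto
      also have "\<dots> \<le> \<bar>L\<bar> * \<phi> s" by (intro mult_right_mono) (auto simp: \<phi>_def)
      finally show "norm (F (y s) s - F (z s) s) \<le> \<bar>L\<bar> * \<phi> s" .
    qed (use I I\<phi> in auto)
    then show ?thesis unfolding integral_unique[OF I] integral_unique[OF I\<phi>] by (simp add: \<phi>_def)
  qed
  from gronwall[OF \<phi> abs_ge_zero this, of t] show ?thesis using t by (simp add: \<phi>_def)
qed

context averaged_system
begin

theorem averaging_SGPUAS: "SGPUAS (\<lambda>x t \<epsilon> \<delta>. f x (t / \<epsilon>) \<epsilon>) xs"
  unfolding SGPUAS_def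
proof (intro bexI[of _ \<beta>] allI impI)
  fix r \<sigma> :: real assume r: "0 < r" and \<sigma>: "0 < \<sigma>"
  have \<beta>_nonneg: "0 \<le> \<beta> s t" if "0 \<le> s" "0 \<le> t" for s t
    using KL that by (auto simp: class_KL_def)
  have "continuous_on {0..} (\<lambda>s. \<beta> s 0)"
  proof -
    have "continuous_on ({0..} \<times> {0..}) (\<lambda>(r, t). \<beta> r t)" using KL by (simp add: class_KL_def)
    from continuous_on_compose2[OF this, of "{0..}" "\<lambda>s. (s, 0)"]
    show ?thesis by (simp add: continuous_intros image_subset_iff)
  qed
  then obtain d where d: "0 < d" "\<And>s. 0 \<le> s \<Longrightarrow> dist s 0 < d \<Longrightarrow> dist (\<beta> s 0) (\<beta> 0 0) < \<sigma> / 2"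
    using \<sigma> unfolding continuous_on_iff by (metis atLeast_iff half_gt_zero order_refl)
  \<comment> \<open>Continuity of \<open>\<beta> s 0\<close> at \<open>s = 0\<close>: after a
    restart within \<open>\<sigma>1\<close> the averaged motion never exceeds
    \<open>\<sigma> / 2\<close>.\<close>
  define \<sigma>1 where "\<sigma>1 = min (d / 2) \<sigma>"
  have \<sigma>1: "0 < \<sigma>1" "\<sigma>1 \<le> \<sigma>" "\<sigma>1 < d" using d \<sigma> by (auto simp: \<sigma>1_def)
  have "\<beta> 0 0 = 0" using KL by (auto simp: class_KL_def)
  then have \<beta>\<sigma>1: "\<beta> \<sigma>1 0 \<le> \<sigma> / 2" using d(2)[of \<sigma>1] \<sigma>1 by (auto simp: dist_real_def)
  \<comment> \<open>\<open>r'\<close> covers both the first start, within \<open>r\<close>, and all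
    restarts, within \<open>\<sigma>1\<close>.\<close>
  define r' where "r' = max r \<sigma>1"
  have r': "0 \<le> r'" "r \<le> r'" "\<sigma>1 \<le> r'" using r by (auto simp: r'_def)
  have "(\<beta> r' \<longlongrightarrow> 0) at_top" using KL r' by (auto simp: class_KL_def)
  then have "\<forall>\<^sub>F t in at_top. \<beta> r' t < \<sigma>1 / 2" using \<sigma>1 by (intro order_tendstoD) auto
  then obtain N where N: "\<And>t. N \<le> t \<Longrightarrow> \<beta> r' t < \<sigma>1 / 2" by (auto simp: eventually_at_top_linorder)
  define \<Theta> where "\<Theta> = max N 1"
  have \<Theta>: "0 < \<Theta>" "\<beta> r' \<Theta> < \<sigma>1 / 2" using N[of \<Theta>] by (auto simp: \<Theta>_def)
  \<comment> \<open>\<open>\<beta> r' 0\<close> bounds the averaged solution on each interval. The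
    extra \<open>\<sigma>1\<close> leaves room for the averaging error \<open>\<sigma>1 / 2\<close>,
    so that the solution of the projected system remains in the ball.\<close>
  define R where "R = \<beta> r' 0 + \<sigma>1"
  have R: "0 < R" using \<beta>_nonneg[of r' 0] r' \<sigma>1 by (simp add: R_def)
  obtain L0 K0 C0 where LKC: "\<forall>\<epsilon>\<in>{0..1}. \<forall>s. \<forall>x\<in>cball xs R. \<forall>y\<in>cball xs R.
      norm (f x s \<epsilon> - f y s \<epsilon>) \<le> L0 * norm (x - y) \<and> norm (f x s \<epsilon>) \<le> K0 \<and>
      norm (f x s \<epsilon> - f x s 0) \<le> C0 * \<epsilon>"
    using local_bounds[of R] by blast
  define L where "L = \<bar>L0\<bar>"
  define K where "K = \<bar>K0\<bar>"
  define C where "C = \<bar>C0\<bar>"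
  have const: "0 \<le> L" "0 \<le> C" "0 \<le> K" by (auto simp: L_def K_def C_def)
  have bounds: "norm (f x s \<epsilon> - f y s \<epsilon>) \<le> L * norm (x - y) \<and> norm (f x s \<epsilon>) \<le> K \<and>
      norm (f x s \<epsilon> - f x s 0) \<le> C * \<epsilon>"
    if "0 \<le> \<epsilon>" "\<epsilon> \<le> 1" "x \<in> cball xs R" "y \<in> cball xs R" for \<epsilon> s x y
  proof -
    have *: "norm (f x s \<epsilon> - f y s \<epsilon>) \<le> L0 * norm (x - y)" "norm (f x s \<epsilon>) \<le> K0"
      "norm (f x s \<epsilon> - f x s 0) \<le> C0 * \<epsilon>"
      using LKC that by auto
    have "L0 * norm (x - y) \<le> L * norm (x - y)" "C0 * \<epsilon> \<le> C * \<epsilon>"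
      using that by (auto simp: L_def C_def intro!: mult_right_mono)
    with * show ?thesis by (auto simp: K_def)
  qed
  define B where "B = (C * \<Theta> + (2 * L * K * \<Theta> + 2 * K) * T) * exp (L * \<Theta>)"
  have B: "0 \<le> B" unfolding B_def using const \<Theta> T_pos by simp
  \<comment> \<open>The cap 1 is the range in which the bounds hold. The other value makes
    \<open>\<epsilon> * B \<le> \<sigma>1 / 2\<close>, with \<open>B + 1\<close> in the denominator
    because \<open>B\<close> may vanish.\<close>
  define \<epsilon>0 where "\<epsilon>0 = min 1 (\<sigma>1 / (2 * (B + 1)))"
  have \<epsilon>0: "0 < \<epsilon>0" using \<sigma>1 B by (simp add: \<epsilon>0_def)
  have "(\<exists>x. solves_forward (\<lambda>y t. f y (t / \<epsilon>) \<epsilon>) t0 x0 x) \<and>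
      (\<forall>x. solves_forward (\<lambda>y t. f y (t / \<epsilon>) \<epsilon>) t0 x0 x \<longrightarrow>
         (\<forall>t\<ge>t0. norm (x t - xs) \<le> \<beta> (norm (x0 - xs)) (t - t0) + \<sigma>))"
    (is "?P \<epsilon> x0 t0")
    if \<epsilon>: "\<epsilon> \<in> {0<..<\<epsilon>0}" and x0: "norm (x0 - xs) \<le> r" for \<epsilon> x0 t0
  proof -
    have \<epsilon>1: "0 < \<epsilon>" "\<epsilon> \<le> 1" using \<epsilon> by (auto simp: \<epsilon>0_def)
    have "\<epsilon> * (B + 1) \<le> \<sigma>1 / (2 * (B + 1)) * (B + 1)"
      using \<epsilon> B by (intro mult_right_mono) (auto simp: \<epsilon>0_def)
    also have "\<dots> = \<sigma>1 / 2" using B by (simp add: field_simps)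
    finally have \<epsilon>B: "\<epsilon> * B \<le> \<sigma>1 / 2" using \<epsilon>1 by (simp add: algebra_simps)
    define P where "P = closest_point (cball xs R)"
    have PR: "P z \<in> cball xs R" for z
      unfolding P_def using R by (intro closest_point_in_set) auto
    define F where "F z t = f (P z) (t / \<epsilon>) \<epsilon>" for z t
    have F_lip: "norm (F z s - F w s) \<le> L * norm (z - w)" for z w s
    proof -
      have "norm (F z s - F w s) \<le> L * norm (P z - P w)"
        unfolding F_def using bounds PR \<epsilon>1 by auto
      also have "\<dots> \<le> L * norm (z - w)"
        unfolding P_def using closest_point_lipschitz[of "cball xs R" z w] R const
        by (intro mult_left_mono) (auto simp: dist_norm)
      finally show ?thesis .
    qed
    have F_cont: "continuous_on UNIV (F z)" for z
      unfolding F_def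
      by (rule continuous_on_compose2[OF cont]) (use \<epsilon>1 in \<open>auto intro!: continuous_intros\<close>)
    have F_bound: "norm (F z s) \<le> K" for z s
      unfolding F_def using bounds[OF _ _ PR PR] \<epsilon>1 by auto
    obtain x where x: "solves_forward F t0 x0 x"
      using solves_forward_exists[of F, OF F_cont F_lip F_bound] by blast
    have segment: "norm (x t - xs) \<le> \<beta> (norm (x t1 - xs)) (t - t1) + \<sigma>1 / 2"
      if "t0 \<le> t1" "norm (x t1 - xs) \<le> r'" "t \<in> {t1..t1 + \<Theta>}" for t1 t
    proof -
      obtain y where y: "solves_forward (\<lambda>z t. g z) 0 (x t1) y"
          "\<And>t. 0 \<le> t \<Longrightarrow> norm (y t - xs) \<le> \<beta> (norm (x t1 - xs)) t"
        using averaged_solution by blast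
      have "y s \<in> cball xs R" if "s \<in> {0..\<Theta>}" for s
      proof -
        have "norm (y s - xs) \<le> \<beta> (norm (x t1 - xs)) s" using y that by auto
        also have "\<dots> \<le> \<beta> r' 0" using that \<open>norm (x t1 - xs) \<le> r'\<close> by (intro beta_mono) auto
        also have "\<dots> \<le> R" using \<sigma>1 by (simp add: R_def)
        finally show ?thesis by (simp add: dist_norm norm_minus_commute)
      qed
      moreover have "solves_forward (\<lambda>z t. f (closest_point (cball xs R) z) (t / \<epsilon>) \<epsilon>) t1 (x t1) x"
        using solves_forward_restart[OF x \<open>t0 \<le> t1\<close>] by (simp add: F_def[abs_def] P_def)
      ultimately have "norm (x t - y (t - t1)) \<le> \<epsilon> * B"
        unfolding B_def using averaging_error_bound[OF R \<epsilon>1 _ const bounds _ y(1) _ that(3)] \<Theta> by auto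
      then have "norm (x t - y (t - t1)) \<le> \<sigma>1 / 2" using \<epsilon>B by simp
      moreover have "norm (y (t - t1) - xs) \<le> \<beta> (norm (x t1 - xs)) (t - t1)"
        using y that by auto
      ultimately show ?thesis
        using norm_triangle_ineq[of "x t - y (t - t1)" "y (t - t1) - xs"] by simp
    qed
    \<comment> \<open>Only the first interval may start at distance up to \<open>r\<close>. At every
      later grid time the distance is at most
      \<open>\<beta> r' \<Theta> + \<sigma>1 / 2 \<le> \<sigma>1\<close>, so the errors of
      successive intervals do not accumulate.\<close>
    have grid: "norm (x (t0 + real k * \<Theta>) - xs) \<le> (if k = 0 then norm (x0 - xs) else \<sigma>1)" for k
    proof (induction k)
      case 0
      then show ?case using x by (simp add: solves_forward_def)
    next
      case (Suc k)
      define t1 where "t1 = t0 + real k * \<Theta>"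
      have t1: "t0 \<le> t1" using \<Theta> by (simp add: t1_def)
      have le: "norm (x t1 - xs) \<le> r'"
        using Suc x0 r' by (auto simp: t1_def split: if_splits)
      have "norm (x (t1 + \<Theta>) - xs) \<le> \<beta> (norm (x t1 - xs)) (t1 + \<Theta> - t1) + \<sigma>1 / 2"
        using segment[OF t1 le, of "t1 + \<Theta>"] \<Theta> by simp
      also have "\<dots> \<le> \<beta> r' \<Theta> + \<sigma>1 / 2"
        using le \<Theta> by (intro add_right_mono beta_mono) auto
      also have "\<dots> \<le> \<sigma>1" using \<Theta> by simp
      finally show ?case by (simp add: t1_def algebra_simps)
    qed
    have main: "norm (x t - xs) \<le> \<beta> (norm (x0 - xs)) (t - t0) + \<sigma> \<and> norm (x t - xs) \<le> R"
      if t: "t0 \<le> t" for t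
    proof -
      define k where "k = nat \<lfloor>(t - t0) / \<Theta>\<rfloor>"
      have "real k \<le> (t - t0) / \<Theta>" "(t - t0) / \<Theta> < real k + 1"
        using t \<Theta> by (auto simp: k_def)
      then have k: "real k * \<Theta> \<le> t - t0" "t - t0 \<le> real k * \<Theta> + \<Theta>"
        using \<Theta> by (auto simp: field_simps)
      define t1 where "t1 = t0 + real k * \<Theta>"
      have t1: "t0 \<le> t1" "t \<in> {t1..t1 + \<Theta>}" using k \<Theta> by (auto simp: t1_def)
      have le: "norm (x t1 - xs) \<le> r'"
        using grid[of k] x0 r' by (auto simp: t1_def split: if_splits)
      have *: "norm (x t - xs) \<le> \<beta> (norm (x t1 - xs)) (t - t1) + \<sigma>1 / 2"
        by (rule segment[OF t1(1) le t1(2)])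
      also have "\<dots> \<le> \<beta> r' 0 + \<sigma>1 / 2"
        using le t1 by (intro add_right_mono beta_mono) auto
      finally have "norm (x t - xs) \<le> R" using \<sigma>1 by (simp add: R_def)
      moreover have "norm (x t - xs) \<le> \<beta> (norm (x0 - xs)) (t - t0) + \<sigma>"
      proof (cases "k = 0")
        case True
        then show ?thesis using * \<sigma>1 x by (simp add: t1_def solves_forward_def)
      next
        case False
        \<comment> \<open>From the second interval on the slack alone is enough:
          \<open>\<beta> \<sigma>1 0 + \<sigma>1 / 2 \<le> \<sigma>\<close>. Of the term with the
          original initial distance only nonnegativity is used.\<close>
        have "norm (x t - xs) \<le> \<beta> \<sigma>1 0 + \<sigma>1 / 2"
          using * grid[of k] False t1 beta_mono[of "norm (x t1 - xs)" \<sigma>1 0 "t - t1"]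
          by (simp add: t1_def)
        then show ?thesis using \<beta>\<sigma>1 \<sigma>1 \<beta>_nonneg[of "norm (x0 - xs)" "t - t0"] t by simp
      qed
      ultimately show ?thesis by simp
    qed
    \<comment> \<open>\<open>main\<close> confines \<open>x\<close> to the ball, where the
      projection is the identity. Hence the solution of the projected system solves the original one
      for all forward times.\<close>
    have sol: "solves_forward (\<lambda>y t. f y (t / \<epsilon>) \<epsilon>) t0 x0 x"
      unfolding solves_forward_def
    proof (intro conjI allI impI)
      fix t assume t: "t0 \<le> t"
      have "P (x t) = x t"
        unfolding P_def using main[OF t] by (intro closest_point_self) (simp add: dist_norm norm_minus_commute)
      then show "(x has_vector_derivative f (x t) (t / \<epsilon>) \<epsilon>) (at t within {t0..})"
        using x t unfolding solves_forward_def F_def by metis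
    qed (use x in \<open>simp add: solves_forward_def\<close>)
    have "z t = x t" if "solves_forward (\<lambda>y t. f y (t / \<epsilon>) \<epsilon>) t0 x0 z" "t0 \<le> t" for z t
    proof (rule solves_forward_unique[OF _ that(1) sol that(2), of xs])
      fix S
      obtain L where "\<forall>\<epsilon>\<in>{0..1}. \<forall>s. \<forall>x\<in>cball xs S. \<forall>y\<in>cball xs S. norm (f x s \<epsilon> - f y s \<epsilon>) \<le> L * norm (x - y)"
        using local_bounds[of S] by metis
      then show "\<exists>L. \<forall>t. \<forall>y\<in>cball xs S. \<forall>z\<in>cball xs S.
          norm (f y (t / \<epsilon>) \<epsilon> - f z (t / \<epsilon>) \<epsilon>) \<le> L * norm (y - z)"
        using \<epsilon>1 by (intro exI[of _ L]) auto
    qed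
    then show ?thesis using sol main by metis
  qed
  then have Q: "\<exists>\<epsilon>0>0. \<forall>\<epsilon>\<in>{0<..<\<epsilon>0}. \<forall>x0. norm (x0 - xs) \<le> r \<longrightarrow> (\<forall>t0. ?P \<epsilon> x0 t0)" (is ?Q)
    using \<epsilon>0 by (intro exI[of _ \<epsilon>0]) simp
  show "\<exists>\<delta>0>0::real. \<forall>\<delta>\<in>{0<..<\<delta>0}. ?Q"
  proof (intro exI conjI)
    show "\<forall>\<delta>\<in>{0<..<1::real}. ?Q" by (rule ballI) (rule Q)
  qed simp
qed (rule KL)

end

section \<open>Cascades\<close>

text \<open>\<open>\<gamma> s\<close> is the supremum of the deviation over the ball of radius
  \<open>s\<close>. Writing its points as \<open>a + s *\<^sub>R w\<close> with \<open>w\<close> in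
  the fixed unit ball keeps the index set independent of \<open>s\<close>, so continuity of
  \<open>\<gamma>\<close> follows from uniform continuity on a compact product.\<close>

lemma modulus_of_continuity_at:
  fixes f :: "'a::euclidean_space \<Rightarrow> real"
  assumes f: "continuous_on UNIV f"
  obtains \<gamma> :: "real \<Rightarrow> real" where "continuous_on {0..} \<gamma>" "mono_on {0..} \<gamma>" "\<gamma> 0 = 0"
    "\<And>x. \<bar>f x - f a\<bar> \<le> \<gamma> (norm (x - a))"
proof
  define G where "G s w = \<bar>f (a + s *\<^sub>R w) - f a\<bar>" for s :: real and w
  define \<gamma> where "\<gamma> s = (SUP w\<in>cball 0 1. G s w)" for s
  have cont: "continuous_on S (\<lambda>(s, w). G s w)" for S
    unfolding G_def case_prod_unfold
    by (intro continuous_intros continuous_on_compose2[OF f]) auto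
  have bdd: "bdd_above (G s ` cball 0 1)" for s
  proof -
    have "continuous_on (cball 0 1) (G s)"
      using continuous_on_compose2[OF cont[of UNIV], of "cball 0 1" "\<lambda>w. (s, w)"]
      by (simp add: continuous_intros)
    then have "compact (G s ` cball 0 1)" by (intro compact_continuous_image) auto
    then show ?thesis by (intro bounded_imp_bdd_above compact_imp_bounded)
  qed
  have upper: "G s w \<le> \<gamma> s" if "w \<in> cball 0 1" for s w
    unfolding \<gamma>_def using that bdd by (rule cSUP_upper)
  have least: "\<gamma> s \<le> b" if "\<And>w. w \<in> cball 0 1 \<Longrightarrow> G s w \<le> b" for s b
    unfolding \<gamma>_def using that by (intro cSUP_least) auto
  show "\<gamma> 0 = 0"
    using upper[of 0 0] by (intro antisym least) (auto simp: G_def)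
  show "mono_on {0..} \<gamma>"
  proof (rule mono_onI)
    fix s t :: real assume st: "s \<in> {0..}" "t \<in> {0..}" "s \<le> t"
    show "\<gamma> s \<le> \<gamma> t"
    proof (cases "t = 0")
      case False
      show ?thesis
      proof (rule least)
        fix w :: 'a assume w: "w \<in> cball 0 1"
        \<comment> \<open>Shrinking \<open>w\<close> by \<open>s / t \<le> 1\<close> stays in the
          unit ball and describes the same point at radius \<open>t\<close>. The case
          \<open>t = 0\<close> is set apart because of this division.\<close>
        have "G s w = G t ((s / t) *\<^sub>R w)" using False by (simp add: G_def)
        also have "\<dots> \<le> \<gamma> t"
        proof (rule upper)
          have "s / t \<le> 1" using st False by simp
          then have "(s / t) * norm w \<le> 1 * 1" using st w by (intro mult_mono) auto
          then show "(s / t) *\<^sub>R w \<in> cball 0 1" using st by simp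
        qed
        finally show "G s w \<le> \<gamma> t" .
      qed
    qed (use st in simp)
  qed
  show "\<bar>f x - f a\<bar> \<le> \<gamma> (norm (x - a))" for x
  proof (cases "x = a")
    case False
    then have "G (norm (x - a)) (sgn (x - a)) = \<bar>f x - f a\<bar>"
      by (simp add: G_def sgn_div_norm)
    then show ?thesis using upper[of "sgn (x - a)" "norm (x - a)"] by (simp add: norm_sgn)
  qed (simp add: \<open>\<gamma> 0 = 0\<close>)
  show "continuous_on {0..} \<gamma>"
    unfolding continuous_on_iff
  proof (intro ballI allI impI)
    fix s e :: real assume s: "s \<in> {0..}" and e: "0 < e"
    have "compact ({0..s + 1} \<times> cball (0::'a) 1)" by (intro compact_Times) auto
    then have "uniformly_continuous_on ({0..s + 1} \<times> cball 0 1) (\<lambda>(s, w). G s w)"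
      by (intro compact_uniformly_continuous cont)
    then obtain d where d: "0 < d"
      "\<And>p q. p \<in> {0..s + 1} \<times> cball 0 1 \<Longrightarrow> q \<in> {0..s + 1} \<times> cball 0 1 \<Longrightarrow> dist q p < d \<Longrightarrow>
        dist ((\<lambda>(s, w). G s w) q) ((\<lambda>(s, w). G s w) p) < e / 2"
      unfolding uniformly_continuous_on_def using e by (meson half_gt_zero)
    have "dist (\<gamma> t) (\<gamma> s) < e" if t: "t \<in> {0..}" "dist t s < min d 1" for t
    proof -
      have close: "\<bar>G t w - G s w\<bar> < e / 2" if "w \<in> cball 0 1" for w
        using d(2)[of "(s, w)" "(t, w)"] that s t by (auto simp: dist_Pair_Pair dist_real_def)
      have "\<gamma> t \<le> \<gamma> s + e / 2"
        using close upper by (intro least) (smt (verit))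
      moreover have "\<gamma> s \<le> \<gamma> t + e / 2"
        using close upper by (intro least) (smt (verit))
      ultimately show ?thesis using e by (simp add: dist_real_def abs_le_iff abs_less_iff)
    qed
    then show "\<exists>d>0. \<forall>t\<in>{0..}. dist t s < d \<longrightarrow> dist (\<gamma> t) (\<gamma> s) < e"
      using d(1) by (intro exI[of _ "min d 1"]) auto
  qed
qed

text \<open>The weight \<open>\<omega> * exp (\<omega> * s)\<close> has the antiderivative
  \<open>exp (\<omega> * s)\<close>. After multiplication by \<open>exp (- \<omega> * t)\<close> it
  carries mass at most \<open>exp (- \<omega> * t / 2)\<close> on the first half of the interval and
  at most 1 on the second. Thus old input is forgotten exponentially and recent input enters through
  its own bound.\<close>

lemma weighted_integral_bound:
  fixes w :: "real \<Rightarrow> real"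
  assumes \<omega>: "0 < \<omega>" and t: "0 \<le> t" and w: "continuous_on {0..} w"
    and b: "\<And>s. s \<in> {0..t / 2} \<Longrightarrow> \<bar>w s\<bar> \<le> b" and b': "\<And>s. s \<in> {t / 2..t} \<Longrightarrow> \<bar>w s\<bar> \<le> b'"
  shows "exp (- \<omega> * t) * \<bar>integral {0..t} (\<lambda>s. \<omega> * exp (\<omega> * s) * w s)\<bar>
    \<le> exp (- \<omega> * t / 2) * b + b'"
proof -
  define h where "h s = \<omega> * exp (\<omega> * s) * w s" for s
  have h: "h integrable_on {x..y}" if "0 \<le> x" for x y
    unfolding h_def using that continuous_on_subset[OF w]
    by (intro integrable_continuous_real continuous_intros) auto
  have I: "((\<lambda>s. \<omega> * exp (\<omega> * s) * c) has_integral exp (\<omega> * y) * c - exp (\<omega> * x) * c) {x..y}"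
    if "x \<le> y" for x y c
  proof (rule fundamental_theorem_of_calculus[OF that])
    fix s
    have "((\<lambda>s. exp (\<omega> * s) * c) has_real_derivative \<omega> * exp (\<omega> * s) * c) (at s within {x..y})"
      by (auto intro!: derivative_eq_intros)
    then show "((\<lambda>s. exp (\<omega> * s) * c) has_vector_derivative \<omega> * exp (\<omega> * s) * c) (at s within {x..y})"
      by (simp add: has_real_derivative_iff_has_vector_derivative)
  qed
  have bound: "\<bar>integral {x..y} h\<bar> \<le> exp (\<omega> * y) * c - exp (\<omega> * x) * c"
    if "0 \<le> x" "x \<le> y" and c: "\<And>s. s \<in> {x..y} \<Longrightarrow> \<bar>w s\<bar> \<le> c" for x y c
  proof -
    have "norm (integral {x..y} h) \<le> integral {x..y} (\<lambda>s. \<omega> * exp (\<omega> * s) * c)"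
      using I[OF that(2)] \<omega> c
      by (intro Henstock_Kurzweil_Integration.integral_norm_bound_integral h that)
         (auto simp: h_def abs_mult intro!: mult_left_mono)
    then show ?thesis using integral_unique[OF I[OF that(2), of c]] by simp
  qed
  have nn: "0 \<le> b" "0 \<le> b'" using b[of 0] b'[of t] t by auto
  have "\<bar>integral {0..t / 2} h\<bar> \<le> exp (\<omega> * (t / 2)) * b"
    using bound[of 0 "t / 2" b] b t nn by simp
  moreover have "\<bar>integral {t / 2..t} h\<bar> \<le> exp (\<omega> * t) * b'"
    using bound[of "t / 2" t b'] b' t mult_nonneg_nonneg[OF exp_ge_zero nn(2), of "\<omega> * (t / 2)"] by auto
  moreover have "integral {0..t / 2} h + integral {t / 2..t} h = integral {0..t} h"
    using t by (intro Henstock_Kurzweil_Integration.integral_combine h) auto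
  ultimately have "\<bar>integral {0..t} h\<bar> \<le> exp (\<omega> * (t / 2)) * b + exp (\<omega> * t) * b'" by linarith
  then have "exp (- \<omega> * t) * \<bar>integral {0..t} h\<bar> \<le> exp (- \<omega> * t) * (exp (\<omega> * (t / 2)) * b + exp (\<omega> * t) * b')"
    by (intro mult_left_mono) auto
  also have "\<dots> = exp (- \<omega> * t + \<omega> * (t / 2)) * b + exp (- \<omega> * t + \<omega> * t) * b'"
    by (simp only: distrib_left mult.assoc[symmetric] exp_add[symmetric])
  also have "\<dots> = exp (- \<omega> * t / 2) * b + b'" by (simp add: algebra_simps)
  finally show ?thesis by (simp add: h_def[abs_def])
qed

text \<open>The last two summands come from splitting the convolution of the filter input with
  \<open>exp (- \<omega> * t)\<close> at \<open>t / 2\<close>.\<close>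

lemma class_KL_cascade:
  assumes \<beta>: "\<beta> \<in> class_KL" and \<omega>: "0 < \<omega>"
    and \<gamma>: "continuous_on {0..} \<gamma>" "mono_on {0..} \<gamma>" "\<gamma> 0 = 0"
  shows "(\<lambda>r t. \<beta> r t + exp (- \<omega> * t) * r + exp (- \<omega> * t / 2) * \<gamma> (\<beta> r 0) + \<gamma> (\<beta> r (t / 2))) \<in> class_KL"
    (is "?B \<in> _")
proof -
  have c: "continuous_on ({0..} \<times> {0..}) (\<lambda>(r, t). \<beta> r t)" and nn: "\<And>r t. 0 \<le> r \<Longrightarrow> 0 \<le> t \<Longrightarrow> 0 \<le> \<beta> r t"
    and z: "\<And>t. 0 \<le> t \<Longrightarrow> \<beta> 0 t = 0" and sm: "\<And>t. 0 \<le> t \<Longrightarrow> strict_mono_on {0..} (\<lambda>r. \<beta> r t)"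
    and am: "\<And>r. 0 \<le> r \<Longrightarrow> antimono_on {0..} (\<beta> r)" and lim: "\<And>r. 0 \<le> r \<Longrightarrow> (\<beta> r \<longlongrightarrow> 0) at_top"
    using \<beta> by (auto simp: class_KL_def)
  have less: "\<beta> r t < \<beta> r' t" if "0 \<le> r" "r < r'" "0 \<le> t" for r r' t
    using sm[OF that(3)] that by (auto simp: strict_mono_on_def)
  have anti: "\<beta> r t' \<le> \<beta> r t" if "0 \<le> r" "0 \<le> t" "t \<le> t'" for r t t'
    using am[OF that(1)] that by (auto simp: monotone_on_def)
  have mono: "\<gamma> x \<le> \<gamma> y" if "0 \<le> x" "x \<le> y" for x y
    using \<gamma>(2) that by (auto simp: monotone_on_def)
  have \<gamma>nn: "0 \<le> \<gamma> x" if "0 \<le> x" for x using mono[of 0 x] that \<gamma>(3) by simp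
  have cont: "continuous_on ({0..} \<times> {0..}) (\<lambda>p. \<beta> (a p) (b p))"
    if "continuous_on ({0..} \<times> {0..}) a" "continuous_on ({0..} \<times> {0..}) b"
      "\<And>p. p \<in> {0..} \<times> {0..} \<Longrightarrow> 0 \<le> a p \<and> 0 \<le> b p" for a b :: "real \<times> real \<Rightarrow> real"
    using continuous_on_compose2[OF c, of "{0..} \<times> {0..}" "\<lambda>p. (a p, b p)"] that
    by (simp add: continuous_intros image_subset_iff)
  have "continuous_on ({0..} \<times> {0..}) (\<lambda>(r, t). ?B r t)"
    unfolding case_prod_unfold
    by (intro continuous_intros cont continuous_on_compose2[OF \<gamma>(1)]) (auto intro!: nn)
  moreover have "0 \<le> ?B r t" if "0 \<le> r" "0 \<le> t" for r t
    using that by (intro add_nonneg_nonneg mult_nonneg_nonneg \<gamma>nn nn) auto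
  moreover have "?B 0 t = 0" if "0 \<le> t" for t using that by (simp add: z \<gamma>)
  moreover have "strict_mono_on {0..} (\<lambda>r. ?B r t)" if t: "0 \<le> t" for t
  proof (rule strict_mono_onI)
    fix r r' :: real assume "r \<in> {0..}" "r' \<in> {0..}" and r: "r < r'"
    then have r0: "0 \<le> r" by simp
    have "\<gamma> (\<beta> r s) \<le> \<gamma> (\<beta> r' s)" if "0 \<le> s" for s
      using less[OF r0 r that] by (intro mono nn r0 that) simp
    \<comment> \<open>Strict growth is taken from the first summand; \<open>\<gamma>\<close> is
      merely monotone.\<close>
    then show "?B r t < ?B r' t"
      using less[OF r0 r t] r t by (intro add_less_le_mono mult_left_mono) auto
  qed
  moreover have "antimono_on {0..} (?B r)" if r: "0 \<le> r" for r
  proof (rule monotone_onI)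
    fix t t' :: real assume "t \<in> {0..}" "t' \<in> {0..}" and t: "t \<le> t'"
    then have t0: "0 \<le> t" by simp
    show "?B r t' \<le> ?B r t"
    proof (intro add_mono mult_right_mono mono anti \<gamma>nn nn r)
      show "exp (- \<omega> * t') \<le> exp (- \<omega> * t)" "exp (- \<omega> * t' / 2) \<le> exp (- \<omega> * t / 2)"
        using t \<omega> by auto
    qed (use t0 t r in auto)
  qed
  moreover have "(?B r \<longlongrightarrow> 0) at_top" if r: "0 \<le> r" for r
  proof -
    have half: "filterlim (\<lambda>t::real. t / 2) at_top at_top"
      using filterlim_tendsto_pos_mult_at_top[OF tendsto_const[of "1 / 2 :: real"] _ filterlim_ident] by simp
    have ex: "((\<lambda>t. exp (- a * t)) \<longlongrightarrow> 0) at_top" if "0 < a" for a :: real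
    proof -
      have "filterlim (\<lambda>t. - a * t) at_bot at_top"
        using that by (intro filterlim_tendsto_neg_mult_at_bot[OF tendsto_const _ filterlim_ident]) auto
      then show ?thesis by (rule filterlim_compose[OF exp_at_bot])
    qed
    have bh: "((\<lambda>t. \<beta> r (t / 2)) \<longlongrightarrow> 0) at_top"
      by (rule filterlim_compose[OF lim[OF r] half])
    have "((\<lambda>t. \<gamma> (\<beta> r (t / 2))) \<longlongrightarrow> \<gamma> 0) at_top"
    proof (rule continuous_on_tendsto_compose[OF \<gamma>(1) bh])
      show "\<forall>\<^sub>F t in at_top. \<beta> r (t / 2) \<in> {0..}"
        using eventually_ge_at_top[of 0] by eventually_elim (use nn r in auto)
    qed simp
    then have g: "((\<lambda>t. \<gamma> (\<beta> r (t / 2))) \<longlongrightarrow> 0) at_top" by (simp add: \<gamma>)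
    have "(?B r \<longlongrightarrow> 0 + 0 * r + 0 * \<gamma> (\<beta> r 0) + 0) at_top"
      using ex[of "\<omega> / 2"] by (intro tendsto_intros lim r ex \<omega> g) (use \<omega> in \<open>auto\<close>)
    then show ?thesis by simp
  qed
  ultimately show ?thesis unfolding class_KL_def by auto
qed

text \<open>Variation of constants, written relative to the limit \<open>z a\<close>: the deviation
  of \<open>\<eta>\<close> is \<open>exp (- \<omega> * t)\<close> times the sum of the initial
  deviation and a weighted integral \<open>W\<close> of the deviation \<open>w\<close> of the input.
  The modulus \<open>\<gamma>\<close> converts the decay of \<open>y\<close> into decay of
  \<open>w\<close>.\<close>

lemma cascade_filter_solution:
  fixes y :: "real \<Rightarrow> 'a::euclidean_space" and z :: "'a \<Rightarrow> real"
  assumes \<beta>: "\<beta> \<in> class_KL" and \<omega>: "0 < \<omega>"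
    and \<gamma>: "mono_on {0..} \<gamma>" "\<And>x. \<bar>z x - z a\<bar> \<le> \<gamma> (norm (x - a))"
    and z: "continuous_on UNIV z" and y: "continuous_on {0..} y"
    and r: "0 \<le> r" and bound: "\<And>t. 0 \<le> t \<Longrightarrow> norm (y t - a) \<le> \<beta> r t"
  obtains \<eta> where "\<eta> 0 = \<eta>0"
    "\<And>t. 0 \<le> t \<Longrightarrow> (\<eta> has_real_derivative - \<omega> * \<eta> t + \<omega> * z (y t)) (at t within {0..})"
    "\<And>t. 0 \<le> t \<Longrightarrow> \<bar>\<eta> t - z a\<bar> \<le> exp (- \<omega> * t) * \<bar>\<eta>0 - z a\<bar> +
      exp (- \<omega> * t / 2) * \<gamma> (\<beta> r 0) + \<gamma> (\<beta> r (t / 2))"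
proof -
  define w where "w s = z (y s) - z a" for s
  have w: "continuous_on {0..} w"
    unfolding w_def by (intro continuous_intros continuous_on_compose2[OF z y]) auto
  define W where "W t = integral {0..t} (\<lambda>s. \<omega> * exp (\<omega> * s) * w s)" for t
  define \<eta> where "\<eta> t = z a + exp (- \<omega> * t) * (\<eta>0 - z a + W t)" for t
  have W: "(W has_real_derivative \<omega> * exp (\<omega> * t) * w t) (at t within {0..})" if "0 \<le> t" for t
    unfolding W_def has_real_derivative_iff_has_vector_derivative
    using that by (intro integral_has_vector_derivative_atLeast continuous_intros w)
  have "\<eta> 0 = \<eta>0" by (simp add: \<eta>_def W_def)
  moreover have "(\<eta> has_real_derivative - \<omega> * \<eta> t + \<omega> * z (y t)) (at t within {0..})" if t: "0 \<le> t" for t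
  proof -
    have "((\<lambda>t. exp (- \<omega> * t)) has_real_derivative exp (- \<omega> * t) * (- \<omega>)) (at t within {0..})"
      by (auto intro!: derivative_eq_intros)
    then have "(\<eta> has_real_derivative 0 + (exp (- \<omega> * t) * (- \<omega>) * (\<eta>0 - z a + W t) +
        (0 + \<omega> * exp (\<omega> * t) * w t) * exp (- \<omega> * t))) (at t within {0..})"
      unfolding \<eta>_def[abs_def] by (intro DERIV_add DERIV_const DERIV_mult W[OF t])
    moreover have "exp (\<omega> * t) * exp (- (\<omega> * t)) = 1" by (simp add: exp_minus)
    ultimately show ?thesis by (elim DERIV_cong) (simp add: \<eta>_def w_def algebra_simps)
  qed
  moreover have "\<bar>\<eta> t - z a\<bar> \<le> exp (- \<omega> * t) * \<bar>\<eta>0 - z a\<bar> +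
      exp (- \<omega> * t / 2) * \<gamma> (\<beta> r 0) + \<gamma> (\<beta> r (t / 2))" if t: "0 \<le> t" for t
  proof -
    \<comment> \<open>\<open>\<beta> r\<close> is nonincreasing, so the input at time
      \<open>s\<close> obeys the bound belonging to any earlier \<open>s'\<close>:
      \<open>s' = 0\<close> serves on the first half of the interval and \<open>s' = t / 2\<close>
      on the second.\<close>
    have le: "\<bar>w s\<bar> \<le> \<gamma> (\<beta> r s')" if "0 \<le> s'" "s' \<le> s" for s s'
    proof -
      have *: "\<bar>w s\<bar> \<le> \<gamma> (norm (y s - a))" unfolding w_def by (rule \<gamma>)
      moreover have "norm (y s - a) \<le> \<beta> r s" using bound that by simp
      moreover have "\<beta> r s \<le> \<beta> r s'"
        using \<beta> r that by (auto simp: class_KL_def monotone_on_def)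
      ultimately have "norm (y s - a) \<le> \<beta> r s'" by simp
      then have "\<gamma> (norm (y s - a)) \<le> \<gamma> (\<beta> r s')"
        using \<gamma>(1) norm_ge_zero[of "y s - a"] unfolding monotone_on_def
        by (metis atLeast_iff order_trans)
      with * show ?thesis by simp
    qed
    have "exp (- \<omega> * t) * \<bar>W t\<bar> \<le> exp (- \<omega> * t / 2) * \<gamma> (\<beta> r 0) + \<gamma> (\<beta> r (t / 2))"
      unfolding W_def using t by (intro weighted_integral_bound \<omega> w le) auto
    moreover have "\<bar>\<eta> t - z a\<bar> = exp (- \<omega> * t) * \<bar>\<eta>0 - z a + W t\<bar>"
      by (simp add: \<eta>_def abs_mult)
    moreover have "exp (- \<omega> * t) * \<bar>\<eta>0 - z a + W t\<bar> \<le> exp (- \<omega> * t) * (\<bar>\<eta>0 - z a\<bar> + \<bar>W t\<bar>)"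
      by (intro mult_left_mono abs_triangle_ineq) simp
    ultimately show ?thesis by (simp only: distrib_left)
  qed
  ultimately show thesis by (rule that)
qed

section \<open>The boundary curve of a planar domain\<close>

lemma orthonormal_expansion_2:
  fixes e n w :: "real^2"
  assumes "norm e = 1" "norm n = 1" "e \<bullet> n = 0"
  shows "w = (w \<bullet> e) *\<^sub>R e + (w \<bullet> n) *\<^sub>R n"
proof -
  have 1: "e$1 * e$1 + e$2 * e$2 = 1" "n$1 * n$1 + n$2 * n$2 = 1" "e$1 * n$1 + e$2 * n$2 = 0"
    using assms by (simp_all add: norm_eq_1 inner_vec_def sum_2)
  \<comment> \<open>A square matrix with orthonormal rows has orthonormal columns; here the rows are
    \<open>e\<close> and \<open>n\<close>.\<close>
  have 2: "e$1 * e$1 + n$1 * n$1 = 1" "e$2 * e$2 + n$2 * n$2 = 1" "e$1 * e$2 + n$1 * n$2 = 0"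
    using 1 by algebra+
  have "w$1 = (w$1 * e$1 + w$2 * e$2) * e$1 + (w$1 * n$1 + w$2 * n$2) * n$1"
       "w$2 = (w$1 * e$1 + w$2 * e$2) * e$2 + (w$1 * n$1 + w$2 * n$2) * n$2"
    using 2 by algebra+
  then show ?thesis by (simp add: vec_eq_iff forall_2 inner_vec_def sum_2)
qed

lemma smooth_on_has_derivative:
  assumes "smooth_on S f" "x \<in> S"
  shows "(f has_derivative frechet_derivative f (at x)) (at x)"
proof -
  have "Ck_on (Suc 0) S f" using assms(1) unfolding smooth_on_def by blast
  then show ?thesis using assms(2) by (simp add: frechet_derivative_works)
qed

lemma smooth_on_frechet_derivative_continuous:
  assumes "smooth_on S f"
  shows "continuous_on S (\<lambda>x. frechet_derivative f (at x) v)"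
proof -
  have "Ck_on (Suc 0) S f" using assms unfolding smooth_on_def by blast
  then show ?thesis by simp
qed

section \<open>Charts, the frontier and outward normals\<close>

lemma submanifold_chartD:
  assumes "submanifold_chart M p V W \<phi> \<phi>'"
  shows "p \<in> V" "open V" "open W" "homeomorphism V W \<phi> \<phi>'" "smooth_on V \<phi>" "smooth_on W \<phi>'"
    "\<phi> ` (M \<inter> V) = half_plane \<inter> W"
  using assms by (auto simp: submanifold_chart_def diffeomorphism_def)

text \<open>Injectivity of \<open>\<phi>\<close> turns the condition on the image of
  \<open>M\<close> into one on points. From here on a chart is used mainly through the sign of its
  first coordinate.\<close>

lemma submanifold_chart_mem_iff:
  assumes c: "submanifold_chart M p V W \<phi> \<phi>'" and x: "x \<in> V"
  shows "x \<in> M \<longleftrightarrow> 0 \<le> \<phi> x $ 1"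
proof -
  note D = submanifold_chartD[OF c]
  have "\<phi> x \<in> W" using D(4) x by (auto simp: homeomorphism_def)
  have "x \<in> M \<longleftrightarrow> \<phi> x \<in> \<phi> ` (M \<inter> V)"
  proof
    assume "\<phi> x \<in> \<phi> ` (M \<inter> V)"
    then obtain y where "y \<in> M" "y \<in> V" "\<phi> x = \<phi> y" by auto
    then show "x \<in> M" using D(4) x by (metis homeomorphism_apply1)
  qed (use x in auto)
  then show ?thesis using D(7) \<open>\<phi> x \<in> W\<close> by (simp add: half_plane_def)
qed

lemma submanifold_chart_interior:
  assumes c: "submanifold_chart M p V W \<phi> \<phi>'" and x: "x \<in> V" "0 < \<phi> x $ 1"
  shows "x \<in> interior M"
proof (rule interiorI)
  note D = submanifold_chartD[OF c]
  show "open (V \<inter> (\<lambda>x. \<phi> x $ 1) -` {0<..})"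
    using D(2,4) by (intro continuous_open_preimage continuous_on_component) (auto simp: homeomorphism_def)
  show "V \<inter> (\<lambda>x. \<phi> x $ 1) -` {0<..} \<subseteq> M"
    using submanifold_chart_mem_iff[OF c] by (auto intro: less_imp_le)
qed (use x in auto)

text \<open>A small step from \<open>\<phi> p\<close> against the first axis leaves the half-plane.
  If \<open>p\<close> were interior, continuity of \<open>\<phi>'\<close> would keep the preimage of
  the displaced point in \<open>M\<close>, where the first coordinate is nonnegative.\<close>

lemma boundary_chart_not_interior:
  assumes c: "boundary_chart M p V W \<phi> \<phi>'"
  shows "p \<notin> interior M"
proof
  assume p: "p \<in> interior M"
  have c': "submanifold_chart M p V W \<phi> \<phi>'" and 0: "\<phi> p $ 1 = 0"
    using c by (auto simp: boundary_chart_def)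
  note D = submanifold_chartD[OF c']
  have "open (W \<inter> \<phi>' -` interior M)"
    using D(3,4) by (intro continuous_open_preimage) (auto simp: homeomorphism_def)
  moreover have "\<phi> p \<in> W \<inter> \<phi>' -` interior M"
    using D(1,4) p by (auto simp: homeomorphism_def)
  moreover have "((\<lambda>t. \<phi> p - t *\<^sub>R axis 1 1) \<longlongrightarrow> \<phi> p - 0 *\<^sub>R axis 1 1) (at_right 0)"
    by (intro tendsto_intros)
  then have "((\<lambda>t. \<phi> p - t *\<^sub>R axis 1 1) \<longlongrightarrow> \<phi> p) (at_right 0)" by simp
  ultimately have "\<forall>\<^sub>F t in at_right 0. \<phi> p - t *\<^sub>R axis 1 1 \<in> W \<inter> \<phi>' -` interior M"
    by (rule topological_tendstoD[rotated])
  moreover have "\<forall>\<^sub>F t::real in at_right 0. 0 < t" by (simp add: eventually_at_right_less)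
  ultimately have "\<forall>\<^sub>F t::real in at_right 0. 0 < t \<and> \<phi> p - t *\<^sub>R axis 1 1 \<in> W \<inter> \<phi>' -` interior M"
    by eventually_elim auto
  then obtain t :: real where t: "0 < t" "\<phi> p - t *\<^sub>R axis 1 1 \<in> W" "\<phi>' (\<phi> p - t *\<^sub>R axis 1 1) \<in> interior M"
    using eventually_happens[of _ "at_right (0::real)"] by (auto simp: trivial_limit_at_right_real)
  let ?y = "\<phi> p - t *\<^sub>R axis 1 1"
  have "\<phi>' ?y \<in> V" "\<phi> (\<phi>' ?y) = ?y" using D(4) t(2) by (auto simp: homeomorphism_def)
  then have "0 \<le> ?y $ 1"
    using submanifold_chart_mem_iff[OF c', of "\<phi>' ?y"] t(3) interior_subset by auto
  then show False using t(1) 0 by simp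
qed

text \<open>The first chart coordinate of a point of \<open>M\<close> is positive, which makes the
  point interior, or zero, which makes the chart a boundary chart and excludes interior points.
  Arguments about connected sets meeting a frontier thereby apply to the boundary.\<close>

lemma manifold_boundary_eq_frontier:
  assumes "closed M" "smooth_submanifold_with_boundary M"
  shows "manifold_boundary M = frontier M"
proof -
  have "p \<in> interior M \<or> p \<in> manifold_boundary M" if p: "p \<in> M" for p
  proof -
    obtain V W \<phi> \<phi>' where c: "submanifold_chart M p V W \<phi> \<phi>'"
      using assms(2) p unfolding smooth_submanifold_with_boundary_def by blast
    note D = submanifold_chartD[OF c]
    have "0 \<le> \<phi> p $ 1" using submanifold_chart_mem_iff[OF c D(1)] that by simp
    then consider "\<phi> p $ 1 = 0" | "0 < \<phi> p $ 1" by linarith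
    then show ?thesis
    proof cases
      case 1
      then show ?thesis using c that by (auto simp: manifold_boundary_def boundary_chart_def)
    next
      case 2
      then show ?thesis using submanifold_chart_interior[OF c D(1)] by simp
    qed
  qed
  moreover have "p \<notin> interior M" if "p \<in> manifold_boundary M" for p
    using that boundary_chart_not_interior by (auto simp: manifold_boundary_def)
  moreover have "manifold_boundary M \<subseteq> M" by (auto simp: manifold_boundary_def)
  ultimately have "manifold_boundary M = M - interior M" by blast
  then show ?thesis using assms(1) by (simp add: frontier_def)
qed

lemma chart_directional_derivative:
  assumes c: "submanifold_chart M p V W \<phi> \<phi>'"
    and \<gamma>: "(\<gamma> has_vector_derivative v) (at s)" "\<gamma> s = p"
  shows "((\<lambda>s. \<phi> (\<gamma> s) $ i) has_real_derivative frechet_derivative \<phi> (at p) v $ i) (at s)"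
proof -
  note D = submanifold_chartD[OF c]
  have "(\<phi> has_derivative frechet_derivative \<phi> (at p)) (at (\<gamma> s))"
    using smooth_on_has_derivative[OF D(5,1)] \<gamma> by simp
  then have d: "((\<lambda>s. \<phi> (\<gamma> s)) has_vector_derivative frechet_derivative \<phi> (at p) v) (at s)"
    using vector_derivative_diff_chain_within[OF \<gamma>(1), of \<phi> "frechet_derivative \<phi> (at p)"]
    by (simp add: o_def has_derivative_at_withinI)
  show ?thesis
    using bounded_linear.has_vector_derivative[OF bounded_linear_vec_nth d, of i]
    by (simp add: has_real_derivative_iff_has_vector_derivative)
qed

lemma eventually_in_chart:
  assumes "submanifold_chart M p V W \<phi> \<phi>'" and "isCont \<gamma> s" "\<gamma> s = p"
  obtains d :: real where "0 < d" "\<And>t::real. \<bar>t - s\<bar> < d \<Longrightarrow> \<gamma> t \<in> V"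
proof -
  have "\<forall>\<^sub>F t in nhds s. \<gamma> t \<in> V"
    using assms(2,3) submanifold_chartD[OF assms(1)]
    by (intro topological_tendstoD[of \<gamma> p]) (auto simp: isCont_def tendsto_at_iff_tendsto_nhds)
  then show ?thesis
    using that by (auto simp: eventually_nhds_metric dist_real_def)
qed

text \<open>Along the line through \<open>p\<close> in direction \<open>n\<close> the first chart
  coordinate vanishes at 0 with negative derivative, so its sign, and with it membership in
  \<open>M\<close>, changes there.\<close>

lemma outward_unit_normal_transversal:
  assumes n: "outward_unit_normal M p n"
  obtains d where "0 < d" "\<And>t. 0 < t \<Longrightarrow> t < d \<Longrightarrow> p + t *\<^sub>R n \<notin> M \<and> p - t *\<^sub>R n \<in> M"
proof -
  obtain V W \<phi> \<phi>' where c: "submanifold_chart M p V W \<phi> \<phi>'" and 0: "\<phi> p $ 1 = 0"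
    and neg: "frechet_derivative \<phi> (at p) n $ 1 < 0"
    using n by (auto simp: outward_unit_normal_def boundary_chart_def)
  have line: "((\<lambda>t. p + t *\<^sub>R n) has_vector_derivative n) (at 0)"
    by (auto intro!: derivative_eq_intros)
  have d: "((\<lambda>t. \<phi> (p + t *\<^sub>R n) $ 1) has_real_derivative frechet_derivative \<phi> (at p) n $ 1) (at 0)"
    by (rule chart_directional_derivative[OF c line]) simp
  obtain d1 where d1: "0 < d1" "\<And>t. \<bar>t\<bar> < d1 \<Longrightarrow> p + t *\<^sub>R n \<in> V"
    using eventually_in_chart[OF c has_vector_derivative_continuous[OF line]] by auto
  obtain d2 where d2: "0 < d2" "\<And>h. 0 < h \<Longrightarrow> h < d2 \<Longrightarrow> \<phi> (p + h *\<^sub>R n) $ 1 < 0"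
    using DERIV_neg_dec_right[OF d neg] 0 by auto
  obtain d3 where d3: "0 < d3" "\<And>h. 0 < h \<Longrightarrow> h < d3 \<Longrightarrow> 0 < \<phi> (p - h *\<^sub>R n) $ 1"
    using DERIV_neg_dec_left[OF d neg] 0 by auto
  show ?thesis
  proof (rule that[of "min d1 (min d2 d3)"])
    fix t :: real assume t: "0 < t" "t < min d1 (min d2 d3)"
    have "p + t *\<^sub>R n \<in> V" "p - t *\<^sub>R n \<in> V" using d1(2)[of t] d1(2)[of "- t"] t by auto
    then show "p + t *\<^sub>R n \<notin> M \<and> p - t *\<^sub>R n \<in> M"
      using d2(2)[of t] d3(2)[of t] t by (auto simp: submanifold_chart_mem_iff[OF c])
  qed (use d1 d2 d3 in auto)
qed

text \<open>The first chart coordinate is nonnegative along a curve in \<open>M\<close> and zero at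
  \<open>p\<close>, so it has a minimum there: \<open>v\<close> is tangent to the boundary, and
  \<open>n\<close> is orthogonal to tangents. A direction \<open>w\<close> along which one stays in
  \<open>M\<close> has a nonnegative derivative of this coordinate; expanding \<open>w\<close> in
  the orthonormal pair \<open>sgn v\<close>, \<open>n\<close> leaves \<open>w \<bullet> n\<close>
  times a negative number.\<close>

lemma outward_unit_normal_curve:
  assumes n: "outward_unit_normal M p n"
    and \<gamma>: "(\<gamma> has_vector_derivative v) (at s)" "\<gamma> s = p" "\<And>t. \<gamma> t \<in> M"
  shows outward_unit_normal_orthogonal: "n \<bullet> v = 0"
    and outward_unit_normal_inward: "v \<noteq> 0 \<Longrightarrow> 0 < d \<Longrightarrow> (\<And>t. 0 < t \<Longrightarrow> t < d \<Longrightarrow> p + t *\<^sub>R w \<in> M) \<Longrightarrow> w \<bullet> n \<le> 0"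
proof -
  obtain V W \<phi> \<phi>' where c: "submanifold_chart M p V W \<phi> \<phi>'" and 0: "\<phi> p $ 1 = 0"
    and neg: "frechet_derivative \<phi> (at p) n $ 1 < 0" and norm: "norm n = 1"
    and ker: "\<And>v. frechet_derivative \<phi> (at p) v $ 1 = 0 \<Longrightarrow> n \<bullet> v = 0"
    using n by (auto simp: outward_unit_normal_def boundary_chart_def)
  obtain d1 where d1: "0 < d1" "\<And>t. \<bar>t - s\<bar> < d1 \<Longrightarrow> \<gamma> t \<in> V"
    using eventually_in_chart[OF c has_vector_derivative_continuous[OF \<gamma>(1)] \<gamma>(2)] by blast
  have "\<forall>t. \<bar>s - t\<bar> < d1 \<longrightarrow> \<phi> (\<gamma> s) $ 1 \<le> \<phi> (\<gamma> t) $ 1"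
    using d1(2) \<gamma>(2,3) submanifold_chart_mem_iff[OF c] 0 by (auto simp: abs_minus_commute)
  then have v0: "frechet_derivative \<phi> (at p) v $ 1 = 0"
    using DERIV_local_min[OF chart_directional_derivative[OF c \<gamma>(1,2)] d1(1)] by blast
  then show orth: "n \<bullet> v = 0" by (rule ker)
  assume v: "v \<noteq> 0" and d: "0 < d" "\<And>t. 0 < t \<Longrightarrow> t < d \<Longrightarrow> p + t *\<^sub>R w \<in> M"
  have line: "((\<lambda>t. p + t *\<^sub>R w) has_vector_derivative w) (at 0)"
    by (auto intro!: derivative_eq_intros)
  have dw: "((\<lambda>t. \<phi> (p + t *\<^sub>R w) $ 1) has_real_derivative frechet_derivative \<phi> (at p) w $ 1) (at 0)"
    by (rule chart_directional_derivative[OF c line]) simp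
  obtain d2 where d2: "0 < d2" "\<And>t. \<bar>t\<bar> < d2 \<Longrightarrow> p + t *\<^sub>R w \<in> V"
    using eventually_in_chart[OF c has_vector_derivative_continuous[OF line]] by auto
  have "0 \<le> frechet_derivative \<phi> (at p) w $ 1"
  proof (rule ccontr)
    assume "\<not> ?thesis"
    then obtain d3 where d3: "0 < d3" "\<And>h. 0 < h \<Longrightarrow> h < d3 \<Longrightarrow> \<phi> (p + h *\<^sub>R w) $ 1 < 0"
      using DERIV_neg_dec_right[OF dw] 0 by auto
    define t where "t = min d (min d2 d3) / 2"
    have t: "0 < t" "t < d" "t < d2" "t < d3" using d(1) d2(1) d3(1) by (auto simp: t_def)
    have "0 \<le> \<phi> (p + t *\<^sub>R w) $ 1"
      using d(2)[of t] t d2(2)[of t] submanifold_chart_mem_iff[OF c] by auto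
    then show False using d3(2)[of t] t by auto
  qed
  moreover have "w = (w \<bullet> sgn v) *\<^sub>R sgn v + (w \<bullet> n) *\<^sub>R n"
    using v norm orth by (intro orthonormal_expansion_2) (auto simp: norm_sgn sgn_div_norm inner_commute)
  moreover have lin: "linear (frechet_derivative \<phi> (at p))"
    using smooth_on_has_derivative submanifold_chartD[OF c] has_derivative_linear by blast
  ultimately have "0 \<le> (w \<bullet> n) * frechet_derivative \<phi> (at p) n $ 1"
    using v0 linear_add[OF lin, of "(w \<bullet> sgn v) *\<^sub>R sgn v" "(w \<bullet> n) *\<^sub>R n"] linear_scale[OF lin]
    by (simp add: sgn_div_norm)
  then show "w \<bullet> n \<le> 0" using neg by (simp add: zero_le_mult_iff)
qed

text \<open>In a boundary chart the boundary is the line of vanishing first coordinate, so its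
  points are told apart by the second. The curve moves on this line with nonzero velocity at
  \<open>s\<close>; hence its second coordinate takes values on both sides of
  \<open>\<zeta> s\<close> and, by connectedness, all values in between.\<close>

lemma curve_fills_boundary:
  assumes u: "\<And>t. u t \<in> manifold_boundary M" "continuous_on UNIV u"
    and v: "(u has_vector_derivative v) (at s)" "v \<noteq> 0" and \<delta>: "0 < \<delta>"
  obtains N where "open N" "u s \<in> N" "manifold_boundary M \<inter> N \<subseteq> u ` {s - \<delta><..<s + \<delta>}"
proof -
  obtain V W \<phi> \<phi>' where c: "submanifold_chart M (u s) V W \<phi> \<phi>'" and 0: "\<phi> (u s) $ 1 = 0"
    using u(1)[of s] by (auto simp: manifold_boundary_def boundary_chart_def)
  note D = submanifold_chartD[OF c]
  have bd0: "\<phi> x $ 1 = 0" if "x \<in> manifold_boundary M" "x \<in> V" for x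
  proof -
    have "x \<in> M" "x \<notin> interior M"
      using that boundary_chart_not_interior by (auto simp: manifold_boundary_def)
    then show ?thesis
      using submanifold_chart_mem_iff[OF c that(2)] submanifold_chart_interior[OF c that(2)] by fastforce
  qed
  obtain d where d: "0 < d" "\<And>t. \<bar>t - s\<bar> < d \<Longrightarrow> u t \<in> V"
    using eventually_in_chart[OF c has_vector_derivative_continuous[OF v(1)]] by blast
  define \<zeta> where "\<zeta> t = \<phi> (u t) $ 2" for t
  define l where "l = frechet_derivative \<phi> (at (u s)) v $ 2"
  have \<zeta>: "(\<zeta> has_real_derivative l) (at s)"
    unfolding \<zeta>_def l_def by (rule chart_directional_derivative[OF c v(1) refl])
  have "frechet_derivative \<phi> (at (u s)) v $ 1 = 0"
  proof (rule DERIV_local_min[OF chart_directional_derivative[OF c v(1) refl] d(1)])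
    show "\<forall>t. \<bar>s - t\<bar> < d \<longrightarrow> \<phi> (u s) $ 1 \<le> \<phi> (u t) $ 1"
      using bd0 u(1) d by (simp add: 0 abs_minus_commute)
  qed
  moreover have "frechet_derivative \<phi> (at (u s)) v \<noteq> 0"
  proof
    \<comment> \<open>\<open>\<phi>'\<close> inverts \<open>\<phi>\<close> near \<open>u s\<close>,
      so by the chain rule the derivative of \<open>\<phi>\<close> is injective and cannot
      annihilate \<open>v\<close>.\<close>
    assume z: "frechet_derivative \<phi> (at (u s)) v = 0"
    have "\<phi> (u s) \<in> W" using D(1,4) by (auto simp: homeomorphism_def)
    then have "((\<phi>' \<circ> \<phi>) has_derivative frechet_derivative \<phi>' (at (\<phi> (u s))) \<circ> frechet_derivative \<phi> (at (u s))) (at (u s))"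
      using smooth_on_has_derivative D by (intro diff_chain_at) blast+
    then have "((\<lambda>x. x) has_derivative frechet_derivative \<phi>' (at (\<phi> (u s))) \<circ> frechet_derivative \<phi> (at (u s))) (at (u s))"
      using D(1,2,4) by (elim has_derivative_transform_within_open[of _ _ _ _ V]) (auto simp: homeomorphism_def)
    from fun_cong[OF has_derivative_unique[OF this has_derivative_ident], of v]
    have "frechet_derivative \<phi>' (at (\<phi> (u s))) (frechet_derivative \<phi> (at (u s)) v) = v" by simp
    moreover have "linear (frechet_derivative \<phi>' (at (\<phi> (u s))))"
      using smooth_on_has_derivative[OF D(6) \<open>\<phi> (u s) \<in> W\<close>] has_derivative_linear by blast
    ultimately show False using z v(2) linear_0 by metis
  qed
  ultimately have l: "l \<noteq> 0" by (auto simp: l_def vec_eq_iff forall_2)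
  define d' where "d' = min d \<delta>"
  have d': "0 < d'" using d \<delta> by (simp add: d'_def)
  obtain s1 s2 where s12: "\<bar>s1 - s\<bar> < d'" "\<bar>s2 - s\<bar> < d'" "\<zeta> s1 < \<zeta> s" "\<zeta> s < \<zeta> s2"
  proof (cases "0 < l")
    case True
    obtain a where a: "0 < a" "\<And>h. 0 < h \<Longrightarrow> h < a \<Longrightarrow> \<zeta> s < \<zeta> (s + h)"
      using DERIV_pos_inc_right[OF \<zeta> True] by auto
    obtain b where b: "0 < b" "\<And>h. 0 < h \<Longrightarrow> h < b \<Longrightarrow> \<zeta> (s - h) < \<zeta> s"
      using DERIV_pos_inc_left[OF \<zeta> True] by auto
    define h where "h = min d' (min a b) / 2"
    have "0 < h" "h < d'" "h < a" "h < b" using a b d' by (auto simp: h_def)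
    then show ?thesis using that[of "s - h" "s + h"] a b by auto
  next
    case False
    then have "l < 0" using l by simp
    obtain a where a: "0 < a" "\<And>h. 0 < h \<Longrightarrow> h < a \<Longrightarrow> \<zeta> (s + h) < \<zeta> s"
      using DERIV_neg_dec_right[OF \<zeta> \<open>l < 0\<close>] by auto
    obtain b where b: "0 < b" "\<And>h. 0 < h \<Longrightarrow> h < b \<Longrightarrow> \<zeta> s < \<zeta> (s - h)"
      using DERIV_neg_dec_left[OF \<zeta> \<open>l < 0\<close>] by auto
    define h where "h = min d' (min a b) / 2"
    have "0 < h" "h < d'" "h < a" "h < b" using a b d' by (auto simp: h_def)
    then show ?thesis using that[of "s + h" "s - h"] a b by auto
  qed
  have \<zeta>c: "continuous_on {s - d'<..<s + d'} \<zeta>"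
  proof -
    have "u ` {s - d'<..<s + d'} \<subseteq> V" using d by (auto simp: d'_def)
    then have "continuous_on {s - d'<..<s + d'} (\<lambda>t. \<phi> (u t))"
      by (rule continuous_on_compose2[OF homeomorphism_cont1[OF D(4)] continuous_on_subset[OF u(2) subset_UNIV]])
    then show ?thesis unfolding \<zeta>_def by (rule continuous_on_component)
  qed
  have conn: "connected (\<zeta> ` {s - d'<..<s + d'})"
    by (intro connected_continuous_image \<zeta>c) simp
  define N where "N = V \<inter> (\<lambda>x. \<phi> x $ 2) -` {\<zeta> s1<..<\<zeta> s2}"
  show ?thesis
  proof (rule that[of N])
    show "open N"
      unfolding N_def using D(2,4)
      by (intro continuous_open_preimage continuous_on_component) (auto simp: homeomorphism_def)
    show "u s \<in> N" using D(1) s12 by (auto simp: N_def \<zeta>_def)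
    show "manifold_boundary M \<inter> N \<subseteq> u ` {s - \<delta><..<s + \<delta>}"
    proof
      fix x assume x: "x \<in> manifold_boundary M \<inter> N"
      have "\<zeta> s1 \<in> \<zeta> ` {s - d'<..<s + d'}" "\<zeta> s2 \<in> \<zeta> ` {s - d'<..<s + d'}"
        using s12 by (auto simp: abs_less_iff)
      moreover have "\<zeta> s1 \<le> \<phi> x $ 2" "\<phi> x $ 2 \<le> \<zeta> s2" using x by (auto simp: N_def)
      ultimately have "\<phi> x $ 2 \<in> \<zeta> ` {s - d'<..<s + d'}"
        using conn by (meson connected_contains_Icc atLeastAtMost_iff subsetD)
      then obtain t where t: "t \<in> {s - d'<..<s + d'}" "\<phi> x $ 2 = \<phi> (u t) $ 2"
        by (auto simp: \<zeta>_def)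
      then have "u t \<in> V" using d by (auto simp: d'_def)
      then have "\<phi> x = \<phi> (u t)"
        using t bd0 x u(1) by (auto simp: vec_eq_iff forall_2 N_def)
      then have "x = u t" using D(4) \<open>u t \<in> V\<close> x by (metis IntD1 IntD2 N_def homeomorphism_apply1)
      moreover have "t \<in> {s - \<delta><..<s + \<delta>}" using t by (auto simp: d'_def)
      ultimately show "x \<in> u ` {s - \<delta><..<s + \<delta>}" by blast
    qed
  qed
qed

section \<open>The curve as a simple closed parametrization of the frontier\<close>

locale boundary_curve =
  fixes M :: "(real^2) set" and \<nu> :: "real^2 \<Rightarrow> real^2" and u u' :: "real \<Rightarrow> real^2" and T :: real
  assumes M_compact: "compact M" and M_smooth: "smooth_submanifold_with_boundary M"
    and boundary_connected: "connected (manifold_boundary M)"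
    and normal: "\<And>p. p \<in> manifold_boundary M \<Longrightarrow> outward_unit_normal M p (\<nu> p)"
    and u_deriv: "\<And>t. (u has_vector_derivative u' t) (at t)" and u'_cont: "continuous_on UNIV u'"
    and u'_nz: "\<And>t. u' t \<noteq> 0"
    and u_mem: "\<And>t. u t \<in> manifold_boundary M"
    and u_periodic: "\<And>t. u (t + T) = u t"
    and T_pos: "0 < T"
    and u_inj: "inj_on u {0<..<T}"
begin

lemma boundary_eq: "manifold_boundary M = frontier M"
  by (rule manifold_boundary_eq_frontier) (use M_compact M_smooth in \<open>auto intro: compact_imp_closed\<close>)

lemma u_in_M: "u t \<in> M"
  using u_mem by (auto simp: manifold_boundary_def)

lemma u_cont: "continuous_on S u"
  by (intro continuous_at_imp_continuous_on ballI has_vector_derivative_continuous[OF u_deriv])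

lemma u'_periodic: "u' (t + T) = u' t"
proof -
  have "(u \<circ> (\<lambda>t. t + T) has_vector_derivative 1 *\<^sub>R u' (t + T)) (at t)"
    by (intro vector_diff_chain_at u_deriv) (auto intro!: derivative_eq_intros)
  then have "(u has_vector_derivative u' (t + T)) (at t)"
    by (simp add: o_def u_periodic)
  then show ?thesis using u_deriv by (rule vector_derivative_unique_at)
qed

lemma u_periodic_int: "u (t + of_int k * T) = u t"
  by (rule periodic_add_int) (rule u_periodic)

lemma u_fills:
  assumes "0 < \<delta>"
  obtains N where "open N" "u s \<in> N" "frontier M \<inter> N \<subseteq> u ` {s - \<delta><..<s + \<delta>}"
  using curve_fills_boundary[OF u_mem u_cont u_deriv u'_nz assms] boundary_eq by metis

text \<open>The range is compact, hence closed in the frontier, and relatively open by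
  \<open>u_fills\<close>. The frontier is connected, so the nonempty clopen range is all of
  it.\<close>

lemma u_range: "range u = frontier M"
proof -
  have eq: "range u = u ` {0..T}"
  proof
    show "range u \<subseteq> u ` {0..T}"
    proof
      fix x assume "x \<in> range u"
      then obtain t where x: "x = u t" by auto
      obtain k where "0 \<le> t + of_int k * T" "t + of_int k * T < T" by (rule period_representative[OF T_pos])
      then show "x \<in> u ` {0..T}"
        using u_periodic_int[of t k] x by (intro image_eqI[of _ _ "t + of_int k * T"]) auto
    qed
  qed auto
  have sub: "range u \<subseteq> frontier M" using u_mem boundary_eq by auto
  have "compact (range u)" unfolding eq by (intro compact_continuous_image u_cont) simp
  then have "closedin (top_of_set (frontier M)) (range u)"
    using sub by (intro closed_subset) (auto intro: compact_imp_closed)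
  moreover have "openin (top_of_set (frontier M)) (range u)"
    unfolding openin_contains_ball
  proof (intro conjI ballI)
    fix x assume "x \<in> range u"
    then obtain s where s: "x = u s" by auto
    obtain N where N: "open N" "u s \<in> N" "frontier M \<inter> N \<subseteq> u ` {s - 1<..<s + 1}"
      using u_fills[of 1 s] by auto
    then obtain e where "0 < e" "ball x e \<subseteq> N" using s by (metis openE)
    then show "\<exists>e>0. ball x e \<inter> frontier M \<subseteq> range u" using N(3) by (intro exI[of _ e]) auto
  qed (rule sub)
  ultimately show ?thesis
    using boundary_connected unfolding boundary_eq connected_clopen by blast
qed

text \<open>Injectivity is only assumed on the open interval; a double point at \<open>u 0\<close> is excluded since the
  branch through \<open>u t\<close> already covers the boundary near that point.\<close>

lemma u_0_neq: "0 < t \<Longrightarrow> t < T \<Longrightarrow> u t \<noteq> u 0"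
proof
  assume t: "0 < t" "t < T" and eq: "u t = u 0"
  \<comment> \<open>The window around \<open>t\<close> stays inside the open period and away from
    small positive times. Points \<open>u s\<close> with small \<open>s > 0\<close> approach
    \<open>u t = u 0\<close>, so they would be hit a second time from within the window,
    contradicting injectivity.\<close>
  define \<delta> where "\<delta> = min t (T - t) / 2"
  have \<delta>: "0 < \<delta>" "\<delta> < t" "t + \<delta> < T" using t by (auto simp: \<delta>_def min_def field_simps)
  obtain N where N: "open N" "u t \<in> N" "frontier M \<inter> N \<subseteq> u ` {t - \<delta><..<t + \<delta>}"
    using u_fills[OF \<delta>(1)] by blast
  have "isCont u 0" using u_deriv has_vector_derivative_continuous by blast
  then have "(u \<longlongrightarrow> u 0) (at_right 0)" by (auto simp: isCont_def intro: filterlim_mono at_le)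
  then have "\<forall>\<^sub>F s in at_right 0. u s \<in> N" using N eq by (intro topological_tendstoD) auto
  moreover have "\<forall>\<^sub>F s in at_right 0. s \<in> {0<..<t - \<delta>}" using \<delta> by (intro eventually_at_right_real) auto
  ultimately have "\<forall>\<^sub>F s in at_right 0. u s \<in> N \<and> s \<in> {0<..<t - \<delta>}" by eventually_elim auto
  then obtain s where s: "u s \<in> N" "s \<in> {0<..<t - \<delta>}"
    using eventually_happens[of _ "at_right (0::real)"] by (auto simp: trivial_limit_at_right_real)
  then have "u s \<in> u ` {t - \<delta><..<t + \<delta>}" using N u_mem boundary_eq by auto
  then obtain s' where "s' \<in> {t - \<delta><..<t + \<delta>}" "u s = u s'" by auto
  then have "s = s'" using u_inj s \<delta> t by (intro inj_onD[OF u_inj]) auto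
  then show False using s \<open>s' \<in> _\<close> by auto
qed

text \<open>Translation by whole periods moves the base point into one period, where
  \<open>u_inj\<close> and \<open>u_0_neq\<close> decide the three positions of \<open>a + t\<close>
  relative to \<open>T\<close>. An arbitrary base point is what permits cutting the curve open at
  any boundary point.\<close>

lemma u_neq_shift: "0 < t \<Longrightarrow> t < T \<Longrightarrow> u (s + t) \<noteq> u s"
proof -
  assume t: "0 < t" "t < T"
  obtain k where k: "0 \<le> s + of_int k * T" "s + of_int k * T < T" by (rule period_representative[OF T_pos])
  define a where "a = s + of_int k * T"
  have "u (s + t) = u (a + t)" "u s = u a"
    using u_periodic_int[of "s + t" k] u_periodic_int[of s k] by (simp_all add: a_def ac_simps)
  moreover have "u (a + t) \<noteq> u a"
  proof (cases "a = 0")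
    case True
    then show ?thesis using u_0_neq t by simp
  next
    case False
    then have a: "0 < a" "a < T" using k by (auto simp: a_def)
    consider "a + t < T" | "a + t = T" | "T < a + t" by linarith
    then show ?thesis
    proof cases
      case 1
      then show ?thesis using inj_onD[OF u_inj, of "a + t" a] a t by auto
    next
      case 2
      then show ?thesis using u_periodic[of 0] u_0_neq[OF a] by simp
    next
      case 3
      then show ?thesis using inj_onD[OF u_inj, of "a + t - T" a] u_periodic[of "a + t - T"] a t by auto
    qed
  qed
  ultimately show ?thesis by simp
qed

lemma normal_u: "outward_unit_normal M (u s) (\<nu> (u s))" "norm (\<nu> (u s)) = 1" "\<nu> (u s) \<bullet> u' s = 0"
  using normal[OF u_mem] outward_unit_normal_orthogonal[OF normal[OF u_mem] u_deriv refl u_in_M]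
  by (auto simp: outward_unit_normal_def)

text \<open>The frontier meets the box \<open>{(s, b)}\<close> only in \<open>b = 0\<close>, so each of the two open halves lies in \<open>M\<close>
  or in its complement; which one is decided by the normal at \<open>u s0\<close>.\<close>

lemma local_graph:
  obtains \<delta> h e n where "0 < \<delta>" "2 * \<delta> < T" "0 < h" "norm e = 1" "norm n = 1" "e \<bullet> n = 0"
    "\<And>s. s \<in> {s0 - \<delta>..s0 + \<delta>} \<Longrightarrow> 0 < e \<bullet> u' s"
    "inj_on (\<lambda>(s, b). u s + b *\<^sub>R n) ({s0 - \<delta>..s0 + \<delta>} \<times> {- h..h})"
    "\<And>s b. s \<in> {s0 - \<delta>..s0 + \<delta>} \<Longrightarrow> b \<in> {- h..h} \<Longrightarrow> u s + b *\<^sub>R n \<in> M \<longleftrightarrow> b \<le> 0"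
    "\<And>s. s \<in> {s0 - \<delta>..s0 + \<delta>} \<Longrightarrow> norm (u' s) *\<^sub>R \<nu> (u s) = (e \<bullet> u' s) *\<^sub>R n - (n \<bullet> u' s) *\<^sub>R e"
proof -
  define e where "e = sgn (u' s0)"
  define n where "n = \<nu> (u s0)"
  have on: "norm e = 1" "norm n = 1" "e \<bullet> n = 0"
    using normal_u[of s0] u'_nz[of s0] by (auto simp: e_def n_def norm_sgn sgn_div_norm inner_commute)
  have "0 < e \<bullet> u' s0"
    using u'_nz[of s0] by (simp add: e_def sgn_div_norm)
  moreover have "isCont (\<lambda>s. e \<bullet> u' s) s0"
    using u'_cont by (intro continuous_intros) (auto simp: continuous_on_eq_continuous_at)
  ultimately have "\<forall>\<^sub>F s in nhds s0. 0 < e \<bullet> u' s"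
    by (intro order_tendstoD(1)[of _ "e \<bullet> u' s0"]) (auto simp: isCont_def tendsto_nhds_iff)
  then obtain \<delta>1 where \<delta>1: "0 < \<delta>1" "\<And>s. \<bar>s - s0\<bar> < \<delta>1 \<Longrightarrow> 0 < e \<bullet> u' s"
    by (auto simp: eventually_nhds_metric dist_real_def)
  \<comment> \<open>\<open>e \<bullet> u\<close> is strictly increasing on the window. Moving along
    \<open>n\<close>, which is orthogonal to \<open>e\<close>, does not change this coordinate, so
    \<open>G\<close> is injective on the whole strip over the window.\<close>
  have inj1: "s = t" if "\<bar>s - s0\<bar> < \<delta>1" "\<bar>t - s0\<bar> < \<delta>1" "e \<bullet> u s = e \<bullet> u t" for s t
  proof -
    have "e \<bullet> u s < e \<bullet> u t" if "s < t" "\<bar>s - s0\<bar> < \<delta>1" "\<bar>t - s0\<bar> < \<delta>1" for s t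
    proof (rule DERIV_pos_imp_increasing[OF that(1)])
      fix x assume "s \<le> x" "x \<le> t"
      then have "0 < e \<bullet> u' x" using that by (intro \<delta>1) auto
      moreover have "((\<lambda>x. e \<bullet> u x) has_real_derivative e \<bullet> u' x) (at x)"
        using bounded_linear.has_vector_derivative[OF bounded_linear_inner_right u_deriv]
        by (simp add: has_real_derivative_iff_has_vector_derivative)
      ultimately show "\<exists>y. ((\<lambda>x. e \<bullet> u x) has_real_derivative y) (at x) \<and> 0 < y" by blast
    qed
    from this[of s t] this[of t s] that show ?thesis by (cases s t rule: linorder_cases) auto
  qed
  obtain N where N: "open N" "u s0 \<in> N" "frontier M \<inter> N \<subseteq> u ` {s0 - \<delta>1<..<s0 + \<delta>1}"
    using u_fills[OF \<delta>1(1)] by blast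
  obtain r where r: "0 < r" "ball (u s0) r \<subseteq> N" using N(1,2) by (metis openE)
  have "isCont u s0" using u_deriv has_vector_derivative_continuous by blast
  then obtain \<delta>2 where \<delta>2: "0 < \<delta>2" "\<And>s. \<bar>s - s0\<bar> < \<delta>2 \<Longrightarrow> dist (u s) (u s0) < r / 2"
    using r(1) unfolding continuous_at_eps_delta by (metis dist_real_def half_gt_zero)
  define d where "d = min \<delta>1 \<delta>2"
  define k where "k = r / 2"
  have dk: "0 < d" "0 < k" using \<delta>1 \<delta>2 r by (auto simp: d_def k_def)
  define G where "G = (\<lambda>(s, b). u s + b *\<^sub>R n)"
  have G_inj: "s = t \<and> b = c" if "\<bar>s - s0\<bar> < \<delta>1" "\<bar>t - s0\<bar> < \<delta>1" "G (s, b) = G (t, c)" for s t b c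
  proof -
    have "e \<bullet> G (s, b) = e \<bullet> G (t, c)" using that by simp
    then have "s = t" using that on by - (rule inj1, auto simp: G_def inner_add_right)
    moreover have "n \<noteq> 0" using on by auto
    ultimately show ?thesis using that by (auto simp: G_def)
  qed
  \<comment> \<open>The sizes \<open>d\<close> and \<open>k\<close> are such that \<open>G\<close>
    maps the box into \<open>N\<close>. There a frontier point equals \<open>u t\<close> with
    \<open>t\<close> in the window, and \<open>G_inj\<close> forces \<open>b = 0\<close>.\<close>
  have frontier: "b = 0" if fr: "\<bar>s - s0\<bar> < d" "\<bar>b\<bar> < k" "G (s, b) \<in> frontier M" for s b
  proof -
    have "dist (G (s, b)) (u s0) \<le> dist (u s) (u s0) + \<bar>b\<bar>"
      using norm_triangle_ineq[of "u s - u s0" "b *\<^sub>R n"] on by (simp add: G_def dist_norm algebra_simps)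
    also have "\<dots> < r" using \<delta>2(2)[of s] that by (simp add: d_def k_def)
    finally have "G (s, b) \<in> N" using r by (auto simp: dist_commute)
    then obtain t where "t \<in> {s0 - \<delta>1<..<s0 + \<delta>1}" "G (s, b) = u t" using N(3) fr(3) by blast
    then show ?thesis using G_inj[of s t b 0] fr by (auto simp: G_def d_def)
  qed
  obtain d' where d': "0 < d'" "\<And>t. 0 < t \<Longrightarrow> t < d' \<Longrightarrow> u s0 + t *\<^sub>R n \<notin> M \<and> u s0 - t *\<^sub>R n \<in> M"
    using outward_unit_normal_transversal[OF normal_u(1)] n_def by metis
  define t0 where "t0 = min d' k / 2"
  have t0: "0 < t0" "t0 < d'" "t0 < k" using d' dk by (auto simp: t0_def)
  have G_cont: "continuous_on S G" for S
    unfolding G_def case_prod_unfold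
    by (intro continuous_intros continuous_on_compose2[OF u_cont[of UNIV]]) auto
  have conn: "connected (G ` ({s0 - d<..<s0 + d} \<times> I))" if "connected I" for I
    using that by (intro connected_continuous_image G_cont connected_Times) auto
  have upper: "G (s, b) \<notin> M" if "\<bar>s - s0\<bar> < d" "0 < b" "b < k" for s b
  proof
    assume "G (s, b) \<in> M"
    have "G ` ({s0 - d<..<s0 + d} \<times> {0<..<k}) \<inter> frontier M \<noteq> {}"
    proof (rule connected_Int_frontier[OF conn])
      have "G (s, b) \<in> G ` ({s0 - d<..<s0 + d} \<times> {0<..<k})"
        using that by (intro imageI) auto
      then show "G ` ({s0 - d<..<s0 + d} \<times> {0<..<k}) \<inter> M \<noteq> {}"
        using \<open>G (s, b) \<in> M\<close> by blast
      have "G (s0, t0) \<in> G ` ({s0 - d<..<s0 + d} \<times> {0<..<k}) - M"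
        using d'(2)[of t0] t0 dk by (auto simp: G_def)
      then show "G ` ({s0 - d<..<s0 + d} \<times> {0<..<k}) - M \<noteq> {}" by blast
    qed simp
    then show False using frontier by (force simp: abs_less_iff)
  qed
  have lower: "G (s, b) \<in> M" if "\<bar>s - s0\<bar> < d" "- k < b" "b < 0" for s b
  proof (rule ccontr)
    assume *: "G (s, b) \<notin> M"
    have "G ` ({s0 - d<..<s0 + d} \<times> {-k<..<0}) \<inter> frontier M \<noteq> {}"
    proof (rule connected_Int_frontier[OF conn])
      have "G (s0, - t0) \<in> G ` ({s0 - d<..<s0 + d} \<times> {-k<..<0})"
        using t0 dk by (intro imageI) auto
      moreover have "G (s0, - t0) \<in> M" using d'(2)[of t0] t0 by (simp add: G_def)
      ultimately show "G ` ({s0 - d<..<s0 + d} \<times> {-k<..<0}) \<inter> M \<noteq> {}" by blast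
      have "G (s, b) \<in> G ` ({s0 - d<..<s0 + d} \<times> {-k<..<0})"
        using that by (intro imageI) auto
      then show "G ` ({s0 - d<..<s0 + d} \<times> {-k<..<0}) - M \<noteq> {}" using * by blast
    qed simp
    then show False using frontier by (force simp: abs_less_iff)
  qed
  \<comment> \<open>\<open>d / 2\<close> fits the closed interval into the open window, and
    \<open>T / 4\<close> guarantees \<open>2 * \<delta> < T\<close>, so that the box sees less than
    one period.\<close>
  define \<delta> where "\<delta> = min (d / 2) (T / 4)"
  have \<delta>: "0 < \<delta>" "\<delta> < d" "2 * \<delta> < T" using dk T_pos by (auto simp: \<delta>_def)
  have close: "\<bar>s - s0\<bar> < d \<and> \<bar>s - s0\<bar> < \<delta>1" if "s \<in> {s0 - \<delta>..s0 + \<delta>}" for s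
    using that \<delta> by (auto simp: d_def)
  show ?thesis
  proof (rule that[of \<delta> "k / 2" e n])
    show "inj_on (\<lambda>(s, b). u s + b *\<^sub>R n) ({s0 - \<delta>..s0 + \<delta>} \<times> {- (k / 2)..k / 2})"
      unfolding G_def[symmetric] using G_inj close by (intro inj_onI) (clarify, blast)
    show "u s + b *\<^sub>R n \<in> M \<longleftrightarrow> b \<le> 0" if s: "s \<in> {s0 - \<delta>..s0 + \<delta>}" and b: "b \<in> {- (k / 2)..k / 2}" for s b
    proof -
      consider "b < 0" | "b = 0" | "0 < b" by linarith
      then show ?thesis
        using upper[of s b] lower[of s b] close[OF s] b dk u_in_M by cases (auto simp: G_def)
    qed
    show "norm (u' s) *\<^sub>R \<nu> (u s) = (e \<bullet> u' s) *\<^sub>R n - (n \<bullet> u' s) *\<^sub>R e" if s: "s \<in> {s0 - \<delta>..s0 + \<delta>}" for s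
    proof -
      define m where "m = \<nu> (u s)"
      define a where "a = e \<bullet> u' s"
      define b where "b = n \<bullet> u' s"
      \<comment> \<open>Unit length and orthogonality to \<open>u' s\<close> determine
        \<open>m\<close> up to sign. By \<open>lower\<close>, the direction \<open>- n\<close> leads
        into \<open>M\<close> from every \<open>u s\<close> over the box, and this selects the
        sign.\<close>
      have "- n \<bullet> m \<le> 0"
        unfolding m_def
      proof (rule outward_unit_normal_inward[OF normal_u(1) u_deriv refl u_in_M u'_nz dk(2)])
        fix t assume "0 < t" "t < k"
        then show "u s + t *\<^sub>R - n \<in> M" using lower[of s "- t"] close[OF s] by (simp add: G_def)
      qed
      then have \<alpha>: "0 \<le> m \<bullet> n" by (simp add: inner_commute)
      have a: "0 < a" using \<delta>1(2) close[OF s] by (auto simp: a_def)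
      have m: "m = (m \<bullet> e) *\<^sub>R e + (m \<bullet> n) *\<^sub>R n" by (rule orthonormal_expansion_2[OF on])
      have v: "u' s = a *\<^sub>R e + b *\<^sub>R n"
        using orthonormal_expansion_2[OF on, of "u' s"] by (simp add: a_def b_def inner_commute)
      have ee: "e \<bullet> e = 1" "n \<bullet> n = 1" "n \<bullet> e = 0" using on by (auto simp: norm_eq_1 inner_commute)
      have mb: "(m \<bullet> e) * a + (m \<bullet> n) * b = 0"
        using normal_u(3)[of s] by (simp add: m_def[symmetric] v inner_add_right mult.commute)
      have m1: "(m \<bullet> e)\<^sup>2 + (m \<bullet> n)\<^sup>2 = 1"
      proof -
        have "m \<bullet> m = 1" using normal_u(2)[of s] by (simp add: m_def norm_eq_1)
        then show ?thesis by (subst (asm) (1 2) m) (simp add: inner_add_left inner_add_right ee on power2_eq_square)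
      qed
      have nv: "(norm (u' s))\<^sup>2 = a\<^sup>2 + b\<^sup>2"
        unfolding power2_norm_eq_inner by (simp add: v inner_add_left inner_add_right ee on power2_eq_square)
      have "(norm (u' s) * (m \<bullet> n))\<^sup>2 = a\<^sup>2 * (m \<bullet> n)\<^sup>2 + ((m \<bullet> n) * b)\<^sup>2"
        by (simp add: power_mult_distrib nv distrib_right)
      also have "(m \<bullet> n) * b = - ((m \<bullet> e) * a)" using mb by linarith
      also have "a\<^sup>2 * (m \<bullet> n)\<^sup>2 + (- ((m \<bullet> e) * a))\<^sup>2 = a\<^sup>2 * ((m \<bullet> e)\<^sup>2 + (m \<bullet> n)\<^sup>2)"
        by (simp add: power_mult_distrib algebra_simps)
      finally have "(norm (u' s) * (m \<bullet> n))\<^sup>2 = a\<^sup>2" by (simp add: m1)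
      then have 1: "norm (u' s) * (m \<bullet> n) = a"
        by (rule power2_eq_imp_eq) (use a \<alpha> in auto)
      have "a * (norm (u' s) * (m \<bullet> e)) = a * (- b)"
        using mb 1 by algebra
      then have 2: "norm (u' s) * (m \<bullet> e) = - b" using a mult_left_cancel[of a] by blast
      have "norm (u' s) *\<^sub>R m = (norm (u' s) * (m \<bullet> e)) *\<^sub>R e + (norm (u' s) * (m \<bullet> n)) *\<^sub>R n"
        by (subst m) (simp add: scaleR_add_right)
      then show ?thesis unfolding 1 2 by (simp add: m_def a_def b_def)
    qed
  qed (use \<delta> dk on \<delta>1 close in auto)
qed

end

section \<open>The divergence theorem\<close>

text \<open>Fubini is formulated on \<open>real \<times> real\<close>. The coordinate map
  \<open>g\<close> and its inverse \<open>h\<close> send boxes to boxes of equal content, which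
  transports the integral.\<close>

lemma integral_cbox_vec2:
  fixes F :: "real \<Rightarrow> real \<Rightarrow> 'a::euclidean_space"
  assumes F: "continuous_on UNIV (\<lambda>(s, t). F s t)"
  shows integral_cbox_vec2_iterated:
      "integral (cbox (vector [a, c]) (vector [b, d] :: real^2)) (\<lambda>x. F (x $ 1) (x $ 2)) =
        integral {a..b} (\<lambda>s. integral {c..d} (F s))"
    and integral_cbox_vec2_iterated_swap:
      "integral (cbox (vector [a, c]) (vector [b, d] :: real^2)) (\<lambda>x. F (x $ 1) (x $ 2)) =
        integral {c..d} (\<lambda>t. integral {a..b} (\<lambda>s. F s t))"
proof -
  define g :: "real^2 \<Rightarrow> real \<times> real" where "g x = (x $ 1, x $ 2)" for x
  define h :: "real \<times> real \<Rightarrow> real^2" where "h p = vector [fst p, snd p]" for p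
  have hg: "h (g x) = x" and gh: "g (h p) = p" for x p
    by (auto simp: g_def h_def vec_eq_iff forall_2)
  have himg: "h ` cbox p q = cbox (h p) (h q)" for p q
  proof (intro equalityI subsetI)
    fix x assume "x \<in> cbox (h p) (h q)"
    then have "g x \<in> cbox p q"
      by (cases p; cases q) (auto simp: g_def h_def mem_box_cart forall_2 cbox_Pair_eq)
    then show "x \<in> h ` cbox p q" using hg by (metis imageI)
  qed (cases p; cases q; auto simp: h_def mem_box_cart forall_2 cbox_Pair_eq)
  have gimg: "g ` cbox x y = cbox (g x) (g y)" for x y
  proof -
    have "g ` cbox x y = g ` cbox (h (g x)) (h (g y))" by (simp add: hg)
    also have "\<dots> = g ` h ` cbox (g x) (g y)" by (simp add: himg)
    finally show ?thesis by (simp add: image_image gh)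
  qed
  have content: "measure lborel (g ` cbox x y) = 1 * measure lborel (cbox x y)" for x y
  proof (cases "cbox x y = {}")
    case False
    then have "x $ 1 \<le> y $ 1" "x $ 2 \<le> y $ 2" by (auto simp: interval_ne_empty_cart)
    then show ?thesis
      unfolding gimg using content_cbox_cart[OF False]
      by (simp add: g_def content_Pair prod_2 UNIV_2)
  qed simp
  have Fc: "continuous_on S (\<lambda>p. F (fst p) (snd p))" for S
    using continuous_on_subset[OF F, of S] by (simp add: case_prod_unfold)
  have "((\<lambda>p. F (fst p) (snd p)) has_integral integral (cbox (a, c) (b, d)) (\<lambda>p. F (fst p) (snd p))) (cbox (a, c) (b, d))"
    by (intro integrable_integral integrable_continuous Fc)
  then have "((\<lambda>x. F (fst (g x)) (snd (g x))) has_integral (1 / 1) *\<^sub>R integral (cbox (a, c) (b, d)) (\<lambda>p. F (fst p) (snd p)))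
      (h ` cbox (a, c) (b, d))"
  proof (intro has_integral_twiddle hg gh content)
    show "\<exists>w z. g ` cbox x y = cbox w z" for x y using gimg by blast
    show "\<exists>w z. h ` cbox p q = cbox w z" for p q using himg by blast
  qed (auto simp: g_def intro!: continuous_intros)
  then have *: "integral (cbox (vector [a, c]) (vector [b, d] :: real^2)) (\<lambda>x. F (x $ 1) (x $ 2)) =
      integral (cbox (a, c) (b, d)) (\<lambda>p. F (fst p) (snd p))"
    unfolding himg by (intro integral_unique) (simp add: g_def h_def)
  also have "\<dots> = integral {a..b} (\<lambda>s. integral {c..d} (F s))"
    using integral_prod_continuous[OF Fc, of a c b d] by simp
  finally show 1: "integral (cbox (vector [a, c]) (vector [b, d] :: real^2)) (\<lambda>x. F (x $ 1) (x $ 2)) =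
      integral {a..b} (\<lambda>s. integral {c..d} (F s))" .
  show "integral (cbox (vector [a, c]) (vector [b, d] :: real^2)) (\<lambda>x. F (x $ 1) (x $ 2)) =
        integral {c..d} (\<lambda>t. integral {a..b} (\<lambda>s. F s t))"
    unfolding 1 using integral_swap_continuous[OF continuous_on_subset[OF F subset_UNIV], of a b c d] by simp
qed

text \<open>The gradient is carried as an explicit function, so that products and translates have
  gradients given by terms and continuity can be stated for them.\<close>

definition C1_grad :: "('a::euclidean_space \<Rightarrow> real) \<Rightarrow> ('a \<Rightarrow> 'a) \<Rightarrow> bool" where
  "C1_grad f f' \<longleftrightarrow> (\<forall>x. (f has_derivative (\<lambda>v. f' x \<bullet> v)) (at x)) \<and> continuous_on UNIV f'"

lemma C1_grad_chain:
  assumes "C1_grad f f'" "(\<gamma> has_vector_derivative v) (at t within S)"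
  shows "((\<lambda>t. f (\<gamma> t)) has_vector_derivative f' (\<gamma> t) \<bullet> v) (at t within S)"
  using vector_derivative_diff_chain_within[OF assms(2), of f "\<lambda>v. f' (\<gamma> t) \<bullet> v"] assms(1)
  by (auto simp: C1_grad_def o_def intro: has_derivative_at_withinI)

lemma C1_grad_continuous: "C1_grad f f' \<Longrightarrow> continuous_on S f"
  unfolding C1_grad_def
  by (intro continuous_at_imp_continuous_on ballI) (blast intro: has_derivative_continuous)

lemma inner_integral:
  fixes F :: "real^2 \<Rightarrow> real^2"
  assumes "F integrable_on S"
  shows "w \<bullet> integral S F = integral S (\<lambda>x. w \<bullet> F x)"
  using integral_linear[OF assms bounded_linear_inner_right[of w]] by (simp add: o_def)

context boundary_curve
begin

text \<open>\<open>\<nu>\<close> is prescribed only point by point. Its continuity along the curve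
  comes from the local formula in terms of \<open>u'\<close> and the fixed pair \<open>e\<close>,
  \<open>n\<close>.\<close>

lemma normal_cont: "continuous_on UNIV (\<lambda>s. norm (u' s) *\<^sub>R \<nu> (u s))"
proof (intro continuous_at_imp_continuous_on ballI)
  fix s0
  obtain \<delta> e n where \<delta>: "0 < \<delta>"
    and eq: "\<And>s. s \<in> {s0 - \<delta>..s0 + \<delta>} \<Longrightarrow> norm (u' s) *\<^sub>R \<nu> (u s) = (e \<bullet> u' s) *\<^sub>R n - (n \<bullet> u' s) *\<^sub>R e"
    using local_graph[of s0] by metis
  have "isCont (\<lambda>s. (e \<bullet> u' s) *\<^sub>R n - (n \<bullet> u' s) *\<^sub>R e) s0"
    using u'_cont by (intro continuous_intros) (auto simp: continuous_on_eq_continuous_at)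
  moreover have "\<forall>\<^sub>F s in nhds s0. (e \<bullet> u' s) *\<^sub>R n - (n \<bullet> u' s) *\<^sub>R e = norm (u' s) *\<^sub>R \<nu> (u s)"
    unfolding eventually_nhds_metric dist_real_def using \<delta> eq
    by (intro exI[of _ \<delta>]) (auto simp: abs_less_iff)
  ultimately show "isCont (\<lambda>s. norm (u' s) *\<^sub>R \<nu> (u s)) s0"
    by (rule isCont_cong[THEN iffD1, rotated])
qed

text \<open>In the coordinates \<open>(s, b)\<close> with \<open>x = u s + b *\<^sub>R n\<close> the Jacobian is \<open>e \<bullet> u' s\<close>, and
  \<open>(e \<bullet> u') *\<^sub>R e = u' - (n \<bullet> u') *\<^sub>R n\<close> turns both components of the integrand into coordinate
  derivatives of \<open>f\<close>, up to factors depending on \<open>s\<close> only.\<close>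

lemma divergence_local_boundary:
  obtains \<rho> where "0 < \<rho>" "\<And>f f'. C1_grad f f' \<Longrightarrow> (\<And>x. x \<notin> ball (u s0) \<rho> \<Longrightarrow> f x = 0 \<and> f' x = 0) \<Longrightarrow>
    integral M f' = integral {0..T} (\<lambda>s. f (u s) *\<^sub>R norm (u' s) *\<^sub>R \<nu> (u s))"
proof -
  obtain \<delta> h e n where \<delta>: "0 < \<delta>" "2 * \<delta> < T" and h: "0 < h"
    and on: "norm e = 1" "norm n = 1" "e \<bullet> n = 0"
    and pos: "\<And>s. s \<in> {s0 - \<delta>..s0 + \<delta>} \<Longrightarrow> 0 < e \<bullet> u' s"
    and inj: "inj_on (\<lambda>(s, b). u s + b *\<^sub>R n) ({s0 - \<delta>..s0 + \<delta>} \<times> {- h..h})"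
    and mem: "\<And>s b. s \<in> {s0 - \<delta>..s0 + \<delta>} \<Longrightarrow> b \<in> {- h..h} \<Longrightarrow> u s + b *\<^sub>R n \<in> M \<longleftrightarrow> b \<le> 0"
    and \<nu>_eq: "\<And>s. s \<in> {s0 - \<delta>..s0 + \<delta>} \<Longrightarrow> norm (u' s) *\<^sub>R \<nu> (u s) = (e \<bullet> u' s) *\<^sub>R n - (n \<bullet> u' s) *\<^sub>R e"
    using local_graph[of s0] by metis
  define G where "G = (\<lambda>(s, b). u s + b *\<^sub>R n)"
  define Q where "Q = {s0 - \<delta><..<s0 + \<delta>} \<times> {- h<..<h}"
  define Q' where "Q' = {s0 - \<delta>..s0 + \<delta>} \<times> {- h..h}"
  have G_cont: "continuous_on S G" for S
    unfolding G_def case_prod_unfold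
    by (intro continuous_intros continuous_on_compose2[OF u_cont[of UNIV]]) auto
  have injG: "inj_on G Q'" using inj by (simp add: G_def Q'_def)
  \<comment> \<open>Injectivity and continuity suffice for openness by invariance of domain; hence
    some ball around \<open>u s0\<close> is covered by the box.\<close>
  have "open (G ` Q)"
  proof (rule invariance_of_domain_gen[OF _ G_cont])
    show "inj_on G Q" by (rule inj_on_subset[OF injG]) (auto simp: Q_def Q'_def)
  qed (auto simp: Q_def open_Times)
  moreover have "u s0 \<in> G ` Q"
    using \<delta> h by (intro image_eqI[of _ _ "(s0, 0)"]) (auto simp: G_def Q_def)
  ultimately obtain \<rho>1 where \<rho>1: "0 < \<rho>1" "ball (u s0) \<rho>1 \<subseteq> G ` Q" by (metis openE)
  \<comment> \<open>\<open>\<rho>2\<close> keeps the ball away from the rest of the period, so that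
    only the arc over the box contributes to the line integral.\<close>
  have "closed (u ` {s0 + \<delta>..s0 + T - \<delta>})"
    by (intro compact_imp_closed compact_continuous_image u_cont) simp
  moreover have "u s0 \<notin> u ` {s0 + \<delta>..s0 + T - \<delta>}"
  proof
    assume "u s0 \<in> u ` {s0 + \<delta>..s0 + T - \<delta>}"
    then obtain s where "s \<in> {s0 + \<delta>..s0 + T - \<delta>}" "u s = u s0" by auto
    then show False using u_neq_shift[of "s - s0" s0] \<delta> by auto
  qed
  ultimately obtain \<rho>2 where \<rho>2: "0 < \<rho>2" "ball (u s0) \<rho>2 \<subseteq> - u ` {s0 + \<delta>..s0 + T - \<delta>}"
    by (metis ComplI openE open_Compl)
  \<comment> \<open>\<open>S\<close> is the half \<open>b \<le> 0\<close> of the box, the one that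
    \<open>G'\<close> maps into \<open>M\<close>. It is a box in \<open>real^2\<close>, because the
    change of variables is stated with the determinant of a matrix.\<close>
  define S :: "(real^2) set" where "S = cbox (vector [s0 - \<delta>, - h]) (vector [s0 + \<delta>, 0])"
  define G' :: "real^2 \<Rightarrow> real^2" where "G' x = u (x $ 1) + (x $ 2) *\<^sub>R n" for x
  have S_iff: "x \<in> S \<longleftrightarrow> x $ 1 \<in> {s0 - \<delta>..s0 + \<delta>} \<and> x $ 2 \<in> {- h..0}" for x
    by (auto simp: S_def mem_box_cart forall_2)
  show thesis
  proof (rule that[of "min \<rho>1 \<rho>2"])
    fix f f' assume f: "C1_grad f f'" and supp: "\<And>x. x \<notin> ball (u s0) (min \<rho>1 \<rho>2) \<Longrightarrow> f x = 0 \<and> f' x = 0"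
    have f'c: "continuous_on UNIV f'" using f by (simp add: C1_grad_def)
    \<comment> \<open>\<open>G\<close> is injective on the closed box, so its edge is mapped outside
      the image of the open box, which contains the support.\<close>
    have edge: "f (G p) = 0" if "p \<in> Q'" "p \<notin> Q" for p
    proof -
      have "G p \<notin> G ` Q"
      proof
        assume "G p \<in> G ` Q"
        then obtain q where "q \<in> Q" "G p = G q" by auto
        moreover have "Q \<subseteq> Q'" by (auto simp: Q_def Q'_def)
        ultimately show False using inj_onD[OF injG, of p q] that by auto
      qed
      then show ?thesis using \<rho>1 supp by (metis ball_min_Int IntD1 subsetD)
    qed
    have "integral M f' = integral (G' ` S) f'"
    proof -
      have "(if x \<in> M then f' x else 0) = (if x \<in> G' ` S then f' x else 0)" for x
      proof (cases "x \<in> ball (u s0) (min \<rho>1 \<rho>2)")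
        case True
        then obtain s b where sb: "(s, b) \<in> Q" "x = u s + b *\<^sub>R n"
          using \<rho>1(2) by (auto simp: G_def)
        have "x \<in> G' ` S" if "b \<le> 0"
          using sb that by (intro image_eqI[of _ _ "vector [s, b]"]) (auto simp: G'_def S_iff Q_def)
        moreover have "x \<in> M" if "x \<in> G' ` S"
          using that mem h by (auto simp: G'_def S_iff)
        moreover have "x \<in> M \<longleftrightarrow> b \<le> 0" using mem[of s b] sb by (auto simp: Q_def)
        ultimately show ?thesis by auto
      qed (use supp in auto)
      then show ?thesis
        by (subst (1 2) integral_restrict_UNIV[symmetric]) simp
    qed
    also have "\<dots> = integral S (\<lambda>x. (e \<bullet> u' (x $ 1)) *\<^sub>R f' (G' x))"
    proof -
      define D where "D x v = (v $ 1) *\<^sub>R u' (x $ 1) + (v $ 2) *\<^sub>R n" for x v :: "real^2"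
      have deriv: "(G' has_derivative D x) (at x within S)" for x
      proof -
        have "(u has_derivative (\<lambda>r. r *\<^sub>R u' (x $ 1))) (at (x $ 1))"
          using u_deriv by (simp add: has_vector_derivative_def)
        moreover have "((\<lambda>x::real^2. x $ 1) has_derivative (\<lambda>v. v $ 1)) (at x)"
          by (rule bounded_linear_imp_has_derivative[OF bounded_linear_vec_nth])
        ultimately have "((\<lambda>x::real^2. u (x $ 1)) has_derivative (\<lambda>v. (v $ 1) *\<^sub>R u' (x $ 1))) (at x)"
          using diff_chain_at[of "\<lambda>x::real^2. x $ 1" _ x u] by (simp add: o_def)
        moreover have "((\<lambda>x::real^2. (x $ 2) *\<^sub>R n) has_derivative (\<lambda>v. (v $ 2) *\<^sub>R n)) (at x)"
          by (intro bounded_linear_imp_has_derivative bounded_linear_scaleR_const bounded_linear_vec_nth)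
        ultimately have "(G' has_derivative D x) (at x)"
          unfolding G'_def[abs_def] D_def[abs_def] by (rule has_derivative_add)
        then show ?thesis by (rule has_derivative_at_withinI)
      qed
      \<comment> \<open>The columns are \<open>u'\<close> and \<open>n\<close>. Only the
        \<open>e\<close>-component of \<open>u'\<close> counts, and the orthonormal pair
        \<open>e\<close>, \<open>n\<close> has determinant plus or minus 1.\<close>
      have det: "\<bar>det (matrix (D x))\<bar> = e \<bullet> u' (x $ 1)" if "x \<in> S" for x
      proof -
        define v where "v = u' (x $ 1)"
        have v: "v = (v \<bullet> e) *\<^sub>R e + (v \<bullet> n) *\<^sub>R n" by (rule orthonormal_expansion_2[OF on])
        have v1: "v $ 1 = (v \<bullet> e) * e $ 1 + (v \<bullet> n) * n $ 1" "v $ 2 = (v \<bullet> e) * e $ 2 + (v \<bullet> n) * n $ 2"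
          using arg_cong[OF v, of "\<lambda>z. z $ 1"] arg_cong[OF v, of "\<lambda>z. z $ 2"] by simp_all
        have "e$1 * e$1 + e$2 * e$2 = 1" "n$1 * n$1 + n$2 * n$2 = 1" "e$1 * n$1 + e$2 * n$2 = 0"
          using on by (simp_all add: norm_eq_1 inner_vec_def sum_2)
        then have "(e $ 1 * n $ 2 - n $ 1 * e $ 2)\<^sup>2 = 1" by algebra
        then have 1: "\<bar>e $ 1 * n $ 2 - n $ 1 * e $ 2\<bar> = 1" by (simp only: abs_square_eq_1)
        have "det (matrix (D x)) = v $ 1 * n $ 2 - n $ 1 * v $ 2"
          by (simp add: det_2 matrix_def D_def v_def axis_def)
        also have "\<dots> = (v \<bullet> e) * (e $ 1 * n $ 2 - n $ 1 * e $ 2)"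
          unfolding v1 by (simp add: algebra_simps)
        finally have "\<bar>det (matrix (D x))\<bar> = \<bar>v \<bullet> e\<bar>" using 1 by (simp add: abs_mult)
        then show ?thesis using pos[of "x $ 1"] that by (simp add: v_def S_iff inner_commute)
      qed
      have "inj_on G' S"
      proof (rule inj_onI)
        fix x y assume "x \<in> S" "y \<in> S" "G' x = G' y"
        then have "(x $ 1, x $ 2) = (y $ 1, y $ 2)"
          using h by (intro inj_onD[OF injG]) (auto simp: G_def G'_def Q'_def S_iff)
        then show "x = y" by (simp add: vec_eq_iff forall_2)
      qed
      moreover have abs_int: "(\<lambda>x. \<bar>det (matrix (D x))\<bar> *\<^sub>R f' (G' x)) absolutely_integrable_on S"
      proof -
        have "continuous_on S (\<lambda>x. (e \<bullet> u' (x $ 1)) *\<^sub>R f' (G' x))"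
          unfolding G'_def
          by (intro continuous_intros continuous_on_compose2[OF u'_cont] continuous_on_compose2[OF f'c]
              continuous_on_compose2[OF u_cont[of UNIV]]) auto
        then have "(\<lambda>x. (e \<bullet> u' (x $ 1)) *\<^sub>R f' (G' x)) absolutely_integrable_on S"
          unfolding S_def by (rule absolutely_integrable_continuous)
        then show ?thesis by (subst set_integrable_cong[OF refl refl]) (simp_all add: det)
      qed
      ultimately have "integral (G' ` S) f' = integral S (\<lambda>x. \<bar>det (matrix (D x))\<bar> *\<^sub>R f' (G' x))"
        using deriv by (intro integral_change_of_variables) (auto simp: S_def)
      also have "\<dots> = integral S (\<lambda>x. (e \<bullet> u' (x $ 1)) *\<^sub>R f' (G' x))"
        by (intro Henstock_Kurzweil_Integration.integral_cong) (simp add: det)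
      finally show ?thesis .
    qed
    finally have I: "integral M f' = integral S (\<lambda>x. (e \<bullet> u' (x $ 1)) *\<^sub>R f' (G' x))" .
    show "integral M f' = integral {0..T} (\<lambda>s. f (u s) *\<^sub>R norm (u' s) *\<^sub>R \<nu> (u s))"
    proof -
      define a where "a = s0 - \<delta>"
      define c where "c = s0 + \<delta>"
      have ac: "a < c" "c \<le> a + T" using \<delta> by (auto simp: a_def c_def)
      have cont: "continuous_on UNIV (\<lambda>(s, b). k s \<bullet> f' (u s + b *\<^sub>R n))"
        if "continuous_on UNIV k" for k :: "real \<Rightarrow> real^2"
        unfolding case_prod_unfold
        by (intro continuous_intros continuous_on_compose2[OF that] continuous_on_compose2[OF f'c]
            continuous_on_compose2[OF u_cont[of UNIV]]) auto
      have S_int: "(\<lambda>x. k (x $ 1) \<bullet> f' (G' x)) integrable_on S"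
        if "continuous_on UNIV k" for k :: "real \<Rightarrow> real^2"
        unfolding G'_def S_def
        by (intro integrable_continuous continuous_intros continuous_on_compose2[OF that]
            continuous_on_compose2[OF f'c] continuous_on_compose2[OF u_cont[of UNIV]]) auto
      \<comment> \<open>Integrating along \<open>n\<close> first leaves the values on the curve, at
        \<open>b = 0\<close>, since \<open>f\<close> vanishes on the edge
        \<open>b = - h\<close>.\<close>
      have along_n: "integral S (\<lambda>x. (k (x $ 1) *\<^sub>R n) \<bullet> f' (G' x)) = integral {a..c} (\<lambda>s. k s * f (u s))"
        if k: "continuous_on UNIV k" for k :: "real \<Rightarrow> real"
      proof -
        have "integral S (\<lambda>x. (k (x $ 1) *\<^sub>R n) \<bullet> f' (G' x)) =
            integral {a..c} (\<lambda>s. integral {- h..0} (\<lambda>b. (k s *\<^sub>R n) \<bullet> f' (u s + b *\<^sub>R n)))"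
          unfolding S_def a_def c_def G'_def
          by (rule integral_cbox_vec2_iterated[OF cont]) (intro continuous_intros k)
        also have "\<dots> = integral {a..c} (\<lambda>s. k s * f (u s))"
        proof (rule Henstock_Kurzweil_Integration.integral_cong)
          fix s assume s: "s \<in> {a..c}"
          have "((\<lambda>b. (k s *\<^sub>R n) \<bullet> f' (u s + b *\<^sub>R n)) has_integral
              k s * f (u s + 0 *\<^sub>R n) - k s * f (u s + (- h) *\<^sub>R n)) {- h..0}"
          proof (rule fundamental_theorem_of_calculus)
            fix b
            have "((\<lambda>b. u s + b *\<^sub>R n) has_vector_derivative n) (at b within {- h..0})"
              by (auto intro!: derivative_eq_intros)
            from has_vector_derivative_mult_right[OF C1_grad_chain[OF f this], of "k s"]
            show "((\<lambda>b. k s * f (u s + b *\<^sub>R n)) has_vector_derivative (k s *\<^sub>R n) \<bullet> f' (u s + b *\<^sub>R n)) (at b within {- h..0})"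
              by (simp add: inner_commute)
          qed (use h in simp)
          moreover have "f (u s + (- h) *\<^sub>R n) = 0"
            using edge[of "(s, - h)"] s h by (auto simp: Q_def Q'_def G_def a_def c_def)
          ultimately show "integral {- h..0} (\<lambda>b. (k s *\<^sub>R n) \<bullet> f' (u s + b *\<^sub>R n)) = k s * f (u s)"
            by (intro integral_unique) simp
        qed
        finally show ?thesis .
      qed
      \<comment> \<open>Integrating in the curve parameter first leaves differences of values of
        \<open>f\<close> on the two side edges, where it vanishes.\<close>
      have along_u: "integral S (\<lambda>x. u' (x $ 1) \<bullet> f' (G' x)) = 0"
      proof -
        have "integral S (\<lambda>x. u' (x $ 1) \<bullet> f' (G' x)) =
            integral {- h..0} (\<lambda>b. integral {a..c} (\<lambda>s. u' s \<bullet> f' (u s + b *\<^sub>R n)))"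
          unfolding S_def a_def c_def G'_def
          by (rule integral_cbox_vec2_iterated_swap[OF cont]) (rule u'_cont)
        also have "\<dots> = integral {- h..0} (\<lambda>b. 0)"
        proof (rule Henstock_Kurzweil_Integration.integral_cong)
          fix b assume b: "b \<in> {- h..0}"
          have "((\<lambda>s. u' s \<bullet> f' (u s + b *\<^sub>R n)) has_integral f (u c + b *\<^sub>R n) - f (u a + b *\<^sub>R n)) {a..c}"
          proof (rule fundamental_theorem_of_calculus)
            fix s
            have "((\<lambda>s. u s + b *\<^sub>R n) has_vector_derivative u' s + 0) (at s within {a..c})"
              by (intro has_vector_derivative_add has_vector_derivative_const has_vector_derivative_at_within[OF u_deriv])
            from C1_grad_chain[OF f this]
            show "((\<lambda>s. f (u s + b *\<^sub>R n)) has_vector_derivative u' s \<bullet> f' (u s + b *\<^sub>R n)) (at s within {a..c})"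
              by (simp add: inner_commute)
          qed (use ac in simp)
          moreover have "f (u c + b *\<^sub>R n) = 0" "f (u a + b *\<^sub>R n) = 0"
            using edge[of "(c, b)"] edge[of "(a, b)"] b h \<delta> by (auto simp: Q_def Q'_def G_def a_def c_def)
          ultimately show "integral {a..c} (\<lambda>s. u' s \<bullet> f' (u s + b *\<^sub>R n)) = 0"
            by (intro integral_unique) simp
        qed
        finally show ?thesis by simp
      qed
      have inner_I: "w \<bullet> integral M f' = integral S (\<lambda>x. ((e \<bullet> u' (x $ 1)) *\<^sub>R w) \<bullet> f' (G' x))" for w
      proof -
        have "continuous_on S (\<lambda>x. (e \<bullet> u' (x $ 1)) *\<^sub>R f' (G' x))"
          unfolding G'_def
          by (intro continuous_intros continuous_on_compose2[OF u'_cont] continuous_on_compose2[OF f'c]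
              continuous_on_compose2[OF u_cont[of UNIV]]) auto
        then show ?thesis
          unfolding I by (subst inner_integral) (auto simp: S_def intro!: integrable_continuous)
      qed
      have k1: "continuous_on UNIV (\<lambda>s. e \<bullet> u' s)" "continuous_on UNIV (\<lambda>s. n \<bullet> u' s)"
        by (intro continuous_intros u'_cont)+
      have n_I: "n \<bullet> integral M f' = integral {a..c} (\<lambda>s. (e \<bullet> u' s) * f (u s))"
        unfolding inner_I by (rule along_n[OF k1(1)])
      have "((e \<bullet> u' s) *\<^sub>R e) = u' s - (n \<bullet> u' s) *\<^sub>R n" for s
        using orthonormal_expansion_2[OF on, of "u' s"] by (simp add: inner_commute algebra_simps)
      then have "e \<bullet> integral M f' = integral S (\<lambda>x. u' (x $ 1) \<bullet> f' (G' x) - ((n \<bullet> u' (x $ 1)) *\<^sub>R n) \<bullet> f' (G' x))"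
        unfolding inner_I by (simp add: inner_diff_left)
      also have "\<dots> = integral S (\<lambda>x. u' (x $ 1) \<bullet> f' (G' x)) - integral S (\<lambda>x. ((n \<bullet> u' (x $ 1)) *\<^sub>R n) \<bullet> f' (G' x))"
        by (intro Henstock_Kurzweil_Integration.integral_diff S_int u'_cont continuous_intros)
      also have "\<dots> = - integral {a..c} (\<lambda>s. (n \<bullet> u' s) * f (u s))"
        unfolding along_u along_n[OF k1(2)] by simp
      finally have e_I: "e \<bullet> integral M f' = - integral {a..c} (\<lambda>s. (n \<bullet> u' s) * f (u s))" .
      define k where "k s = f (u s) *\<^sub>R norm (u' s) *\<^sub>R \<nu> (u s)" for s
      have kc: "continuous_on S k" for S
        unfolding k_def
        by (rule continuous_on_scaleR[OF continuous_on_compose2[OF C1_grad_continuous[OF f, of UNIV] u_cont subset_UNIV]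
            continuous_on_subset[OF normal_cont subset_UNIV]])
      have kint: "k integrable_on {x..y}" for x y by (intro integrable_continuous_real kc)
      \<comment> \<open>The period is shifted to begin at \<open>a\<close>; beyond the arc over the
        box the integrand is zero by the choice of \<open>\<rho>2\<close>.\<close>
      have "integral {0..T} k = integral {a..a + T} k"
        using integral_periodic_shift[OF kc, of T 0 a] T_pos by (simp add: k_def u_periodic u'_periodic)
      also have "\<dots> = integral {a..c} k + integral {c..a + T} k"
        using ac by (intro Henstock_Kurzweil_Integration.integral_combine[symmetric] kint) auto
      also have "integral {c..a + T} k = integral {c..a + T} (\<lambda>s. 0)"
      proof (rule Henstock_Kurzweil_Integration.integral_cong)
        fix s assume "s \<in> {c..a + T}"
        then have "u s \<in> u ` {s0 + \<delta>..s0 + T - \<delta>}" by (intro imageI) (auto simp: a_def c_def)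
        then have "u s \<notin> ball (u s0) (min \<rho>1 \<rho>2)" using \<rho>2(2) by auto
        then show "k s = 0" using supp by (simp add: k_def)
      qed
      finally have R: "integral {0..T} k = integral {a..c} k" by simp
      have ee: "e \<bullet> e = 1" "n \<bullet> n = 1" "n \<bullet> e = 0" using on by (auto simp: norm_eq_1 inner_commute)
      have k_eq: "k s = f (u s) *\<^sub>R ((e \<bullet> u' s) *\<^sub>R n - (n \<bullet> u' s) *\<^sub>R e)" if "s \<in> {a..c}" for s
        using \<nu>_eq[of s] that by (simp add: k_def a_def c_def)
      have "n \<bullet> integral {0..T} k = integral {a..c} (\<lambda>s. n \<bullet> k s)"
        unfolding R using integral_linear[OF kint bounded_linear_inner_right] by (simp add: o_def)
      also have "\<dots> = integral {a..c} (\<lambda>s. (e \<bullet> u' s) * f (u s))"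
        by (intro Henstock_Kurzweil_Integration.integral_cong) (simp add: k_eq inner_diff_right ee mult.commute)
      finally have n_R: "n \<bullet> integral {0..T} k = n \<bullet> integral M f'" by (simp add: n_I)
      have "e \<bullet> integral {0..T} k = integral {a..c} (\<lambda>s. e \<bullet> k s)"
        unfolding R using integral_linear[OF kint bounded_linear_inner_right] by (simp add: o_def)
      also have "\<dots> = integral {a..c} (\<lambda>s. - ((n \<bullet> u' s) * f (u s)))"
        by (intro Henstock_Kurzweil_Integration.integral_cong) (simp add: k_eq inner_diff_right ee on mult.commute)
      finally have e_R: "e \<bullet> integral {0..T} k = e \<bullet> integral M f'" by (simp add: e_I)
      have "integral M f' = integral {0..T} k"
        using orthonormal_expansion_2[OF on, of "integral M f'"] orthonormal_expansion_2[OF on, of "integral {0..T} k"] e_R n_R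
        by (metis inner_commute)
      then show ?thesis by (simp add: k_def[abs_def])
    qed
  qed (use \<rho>1 \<rho>2 in auto)
qed

end

lemma integrable_on_compact_continuous:
  fixes F :: "'a::euclidean_space \<Rightarrow> 'b::euclidean_space"
  assumes "compact S" "continuous_on S F"
  shows "F integrable_on S"
proof -
  have "(\<lambda>x. indicator S x *\<^sub>R F x) integrable_on UNIV"
    using borel_integrable_compact[OF assms] by (rule integrable_on_lborel)
  moreover have "(\<lambda>x. indicator S x *\<^sub>R F x) = (\<lambda>x. if x \<in> S then F x else 0)"
    by (auto simp: indicator_def)
  ultimately show ?thesis using integrable_restrict_UNIV[of S F] by simp
qed

section \<open>Continuously differentiable cut-off functions\<close>

definition pos_sq :: "real \<Rightarrow> real" where "pos_sq z = (max 0 z)\<^sup>2"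

text \<open>Squaring removes the kink of the positive part: at 0 the difference quotient is at most
  \<open>\<bar>h\<bar>\<close>. One continuous derivative is what \<open>C1_grad\<close> asks of the
  cut-off functions built from it.\<close>

lemma pos_sq_deriv: "(pos_sq has_real_derivative 2 * max 0 z) (at z)"
proof -
  consider "z < 0" | "z = 0" | "0 < z" by linarith
  then show ?thesis
  proof cases
    case 1
    have "((\<lambda>z. 0) has_real_derivative 0) (at z)" by simp
    then have "(pos_sq has_real_derivative 0) (at z)"
      by (rule has_field_derivative_transform_within_open[of _ _ _ "{..<0}"]) (use 1 in \<open>auto simp: pos_sq_def\<close>)
    then show ?thesis using 1 by simp
  next
    case 2
    have "(\<lambda>h. (pos_sq (0 + h) - pos_sq 0) / h) \<midarrow>0\<rightarrow> 0"
    proof (rule Lim_null_comparison)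
      show "\<forall>\<^sub>F h in at 0. norm ((pos_sq (0 + h) - pos_sq 0) / h) \<le> \<bar>h\<bar>"
        by (intro always_eventually) (auto simp: pos_sq_def max_def power2_eq_square)
      show "((\<lambda>h::real. \<bar>h\<bar>) \<longlongrightarrow> 0) (at 0)"
        by (rule tendsto_rabs_zero[OF tendsto_ident_at])
    qed
    then show ?thesis using 2 by (simp add: DERIV_def)
  next
    case 3
    have "((\<lambda>z. z\<^sup>2) has_real_derivative 2 * z) (at z)"
      by (auto intro!: derivative_eq_intros)
    then have "(pos_sq has_real_derivative 2 * z) (at z)"
      by (rule has_field_derivative_transform_within_open[of _ _ _ "{0<..}"]) (use 3 in \<open>auto simp: pos_sq_def\<close>)
    then show ?thesis using 3 by simp
  qed
qed

lemma C1_grad_mult: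
  assumes "C1_grad f f'" "C1_grad g g'"
  shows "C1_grad (\<lambda>x. f x * g x) (\<lambda>x. f x *\<^sub>R g' x + g x *\<^sub>R f' x)"
proof -
  have "((\<lambda>x. f x * g x) has_derivative (\<lambda>v. (f x *\<^sub>R g' x + g x *\<^sub>R f' x) \<bullet> v)) (at x)" for x
  proof -
    have "((\<lambda>x. f x * g x) has_derivative (\<lambda>v. f x * (g' x \<bullet> v) + (f' x \<bullet> v) * g x)) (at x)"
      using assms unfolding C1_grad_def by (intro has_derivative_mult) auto
    then show ?thesis by (simp add: inner_add_left mult.commute)
  qed
  moreover have "continuous_on UNIV (\<lambda>x. f x *\<^sub>R g' x + g x *\<^sub>R f' x)"
    using assms C1_grad_continuous unfolding C1_grad_def by (intro continuous_intros) blast+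
  ultimately show ?thesis by (simp add: C1_grad_def)
qed

lemma C1_grad_plateau:
  fixes p :: "'a::euclidean_space"
  assumes "0 < r"
  obtains b b' where "C1_grad b b'" "\<And>x. x \<in> ball p (r / 2) \<Longrightarrow> b x = 1 \<and> b' x = 0"
    "\<And>x. x \<notin> ball p r \<Longrightarrow> b x = 0 \<and> b' x = 0"
proof -
  define q where "q x = 1 / r\<^sup>2 * ((x - p) \<bullet> (x - p))" for x
  \<comment> \<open>\<open>\<theta>\<close> is 1 up to \<open>1 / 2\<close> and 0 from 1 on; the
    factor 4 makes the bracket vanish at \<open>z = 1\<close>, as
    \<open>pos_sq (1 / 2) = 1 / 4\<close>. Since \<open>q\<close> is the squared distance in units
    of \<open>r\<close>, the half-radius ball has \<open>q \<le> 1 / 4\<close> and lies in the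
    plateau.\<close>
  define \<theta> where "\<theta> z = pos_sq (1 - 4 * pos_sq (z - 1 / 2))" for z
  define \<theta>' where "\<theta>' z = 2 * max 0 (1 - 4 * pos_sq (z - 1 / 2)) * (- (4 * (2 * max 0 (z - 1 / 2))))" for z
  have \<theta>: "(\<theta> has_real_derivative \<theta>' z) (at z)" for z
  proof -
    have "((\<lambda>z. z - 1 / 2) has_real_derivative 1) (at z)" by (auto intro!: derivative_eq_intros)
    from DERIV_chain2[OF pos_sq_deriv this]
    have "((\<lambda>z. pos_sq (z - 1 / 2)) has_real_derivative 2 * max 0 (z - 1 / 2)) (at z)" by simp
    from DERIV_diff[OF DERIV_const[of 1] DERIV_cmult[OF this, of 4]]
    have "((\<lambda>z. 1 - 4 * pos_sq (z - 1 / 2)) has_real_derivative - (4 * (2 * max 0 (z - 1 / 2)))) (at z)" by simp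
    from DERIV_chain2[OF pos_sq_deriv this]
    show ?thesis by (simp add: \<theta>_def[abs_def] \<theta>'_def)
  qed
  have pos_sq_cont: "continuous_on UNIV pos_sq"
    using pos_sq_deriv by (intro continuous_at_imp_continuous_on ballI) (blast intro: DERIV_isCont)
  have \<theta>'_cont: "continuous_on UNIV \<theta>'"
    unfolding \<theta>'_def by (intro continuous_intros continuous_on_compose2[OF pos_sq_cont]) auto
  have q_cont: "continuous_on UNIV q" unfolding q_def by (intro continuous_intros) (use assms in auto)
  have grad: "((\<lambda>x. \<theta> (q x)) has_derivative (\<lambda>v. ((\<theta>' (q x) * (2 / r\<^sup>2)) *\<^sub>R (x - p)) \<bullet> v)) (at x)" for x
  proof -
    have "((\<lambda>x. x - p) has_derivative (\<lambda>v. v)) (at x)" by (auto intro!: derivative_eq_intros)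
    from has_derivative_mult_right[OF has_derivative_inner[OF this this], of "1 / r\<^sup>2"]
    have "(q has_derivative (\<lambda>v. (2 / r\<^sup>2) * ((x - p) \<bullet> v))) (at x)"
      unfolding q_def[abs_def] by (rule has_derivative_eq_rhs) (auto simp: inner_commute)
    from has_derivative_compose[OF this \<theta>[of "q x", unfolded has_field_derivative_def]]
    show ?thesis by (rule has_derivative_eq_rhs) (simp add: mult.assoc)
  qed
  have "C1_grad (\<lambda>x. \<theta> (q x)) (\<lambda>x. (\<theta>' (q x) * (2 / r\<^sup>2)) *\<^sub>R (x - p))"
    unfolding C1_grad_def
    by (intro conjI allI grad continuous_intros continuous_on_compose2[OF \<theta>'_cont q_cont]) auto
  moreover have "\<theta> (q x) = 1 \<and> (\<theta>' (q x) * (2 / r\<^sup>2)) *\<^sub>R (x - p) = 0" if "x \<in> ball p (r / 2)" for x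
  proof -
    have "(norm (x - p))\<^sup>2 \<le> (r / 2)\<^sup>2"
      using that by (intro power_mono) (auto simp: dist_norm norm_minus_commute)
    then have "4 * (norm (x - p))\<^sup>2 \<le> r\<^sup>2" by (simp add: power_divide)
    then have "2 * (norm (x - p))\<^sup>2 \<le> r\<^sup>2" using zero_le_power2[of "norm (x - p)"] by linarith
    then have "q x \<le> 1 / 2"
      using assms by (simp add: q_def power2_norm_eq_inner[symmetric] divide_le_eq)
    then have "pos_sq (q x - 1 / 2) = 0" "max 0 (q x - 1 / 2) = 0" by (simp_all add: pos_sq_def)
    then show ?thesis by (simp add: \<theta>_def \<theta>'_def) (simp add: pos_sq_def)
  qed
  moreover have "\<theta> (q x) = 0 \<and> (\<theta>' (q x) * (2 / r\<^sup>2)) *\<^sub>R (x - p) = 0" if "x \<notin> ball p r" for x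
  proof -
    have "r\<^sup>2 \<le> (norm (x - p))\<^sup>2"
      using that assms by (intro power_mono) (auto simp: dist_norm norm_minus_commute)
    then have "1 \<le> q x"
      using assms by (simp add: q_def power2_norm_eq_inner[symmetric] le_divide_eq)
    then have "(1 / 2)\<^sup>2 \<le> (max 0 (q x - 1 / 2))\<^sup>2" by (intro power_mono) auto
    then have "1 - 4 * pos_sq (q x - 1 / 2) \<le> 0" by (simp add: pos_sq_def power_divide)
    then show ?thesis by (simp add: \<theta>_def \<theta>'_def) (simp add: pos_sq_def[of "1 - _"] max_def)
  qed
  ultimately show thesis by (rule that)
qed

section \<open>From the local to the global divergence theorem\<close>

context boundary_curve
begin

text \<open>Both sides are zero. The curve runs in the frontier and avoids the ball; each component
  of the area integral is a partial derivative integrated over a square circumscribed about the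
  ball, with \<open>f = 0\<close> on its edges.\<close>

lemma divergence_local_interior:
  assumes p: "p \<in> interior M"
  obtains \<rho> where "0 < \<rho>" "\<And>f f'. C1_grad f f' \<Longrightarrow> (\<And>x. x \<notin> ball p \<rho> \<Longrightarrow> f x = 0 \<and> f' x = 0) \<Longrightarrow>
    integral M f' = integral {0..T} (\<lambda>s. f (u s) *\<^sub>R norm (u' s) *\<^sub>R \<nu> (u s))"
proof -
  obtain \<rho> where \<rho>: "0 < \<rho>" "ball p \<rho> \<subseteq> interior M" using p by (metis open_interior openE)
  show thesis
  proof (rule that[OF \<rho>(1)])
    fix f f' assume f: "C1_grad f f'" and supp: "\<And>x. x \<notin> ball p \<rho> \<Longrightarrow> f x = 0 \<and> f' x = 0"
    have f'c: "continuous_on UNIV f'" using f by (simp add: C1_grad_def)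
    define P where "P s t = s *\<^sub>R axis 1 1 + t *\<^sub>R (axis 2 1 :: real^2)" for s t
    have P: "P (x $ 1) (x $ 2) = x" "P s t $ 1 = s" "P s t $ 2 = t" for x s t
      by (simp_all add: P_def vec_eq_iff forall_2 axis_def)
    define S :: "(real^2) set" where "S = cbox (vector [p $ 1 - \<rho>, p $ 2 - \<rho>]) (vector [p $ 1 + \<rho>, p $ 2 + \<rho>])"
    have ball_S: "x \<in> S" if "x \<in> ball p \<rho>" for x
    proof -
      have "\<bar>(x - p) $ i\<bar> < \<rho>" for i
        using component_le_norm_cart[of "x - p" i] that by (auto simp: dist_norm norm_minus_commute)
      from this[of 1] this[of 2] show ?thesis by (auto simp: S_def mem_box_cart forall_2 abs_less_iff)
    qed
    have edge: "f (P s t) = 0" if "\<bar>s - p $ 1\<bar> = \<rho> \<or> \<bar>t - p $ 2\<bar> = \<rho>" for s t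
    proof -
      have "\<rho> \<le> norm (P s t - p)"
        using that component_le_norm_cart[of "P s t - p" 1] component_le_norm_cart[of "P s t - p" 2] by (auto simp: P)
      then show ?thesis using supp[of "P s t"] by (auto simp: dist_norm norm_minus_commute)
    qed
    have "(if x \<in> M then f' x else 0) = (if x \<in> S then f' x else 0)" for x
      using ball_S[of x] subsetD[OF \<rho>(2), of x] subsetD[OF interior_subset, of x M] supp[of x]
      by (cases "x \<in> ball p \<rho>") auto
    then have MS: "integral M f' = integral S f'"
      by (subst (1 2) integral_restrict_UNIV[symmetric]) simp
    have cont: "continuous_on UNIV (\<lambda>(s, t). w \<bullet> f' (P s t))" for w
      unfolding case_prod_unfold P_def
      by (intro continuous_intros continuous_on_compose2[OF f'c]) auto
    have inner: "w \<bullet> integral S f' = integral S (\<lambda>x. w \<bullet> f' (P (x $ 1) (x $ 2)))" for w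
      unfolding P using f'c
      by (intro inner_integral) (auto simp: S_def intro!: integrable_continuous intro: continuous_on_subset)
    have zero: "integral {a - \<rho>..a + \<rho>} (\<lambda>s. w \<bullet> f' (\<gamma> s)) = 0"
      if \<gamma>: "\<And>s. (\<gamma> has_vector_derivative w) (at s)" "f (\<gamma> (a - \<rho>)) = 0" "f (\<gamma> (a + \<rho>)) = 0" for \<gamma> w a
    proof -
      have "((\<lambda>s. w \<bullet> f' (\<gamma> s)) has_integral f (\<gamma> (a + \<rho>)) - f (\<gamma> (a - \<rho>))) {a - \<rho>..a + \<rho>}"
      proof (rule fundamental_theorem_of_calculus)
        fix s
        show "((\<lambda>s. f (\<gamma> s)) has_vector_derivative w \<bullet> f' (\<gamma> s)) (at s within {a - \<rho>..a + \<rho>})"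
          using C1_grad_chain[OF f has_vector_derivative_at_within[OF \<gamma>(1)]] by (simp add: inner_commute)
      qed (use \<rho> in simp)
      then show ?thesis using \<gamma> by (simp add: integral_unique)
    qed
    have P_deriv: "((\<lambda>s. P s t) has_vector_derivative axis 1 1) (at s)"
      "((\<lambda>t. P s t) has_vector_derivative axis 2 1) (at t)" for s t
      unfolding P_def by (auto intro!: derivative_eq_intros)
    have 1: "axis 1 1 \<bullet> integral S f' = 0"
      unfolding inner unfolding S_def integral_cbox_vec2_iterated_swap[OF cont]
      using \<rho>(1) by (subst zero[OF P_deriv(1)]) (simp_all add: edge)
    have 2: "axis 2 1 \<bullet> integral S f' = 0"
      unfolding inner unfolding S_def integral_cbox_vec2_iterated[OF cont]
      using \<rho>(1) by (subst zero[OF P_deriv(2)]) (simp_all add: edge)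
    have "integral M f' = 0"
      using 1 2 unfolding MS by (simp add: vec_eq_iff forall_2 inner_axis' )
    moreover have "f (u s) = 0" for s
      using u_mem[of s] subsetD[OF \<rho>(2), of "u s"] supp[of "u s"] by (auto simp: boundary_eq frontier_def)
    ultimately show "integral M f' = integral {0..T} (\<lambda>s. f (u s) *\<^sub>R norm (u' s) *\<^sub>R \<nu> (u s))"
      by simp
  qed
qed

text \<open>Instead of summing a partition of unity, the balls of a finite cover are removed one at
  a time: \<open>f = f * b + f * (1 - b)\<close> with a plateau function \<open>b\<close>. The first
  summand is supported in a ball for which the local version holds; the second vanishes with its
  gradient on the half-radius ball, where \<open>b = 1\<close>. This is why the cover uses half
  radii.\<close>

theorem divergence_theorem:
  assumes f: "C1_grad f f'"
  shows "integral M f' = integral {0..T} (\<lambda>s. f (u s) *\<^sub>R norm (u' s) *\<^sub>R \<nu> (u s))"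
proof -
  define flux where "flux f f' \<longleftrightarrow> integral M f' = integral {0..T} (\<lambda>s. f (u s) *\<^sub>R norm (u' s) *\<^sub>R \<nu> (u s))"
    for f :: "real^2 \<Rightarrow> real" and f'
  have int: "f' integrable_on M" "(\<lambda>s. f (u s) *\<^sub>R norm (u' s) *\<^sub>R \<nu> (u s)) integrable_on {0..T}"
    if "C1_grad f f'" for f f'
  proof -
    show "f' integrable_on M"
      using that M_compact by (intro integrable_on_compact_continuous) (auto simp: C1_grad_def intro: continuous_on_subset)
    show "(\<lambda>s. f (u s) *\<^sub>R norm (u' s) *\<^sub>R \<nu> (u s)) integrable_on {0..T}"
      by (intro integrable_continuous_real continuous_on_scaleR[OF continuous_on_compose2[OF C1_grad_continuous[OF that, of UNIV] u_cont subset_UNIV]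
            continuous_on_subset[OF normal_cont subset_UNIV]])
  qed
  have "\<exists>\<rho>>0. \<forall>f f'. C1_grad f f' \<longrightarrow> (\<forall>x. x \<notin> ball p \<rho> \<longrightarrow> f x = 0 \<and> f' x = 0) \<longrightarrow> flux f f'" if "p \<in> M" for p
  proof (cases "p \<in> interior M")
    case True
    then show ?thesis by (rule divergence_local_interior) (auto simp: flux_def)
  next
    case False
    then have "p \<in> range u" using that M_compact by (auto simp: u_range frontier_def compact_imp_closed)
    then obtain s where "p = u s" by auto
    then show ?thesis by (rule_tac divergence_local_boundary[of s]) (auto simp: flux_def)
  qed
  then obtain r where r: "\<And>p. p \<in> M \<Longrightarrow> 0 < r p"
    "\<And>p f f'. p \<in> M \<Longrightarrow> C1_grad f f' \<Longrightarrow> (\<And>x. x \<notin> ball p (r p) \<Longrightarrow> f x = 0 \<and> f' x = 0) \<Longrightarrow> flux f f'"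
    by metis
  have "\<forall>p\<in>M. open (ball p (r p / 2))" "M \<subseteq> (\<Union>p\<in>M. ball p (r p / 2))" using r(1) by auto
  then obtain F where F: "F \<subseteq> M" "finite F" "M \<subseteq> (\<Union>p\<in>F. ball p (r p / 2))"
    by - (rule compactE_image[OF M_compact, of M "\<lambda>p. ball p (r p / 2)"], auto)
  \<comment> \<open>The induction changes the function, hence the generality in \<open>f\<close> and
    \<open>f'\<close>. Vanishing is demanded on the part of \<open>M\<close> outside the remaining
    balls: no condition for the full cover, and \<open>f = 0\<close> on all of \<open>M\<close> for
    the empty one.\<close>
  have "flux f f'" if "C1_grad f f'" "\<And>x. x \<in> M \<Longrightarrow> x \<notin> (\<Union>p\<in>F. ball p (r p / 2)) \<Longrightarrow> f x = 0 \<and> f' x = 0"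
    for f f'
    using F(2,1) that
  proof (induction F arbitrary: f f' rule: finite_induct)
    case empty
    then have "integral M f' = integral M (\<lambda>x. 0)"
      by (intro Henstock_Kurzweil_Integration.integral_cong) auto
    then show ?case using empty u_in_M by (simp add: flux_def)
  next
    case (insert p F)
    obtain b b' where b: "C1_grad b b'" "\<And>x. x \<in> ball p (r p / 2) \<Longrightarrow> b x = 1 \<and> b' x = 0"
      "\<And>x. x \<notin> ball p (r p) \<Longrightarrow> b x = 0 \<and> b' x = 0"
      using C1_grad_plateau[of "r p" p] r(1) insert.prems(1) by auto
    have c_grad: "C1_grad (\<lambda>x. 1 - b x) (\<lambda>x. - b' x)"
      using b(1) unfolding C1_grad_def
      by (auto intro!: derivative_eq_intros continuous_intros simp: inner_minus_left)
    define g where "g x = f x *\<^sub>R b' x + b x *\<^sub>R f' x" for x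
    define h where "h x = f x *\<^sub>R (- b' x) + (1 - b x) *\<^sub>R f' x" for x
    have g: "C1_grad (\<lambda>x. f x * b x) g" and h: "C1_grad (\<lambda>x. f x * (1 - b x)) h"
      unfolding g_def[abs_def] h_def[abs_def] by (intro C1_grad_mult insert.prems b c_grad)+
    have "flux (\<lambda>x. f x * b x) g"
      using insert.prems(1) b(3) by (intro r(2)[OF _ g, of p]) (auto simp: g_def)
    moreover have "flux (\<lambda>x. f x * (1 - b x)) h"
    proof (rule insert.IH[OF _ h])
      show "f x * (1 - b x) = 0 \<and> h x = 0" if "x \<in> M" "x \<notin> (\<Union>p\<in>F. ball p (r p / 2))" for x
        using insert.prems(3)[of x] b(2)[of x] that by (cases "x \<in> ball p (r p / 2)") (auto simp: h_def)
    qed (use insert.prems in auto)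
    moreover have "integral M f' = integral M g + integral M h"
    proof -
      have "f' = (\<lambda>x. g x + h x)" by (auto simp: g_def h_def scaleR_left_diff_distrib)
      then show ?thesis using Henstock_Kurzweil_Integration.integral_add[OF int(1)[OF g] int(1)[OF h]] by simp
    qed
    moreover have "integral {0..T} (\<lambda>s. f (u s) *\<^sub>R norm (u' s) *\<^sub>R \<nu> (u s)) =
        integral {0..T} (\<lambda>s. (f (u s) * b (u s)) *\<^sub>R norm (u' s) *\<^sub>R \<nu> (u s)) +
        integral {0..T} (\<lambda>s. (f (u s) * (1 - b (u s))) *\<^sub>R norm (u' s) *\<^sub>R \<nu> (u s))"
      unfolding Henstock_Kurzweil_Integration.integral_add[OF int(2)[OF g] int(2)[OF h], symmetric]
      by (simp add: scaleR_left_distrib[symmetric] distrib_left[symmetric] distrib_right[symmetric])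
    ultimately show ?case by (simp add: flux_def)
  qed
  from this[OF f] F(3) show ?thesis unfolding flux_def by blast
qed

end

section \<open>The source-seeking system\<close>

text \<open>\<open>smooth_on\<close> speaks of derivatives along fixed directions. The gradient is
  assembled from those along a basis, and finitely many continuous components make it
  continuous.\<close>

lemma smooth_on_C1_grad:
  fixes f :: "'a::euclidean_space \<Rightarrow> real"
  assumes "smooth_on UNIV f"
  obtains f' where "C1_grad f f'"
proof
  define f' where "f' x = (\<Sum>b\<in>Basis. frechet_derivative f (at x) b *\<^sub>R b)" for x
  have "(f has_derivative (\<lambda>v. f' x \<bullet> v)) (at x)" for x
  proof -
    have d: "(f has_derivative frechet_derivative f (at x)) (at x)"
      by (rule smooth_on_has_derivative[OF assms]) simp
    then have lin: "linear (frechet_derivative f (at x))" by (rule has_derivative_linear)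
    have "frechet_derivative f (at x) v = f' x \<bullet> v" for v
    proof -
      have "frechet_derivative f (at x) v = frechet_derivative f (at x) (\<Sum>b\<in>Basis. (v \<bullet> b) *\<^sub>R b)"
        by (simp add: euclidean_representation)
      also have "\<dots> = (\<Sum>b\<in>Basis. (v \<bullet> b) * frechet_derivative f (at x) b)"
        by (simp add: linear_sum[OF lin] linear_scale[OF lin])
      also have "\<dots> = f' x \<bullet> v"
        by (simp add: f'_def inner_sum_left inner_commute[of v] mult.commute)
      finally show ?thesis .
    qed
    then have "frechet_derivative f (at x) = (\<lambda>v. f' x \<bullet> v)" by (rule ext)
    with d show ?thesis by simp
  qed
  moreover have "continuous_on UNIV f'"
    unfolding f'_def using smooth_on_frechet_derivative_continuous[OF assms] by (intro continuous_intros)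
  ultimately show "C1_grad f f'" by (simp add: C1_grad_def)
qed

lemma C1_grad_linearization:
  fixes f :: "'a::euclidean_space \<Rightarrow> real"
  assumes f: "C1_grad f f'" and S: "convex S" "a \<in> S" "b \<in> S"
    and B: "\<And>x. x \<in> S \<Longrightarrow> norm (f' x - f' a) \<le> B"
  shows "\<bar>f b - f a - f' a \<bullet> (b - a)\<bar> \<le> B * norm (b - a)"
proof -
  have "norm (f b - f a - (\<lambda>v. f' a \<bullet> v) (b - a)) \<le> norm (b - a) * B"
  proof (rule differentiable_bound_linearization[where S=S and f'="\<lambda>x v. f' x \<bullet> v"])
    fix t :: real assume "t \<in> {0..1}"
    then have "(1 - t) *\<^sub>R a + t *\<^sub>R b \<in> S" using S by (intro convexD) auto
    then show "a + t *\<^sub>R (b - a) \<in> S" by (simp add: algebra_simps)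
  next
    fix x assume "x \<in> S"
    have "onorm (\<lambda>v. (f' x - f' a) \<bullet> v) \<le> norm (f' x - f' a)"
      by (intro onorm_le) (simp add: Cauchy_Schwarz_ineq2)
    then show "onorm ((\<lambda>v. f' x \<bullet> v) - (\<lambda>v. f' a \<bullet> v)) \<le> B"
      using B[OF \<open>x \<in> S\<close>] by (simp add: fun_diff_def inner_diff_left)
  qed (use f S in \<open>auto simp: C1_grad_def intro: has_derivative_at_withinI\<close>)
  then show ?thesis by (simp add: mult.commute)
qed

lemma compact_norm_bound:
  fixes f :: "'a::topological_space \<Rightarrow> 'b::real_normed_vector"
  assumes "compact S" "continuous_on S f"
  obtains B where "0 \<le> B" "\<And>x. x \<in> S \<Longrightarrow> norm (f x) \<le> B"
proof -
  have "bounded (f ` S)" using assms by (intro compact_imp_bounded compact_continuous_image)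
  then obtain B where "0 < B" "\<forall>y\<in>f ` S. norm y \<le> B" by (auto simp: bounded_pos)
  then show thesis by (intro that[of B]) auto
qed

lemma C1_grad_bounded_lipschitz:
  fixes f :: "'a::euclidean_space \<Rightarrow> real"
  assumes f: "C1_grad f f'"
  obtains K L where "0 \<le> K" "0 \<le> L" "\<And>x. x \<in> cball 0 R \<Longrightarrow> \<bar>f x\<bar> \<le> K"
    "\<And>x y. x \<in> cball 0 R \<Longrightarrow> y \<in> cball 0 R \<Longrightarrow> \<bar>f x - f y\<bar> \<le> L * norm (x - y)"
proof -
  have "continuous_on (cball 0 R) f'" using f continuous_on_subset unfolding C1_grad_def by blast
  from compact_norm_bound[OF compact_cball this] obtain L
    where L: "0 \<le> L" "\<And>x. x \<in> cball 0 R \<Longrightarrow> norm (f' x) \<le> L" by blast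
  obtain K where K: "0 \<le> K" "\<And>x. x \<in> cball 0 R \<Longrightarrow> norm (f x) \<le> K"
    using compact_norm_bound[OF compact_cball C1_grad_continuous[OF f, of "cball 0 R"]] by blast
  show thesis
  proof (rule that[OF K(1) L(1)])
    fix x y :: 'a assume xy: "x \<in> cball 0 R" "y \<in> cball 0 R"
    have "norm (f x - f y) \<le> L * norm (x - y)"
    proof (rule differentiable_bound[OF convex_cball _ _ xy])
      fix z :: 'a assume z: "z \<in> cball 0 R"
      show "(f has_derivative (\<lambda>v. f' z \<bullet> v)) (at z within cball 0 R)"
        using f by (auto simp: C1_grad_def intro: has_derivative_at_withinI)
      have "onorm (\<lambda>v. f' z \<bullet> v) \<le> norm (f' z)"
        by (intro onorm_le) (simp add: Cauchy_Schwarz_ineq2)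
      then show "onorm (\<lambda>v. f' z \<bullet> v) \<le> L" using L(2)[OF z] by linarith
    qed
    then show "\<bar>f x - f y\<bar> \<le> L * norm (x - y)" by simp
  qed (use K in auto)
qed

text \<open>\<open>f'\<close> is uniformly continuous on a ball containing all \<open>q + p\<close>
  and their unit neighbourhoods. The linearization error at \<open>q + p\<close> is therefore at
  most \<open>e' * norm (y - q)\<close> uniformly in \<open>p\<close>, and this bound is integrated
  over \<open>M\<close>.\<close>

lemma has_derivative_integral_translates:
  fixes f :: "'a::euclidean_space \<Rightarrow> real"
  assumes f: "C1_grad f f'" and M: "compact M"
  shows "((\<lambda>q. integral M (\<lambda>p. f (q + p))) has_derivative (\<lambda>v. integral M (\<lambda>p. f' (q + p)) \<bullet> v)) (at q)"
  unfolding has_derivative_at_alt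
proof (intro conjI allI impI)
  show "bounded_linear ((\<bullet>) (integral M (\<lambda>p. f' (q + p))))" by (rule bounded_linear_inner_right)
  fix e :: real assume e: "0 < e"
  have f'c: "continuous_on UNIV f'" using f by (simp add: C1_grad_def)
  have int: "(\<lambda>p. f (y + p)) integrable_on M" "(\<lambda>p. f' (y + p)) integrable_on M" for y
    by (intro integrable_on_compact_continuous[OF M] continuous_intros
        continuous_on_compose2[OF C1_grad_continuous[OF f, of UNIV]] continuous_on_compose2[OF f'c]; simp)+
  define \<mu> where "\<mu> = integral M (\<lambda>_. 1::real)"
  have one: "(\<lambda>_. 1::real) integrable_on M" by (intro integrable_on_compact_continuous[OF M] continuous_intros)
  have \<mu>: "0 \<le> \<mu>" unfolding \<mu>_def by (intro Henstock_Kurzweil_Integration.integral_nonneg one) simp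
  \<comment> \<open>\<open>\<mu>\<close> is the total mass of \<open>M\<close> and may be 0, hence
    \<open>\<mu> + 1\<close> in the denominator.\<close>
  define e' where "e' = e / (\<mu> + 1)"
  have e': "0 < e'" "e' * \<mu> \<le> e"
  proof -
    show "0 < e'" using e \<mu> by (simp add: e'_def)
    then have "e' * \<mu> \<le> e' * (\<mu> + 1)" by simp
    also have "\<dots> = e" using \<mu> by (simp add: e'_def)
    finally show "e' * \<mu> \<le> e" .
  qed
  have "continuous_on M (\<lambda>p. q + p)" by (intro continuous_intros)
  from compact_norm_bound[OF M this] obtain R where R: "\<And>p. p \<in> M \<Longrightarrow> norm (q + p) \<le> R" by blast
  have "uniformly_continuous_on (cball 0 (R + 1)) f'"
    by (intro compact_uniformly_continuous continuous_on_subset[OF f'c]) auto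
  then obtain d where d: "0 < d" "\<And>x y. x \<in> cball 0 (R + 1) \<Longrightarrow> y \<in> cball 0 (R + 1) \<Longrightarrow> dist y x < d \<Longrightarrow> dist (f' y) (f' x) < e'"
    unfolding uniformly_continuous_on_def using e'(1) by metis
  have "norm (integral M (\<lambda>p. f (y + p)) - integral M (\<lambda>p. f (q + p)) - integral M (\<lambda>p. f' (q + p)) \<bullet> (y - q)) \<le> e * norm (y - q)"
    if y: "norm (y - q) < min d 1" for y
  proof -
    have I: "((\<lambda>p. f (y + p) - f (q + p) - f' (q + p) \<bullet> (y - q)) has_integral
        integral M (\<lambda>p. f (y + p)) - integral M (\<lambda>p. f (q + p)) - integral M (\<lambda>p. f' (q + p)) \<bullet> (y - q)) M"
      using has_integral_linear[OF integrable_integral[OF int(2)[of q]] bounded_linear_inner_left[of "y - q"]]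
      by (intro has_integral_diff integrable_integral int) (simp add: o_def)
    have "norm (integral M (\<lambda>p. f (y + p) - f (q + p) - f' (q + p) \<bullet> (y - q))) \<le> integral M (\<lambda>p. (e' * norm (y - q)) * 1)"
    proof (rule Henstock_Kurzweil_Integration.integral_norm_bound_integral[OF has_integral_integrable[OF I] integrable_on_mult_right[OF one]])
      fix p assume p: "p \<in> M"
      have c: "q + p \<in> cball 0 (R + 1)" unfolding mem_cball_0 using R[OF p] by simp
      have S: "x \<in> cball 0 (R + 1) \<and> dist x (q + p) < d" if "x \<in> ball (q + p) (min d 1)" for x
      proof -
        have "norm x \<le> norm (x - (q + p)) + norm (q + p)" using norm_triangle_ineq[of "x - (q + p)" "q + p"] by simp
        then show ?thesis using that R[OF p] by (auto simp: dist_norm norm_minus_commute)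
      qed
      have "\<bar>f (y + p) - f (q + p) - f' (q + p) \<bullet> ((y + p) - (q + p))\<bar> \<le> e' * norm ((y + p) - (q + p))"
      proof (rule C1_grad_linearization[OF f convex_ball[of "q + p" "min d 1"]])
        fix x assume "x \<in> ball (q + p) (min d 1)"
        then show "norm (f' x - f' (q + p)) \<le> e'"
          using S[of x] d(2)[OF c, of x] by (auto simp: dist_norm less_imp_le)
      qed (use y d(1) in \<open>auto simp: dist_norm norm_minus_commute\<close>)
      then show "norm (f (y + p) - f (q + p) - f' (q + p) \<bullet> (y - q)) \<le> (e' * norm (y - q)) * 1" by simp
    qed
    also have "\<dots> = (e' * norm (y - q)) * \<mu>" unfolding \<mu>_def by (rule integral_mult_right)
    also have "\<dots> = (e' * \<mu>) * norm (y - q)" by simp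
    also have "\<dots> \<le> e * norm (y - q)" using e' by (intro mult_right_mono) auto
    finally show ?thesis using integral_unique[OF I] by simp
  qed
  then show "\<exists>d>0. \<forall>y. norm (y - q) < d \<longrightarrow>
      norm (integral M (\<lambda>p. f (y + p)) - integral M (\<lambda>p. f (q + p)) - integral M (\<lambda>p. f' (q + p)) \<bullet> (y - q)) \<le> e * norm (y - q)"
    using d(1) by (intro exI[of _ "min d 1"]) auto
qed

lemma grad_eqI:
  assumes "(f has_derivative (\<lambda>v. D \<bullet> v)) (at x)"
  shows "grad f x = D"
  unfolding grad_def
proof (rule the_equality)
  show "GDERIV f x :> D" using assms by (simp add: gderiv_def inner_commute)
  fix E assume "GDERIV f x :> E"
  then have "(\<lambda>h. h \<bullet> E) = (\<lambda>v. D \<bullet> v)"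
    using assms unfolding gderiv_def by (rule has_derivative_unique)
  then have "(E - D) \<bullet> v = 0" for v by (metis inner_commute inner_diff_left right_minus_eq)
  then have "(E - D) \<bullet> (E - D) = 0" .
  then show "E = D" by simp
qed

lemma grad_psi_bar:
  assumes f: "C1_grad \<psi> \<psi>'" and M: "compact M"
  shows "grad (psi_bar M \<psi>) q = (1 / area M) *\<^sub>R integral M (\<lambda>p. \<psi>' (q + p))"
proof (rule grad_eqI)
  show "(psi_bar M \<psi> has_derivative (\<lambda>v. (1 / area M) *\<^sub>R integral M (\<lambda>p. \<psi>' (q + p)) \<bullet> v)) (at q)"
    using has_derivative_mult_right[OF has_derivative_integral_translates[OF f M, of q], of "1 / area M"]
    by (simp add: psi_bar_def[abs_def])
qed

lemma has_integral_Pair: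
  fixes f :: "real \<Rightarrow> 'a::euclidean_space" and g :: "real \<Rightarrow> 'b::euclidean_space"
  assumes "(f has_integral I) S" "(g has_integral J) S"
  shows "((\<lambda>x. (f x, g x)) has_integral (I, J)) S"
proof -
  have "bounded_linear (\<lambda>x. (x, 0::'b))" "bounded_linear (\<lambda>x. (0::'a, x))"
    by (auto intro: bounded_linear_Pair bounded_linear_ident bounded_linear_zero)
  from has_integral_add[OF has_integral_linear[OF assms(1) this(1)] has_integral_linear[OF assms(2) this(2)]]
  show ?thesis by (simp add: o_def)
qed

lemma C1_grad_translate:
  assumes "C1_grad f f'"
  shows "C1_grad (\<lambda>p. f (q + p)) (\<lambda>p. f' (q + p))"
  unfolding C1_grad_def
proof (intro conjI allI)
  fix x
  have "((\<lambda>p. q + p) has_derivative (\<lambda>v. v)) (at x)" by (auto intro!: derivative_eq_intros)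
  from has_derivative_compose[OF this, of f] assms
  show "((\<lambda>p. f (q + p)) has_derivative (\<lambda>v. f' (q + x) \<bullet> v)) (at x)" by (simp add: C1_grad_def)
  show "continuous_on UNIV (\<lambda>p. f' (q + p))"
    using assms unfolding C1_grad_def by (auto intro!: continuous_intros intro: continuous_on_compose2)
qed

lemma periodic_continuous_bounded:
  fixes w :: "real \<Rightarrow> 'a::real_normed_vector"
  assumes w: "continuous_on UNIV w" and per: "\<And>t. w (t + T) = w t" and "0 < T"
  obtains B where "0 \<le> B" "\<And>t. norm (w t) \<le> B"
proof -
  obtain B where "0 \<le> B" and B: "\<And>t. t \<in> {0..T} \<Longrightarrow> norm (w t) \<le> B"
    using compact_norm_bound[OF compact_Icc continuous_on_subset[OF w subset_UNIV]] by blast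
  have "norm (w t) \<le> B" for t
  proof -
    obtain k where "0 \<le> t + of_int k * T" "t + of_int k * T < T"
      using period_representative[OF \<open>0 < T\<close>] by blast
    then show ?thesis using B[of "t + of_int k * T"] periodic_add_int[of w T t k, OF per] by simp
  qed
  with \<open>0 \<le> B\<close> show thesis by (rule that)
qed

lemma norm_triple:
  shows norm_triple_le: "norm (a, b, c) \<le> norm a + norm b + norm c"
    and norm_triple_fst: "norm a \<le> norm (a, b, c)"
    and norm_triple_snd: "norm b \<le> norm (a, b, c)"
    and norm_triple_thd: "norm c \<le> norm (a, b, c)"
    and norm_triple_pair: "norm (a, b) \<le> norm (a, b, c)"
proof -
  show "norm (a, b, c) \<le> norm a + norm b + norm c"
    using norm_Pair_le[of a "(b, c)"] norm_Pair_le[of b c] by simp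
  show "norm a \<le> norm (a, b, c)" by (rule norm_fst_le)
  show "norm b \<le> norm (a, b, c)" using norm_fst_le[of b c] norm_snd_le[of "(b, c)" a] by simp
  show "norm c \<le> norm (a, b, c)" using norm_snd_le[of c b] norm_snd_le[of "(b, c)" a] by simp
  show "norm (a, b) \<le> norm (a, b, c)" by (simp add: norm_Pair)
qed

section \<open>The oscillating field and its average\<close>

locale source_seeking = boundary_curve +
  fixes m \<kappa> c \<omega> :: real and \<psi> :: "real^2 \<Rightarrow> real" and \<psi>' :: "real^2 \<Rightarrow> real^2" and U :: "real \<Rightarrow> real^2"
  assumes m: "0 < m" and \<kappa>: "0 < \<kappa>" and \<omega>: "0 < \<omega>"
    and \<psi>: "C1_grad \<psi> \<psi>'"
    and u_mean: "integral {0..T} u = 0"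
    and U_deriv: "\<And>t. (U has_vector_derivative u t) (at t)"
begin

definition n :: "real \<Rightarrow> real^2" where "n s = norm (u' s) *\<^sub>R \<nu> (u s)"

definition y :: "real^2 \<Rightarrow> real \<Rightarrow> real \<Rightarrow> real" where
  "y q s \<epsilon> = \<psi> (q + u s - (\<epsilon> * (\<kappa> / m)) *\<^sub>R U s)"

definition C where "C = c * T / area M / m"

text \<open>The right-hand side in the fast time \<open>s = t / \<epsilon>\<close>, so that \<open>\<epsilon> = 0\<close> makes sense.\<close>

definition field :: "(real^2) \<times> (real^2) \<times> real \<Rightarrow> real \<Rightarrow> real \<Rightarrow> (real^2) \<times> (real^2) \<times> real" where
  "field = (\<lambda>(q, v, \<eta>) s \<epsilon>. (v,
     - (\<kappa> / m) *\<^sub>R v + (C * (y q s \<epsilon> - \<eta>)) *\<^sub>R n s + (\<kappa>\<^sup>2 / m\<^sup>2) *\<^sub>R u s,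
     - \<omega> * \<eta> + \<omega> * y q s \<epsilon>))"

definition mean_field :: "(real^2) \<times> (real^2) \<times> real \<Rightarrow> (real^2) \<times> (real^2) \<times> real" where
  "mean_field = (\<lambda>(q, v, \<eta>). (v, (1 / m) *\<^sub>R (- \<kappa> *\<^sub>R v + c *\<^sub>R grad (psi_bar M \<psi>) q),
     - \<omega> * \<eta> + \<omega> * z_bar T u \<psi> q))"

lemma \<psi>_cont: "continuous_on S \<psi>"
  by (rule C1_grad_continuous[OF \<psi>])

lemma U_cont: "continuous_on S U"
  by (intro continuous_at_imp_continuous_on ballI has_vector_derivative_continuous[OF U_deriv])

lemma n_cont: "continuous_on S n"
  unfolding n_def by (rule continuous_on_subset[OF normal_cont subset_UNIV])

lemma n_periodic: "n (t + T) = n t"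
  by (simp add: n_def u_periodic u'_periodic)

text \<open>The increment of \<open>U\<close> over a period is the integral of \<open>u\<close>,
  which vanishes. Boundedness of \<open>U\<close> follows, and it makes the shift by
  \<open>U\<close> in the argument of \<open>\<psi>\<close> uniformly small.\<close>

lemma U_periodic: "U (t + T) = U t"
proof -
  have "(u has_integral U (t + T) - U t) {t..t + T}"
    by (rule fundamental_theorem_of_calculus)
       (use T_pos has_vector_derivative_at_within[OF U_deriv] in auto)
  moreover have "integral {t..t + T} u = integral {0..0 + T} u"
    by (rule integral_periodic_shift[OF u_cont u_periodic]) (use T_pos in simp)
  ultimately show ?thesis using u_mean by (simp add: integral_unique)
qed

lemma field_cont: "continuous_on UNIV (\<lambda>s. field x s \<epsilon>)"
proof -
  obtain q v \<eta> where x: "x = (q, v, \<eta>)" by (cases x)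
  have y: "continuous_on UNIV (\<lambda>s. y q s \<epsilon>)"
    unfolding y_def by (intro continuous_on_compose2[OF \<psi>_cont[of UNIV]] continuous_intros u_cont U_cont) auto
  show ?thesis
    unfolding x field_def by (simp, intro continuous_intros y n_cont u_cont)
qed

lemma field_periodic: "field x (s + T) 0 = field x s 0"
  by (cases x) (simp add: field_def y_def u_periodic n_periodic)

text \<open>A single estimate \<open>diff\<close> compares two states and two parameters: equal
  parameters give the Lipschitz bound, equal states with \<open>\<epsilon>' = 0\<close> the
  perturbation bound. For \<open>\<epsilon> \<le> 1\<close> the argument of \<open>\<psi>\<close>
  stays in the ball of radius \<open>R0 + Bu + k * BU\<close>, where \<open>\<psi>\<close> is
  bounded and Lipschitz.\<close>

lemma field_bounds:
  "\<exists>L K B. \<forall>\<epsilon>\<in>{0..1}. \<forall>s. \<forall>x\<in>cball xs R. \<forall>x'\<in>cball xs R.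
    norm (field x s \<epsilon> - field x' s \<epsilon>) \<le> L * norm (x - x') \<and> norm (field x s \<epsilon>) \<le> K \<and>
    norm (field x s \<epsilon> - field x s 0) \<le> B * \<epsilon>"
proof -
  obtain Bu where Bu: "0 \<le> Bu" "\<And>s. norm (u s) \<le> Bu"
    using periodic_continuous_bounded[OF u_cont u_periodic T_pos] by blast
  obtain BU where BU: "0 \<le> BU" "\<And>s. norm (U s) \<le> BU"
    using periodic_continuous_bounded[OF U_cont U_periodic T_pos] by blast
  obtain Bn where Bn: "0 \<le> Bn" "\<And>s. norm (n s) \<le> Bn"
    using periodic_continuous_bounded[OF n_cont n_periodic T_pos] by blast
  define k where "k = \<kappa> / m"
  have k: "0 < k" using \<kappa> m by (simp add: k_def)
  define R0 where "R0 = norm xs + \<bar>R\<bar>"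
  obtain K\<psi> L\<psi> where K\<psi>: "0 \<le> K\<psi>" "\<And>p. p \<in> cball 0 (R0 + Bu + k * BU) \<Longrightarrow> \<bar>\<psi> p\<bar> \<le> K\<psi>"
    and L\<psi>: "0 \<le> L\<psi>" "\<And>p p'. p \<in> cball 0 (R0 + Bu + k * BU) \<Longrightarrow> p' \<in> cball 0 (R0 + Bu + k * BU) \<Longrightarrow>
      \<bar>\<psi> p - \<psi> p'\<bar> \<le> L\<psi> * norm (p - p')"
    using C1_grad_bounded_lipschitz[OF \<psi>, of "R0 + Bu + k * BU"] by metis
  define L where "L = 1 + k + \<bar>C\<bar> * (L\<psi> + 1) * Bn + \<omega> * (1 + L\<psi>)"
  define B where "B = (\<bar>C\<bar> * Bn + \<omega>) * (L\<psi> * (k * BU))"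
  define K where "K = R0 + (k * R0 + \<bar>C\<bar> * (K\<psi> + R0) * Bn + \<kappa>\<^sup>2 / m\<^sup>2 * Bu) + \<omega> * (R0 + K\<psi>)"
  have R0: "norm x \<le> R0" if "x \<in> cball xs R" for x
  proof -
    have "norm x \<le> norm xs + norm (x - xs)" using norm_triangle_ineq[of xs "x - xs"] by simp
    then show ?thesis using that by (simp add: R0_def dist_norm norm_minus_commute)
  qed
  have arg: "q + u s - (\<epsilon> * k) *\<^sub>R U s \<in> cball 0 (R0 + Bu + k * BU)"
    if "norm q \<le> R0" "\<epsilon> \<in> {0..1}" for q s \<epsilon>
  proof -
    have "norm ((\<epsilon> * k) *\<^sub>R U s) \<le> (1 * k) * BU"
      unfolding norm_scaleR using that k BU by (intro mult_mono) auto
    then have "norm (q + u s - (\<epsilon> * k) *\<^sub>R U s) \<le> R0 + Bu + k * BU"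
      using norm_triangle_ineq4[of "q + u s" "(\<epsilon> * k) *\<^sub>R U s"] norm_triangle_ineq[of q "u s"] that Bu(2)[of s] by simp
    then show ?thesis by (simp only: mem_cball_0)
  qed
  have diff: "norm (field x s \<epsilon> - field x' s \<epsilon>') \<le> L * norm (x - x') + B * \<bar>\<epsilon> - \<epsilon>'\<bar>"
    if x: "x \<in> cball xs R" "x' \<in> cball xs R" and \<epsilon>: "\<epsilon> \<in> {0..1}" "\<epsilon>' \<in> {0..1}" for x x' s \<epsilon> \<epsilon>'
  proof -
    obtain q v \<eta> where x1: "x = (q, v, \<eta>)" by (cases x)
    obtain q' v' \<eta>' where x2: "x' = (q', v', \<eta>')" by (cases x')
    define d where "d = norm (x - x')"
    have d: "norm (q - q') \<le> d" "norm (v - v') \<le> d" "\<bar>\<eta> - \<eta>'\<bar> \<le> d"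
      using norm_triple_fst[of "q - q'" "v - v'" "\<eta> - \<eta>'"] norm_triple_snd[of "v - v'" "q - q'" "\<eta> - \<eta>'"]
        norm_triple_thd[of "\<eta> - \<eta>'" "q - q'" "v - v'"]
      by (simp_all add: d_def x1 x2)
    have q: "norm q \<le> R0" "norm q' \<le> R0"
      using R0[OF x(1)] R0[OF x(2)] norm_triple_fst[of q v \<eta>] norm_triple_fst[of q' v' \<eta>'] by (simp_all add: x1 x2)
    define dy where "dy = y q s \<epsilon> - y q' s \<epsilon>'"
    have dy: "\<bar>dy\<bar> \<le> L\<psi> * d + L\<psi> * (k * BU) * \<bar>\<epsilon> - \<epsilon>'\<bar>"
    proof -
      have "\<bar>dy\<bar> \<le> L\<psi> * norm ((q + u s - (\<epsilon> * k) *\<^sub>R U s) - (q' + u s - (\<epsilon>' * k) *\<^sub>R U s))"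
        unfolding dy_def y_def k_def[symmetric] using q \<epsilon> by (intro L\<psi>(2) arg)
      also have "(q + u s - (\<epsilon> * k) *\<^sub>R U s) - (q' + u s - (\<epsilon>' * k) *\<^sub>R U s) = (q - q') - ((\<epsilon> - \<epsilon>') * k) *\<^sub>R U s"
        by (simp add: algebra_simps)
      also have "L\<psi> * norm \<dots> \<le> L\<psi> * (d + \<bar>\<epsilon> - \<epsilon>'\<bar> * k * BU)"
      proof (rule mult_left_mono[OF _ L\<psi>(1)])
        have "norm (((\<epsilon> - \<epsilon>') * k) *\<^sub>R U s) \<le> \<bar>\<epsilon> - \<epsilon>'\<bar> * k * BU"
          using k BU(2)[of s] by (simp add: abs_mult mult_left_mono)
        then show "norm (q - q' - ((\<epsilon> - \<epsilon>') * k) *\<^sub>R U s) \<le> d + \<bar>\<epsilon> - \<epsilon>'\<bar> * k * BU"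
          using norm_triangle_ineq4[of "q - q'" "((\<epsilon> - \<epsilon>') * k) *\<^sub>R U s"] d(1) by linarith
      qed
      finally show ?thesis by (simp add: algebra_simps)
    qed
    have eq: "field x s \<epsilon> - field x' s \<epsilon>' =
        (v - v', - k *\<^sub>R (v - v') + (C * (dy - (\<eta> - \<eta>'))) *\<^sub>R n s, - \<omega> * (\<eta> - \<eta>') + \<omega> * dy)"
      by (simp add: field_def x1 x2 dy_def k_def algebra_simps)
    have "norm (field x s \<epsilon> - field x' s \<epsilon>') \<le>
        norm (v - v') + norm (- k *\<^sub>R (v - v') + (C * (dy - (\<eta> - \<eta>'))) *\<^sub>R n s) + norm (- \<omega> * (\<eta> - \<eta>') + \<omega> * dy)"
      unfolding eq by (rule norm_triple_le)
    also have "\<dots> \<le> d + (k * d + \<bar>C\<bar> * (\<bar>dy\<bar> + d) * Bn) + (\<omega> * d + \<omega> * \<bar>dy\<bar>)"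
    proof (intro add_mono d(2))
      have "norm (- k *\<^sub>R (v - v')) \<le> k * d" using k d(2) by (simp add: mult_left_mono)
      moreover have "norm ((C * (dy - (\<eta> - \<eta>'))) *\<^sub>R n s) \<le> \<bar>C\<bar> * (\<bar>dy\<bar> + d) * Bn"
        unfolding norm_scaleR abs_mult
        using d(3) Bn(1,2) abs_triangle_ineq4[of dy "\<eta> - \<eta>'"] norm_ge_zero[of "x - x'"]
        by (intro mult_mono) (auto simp: d_def)
      ultimately show "norm (- k *\<^sub>R (v - v') + (C * (dy - (\<eta> - \<eta>'))) *\<^sub>R n s) \<le> k * d + \<bar>C\<bar> * (\<bar>dy\<bar> + d) * Bn"
        by (rule norm_triangle_mono)
      have "norm (- \<omega> * (\<eta> - \<eta>')) \<le> \<omega> * d" "norm (\<omega> * dy) \<le> \<omega> * \<bar>dy\<bar>"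
        using \<omega> d(3) by (simp_all add: abs_mult mult_left_mono)
      then show "norm (- \<omega> * (\<eta> - \<eta>') + \<omega> * dy) \<le> \<omega> * d + \<omega> * \<bar>dy\<bar>" by (rule norm_triangle_mono)
    qed
    also have "\<dots> = (1 + k + \<bar>C\<bar> * Bn + \<omega>) * d + (\<bar>C\<bar> * Bn + \<omega>) * \<bar>dy\<bar>"
      by (simp add: algebra_simps)
    also have "\<dots> \<le> (1 + k + \<bar>C\<bar> * Bn + \<omega>) * d + (\<bar>C\<bar> * Bn + \<omega>) * (L\<psi> * d + L\<psi> * (k * BU) * \<bar>\<epsilon> - \<epsilon>'\<bar>)"
      using dy Bn(1) \<omega> by (intro add_left_mono mult_left_mono) auto
    also have "\<dots> = L * d + B * \<bar>\<epsilon> - \<epsilon>'\<bar>"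
      by (simp add: L_def B_def algebra_simps)
    finally show ?thesis by (simp add: d_def)
  qed
  have bound: "norm (field x s \<epsilon>) \<le> K" if x: "x \<in> cball xs R" and \<epsilon>: "\<epsilon> \<in> {0..1}" for x s \<epsilon>
  proof -
    obtain q v \<eta> where x1: "x = (q, v, \<eta>)" by (cases x)
    have q: "norm q \<le> R0" "norm v \<le> R0" "\<bar>\<eta>\<bar> \<le> R0"
      using R0[OF x] norm_triple_fst[of q v \<eta>] norm_triple_snd[of v q \<eta>] norm_triple_thd[of \<eta> q v] by (simp_all add: x1)
    have yK: "\<bar>y q s \<epsilon>\<bar> \<le> K\<psi>"
      unfolding y_def k_def[symmetric] using q \<epsilon> by (intro K\<psi>(2) arg)
    have R0': "0 \<le> R0" by (simp add: R0_def)
    have "norm (field x s \<epsilon>) \<le> norm v + norm (- k *\<^sub>R v + (C * (y q s \<epsilon> - \<eta>)) *\<^sub>R n s + (\<kappa>\<^sup>2 / m\<^sup>2) *\<^sub>R u s)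
        + norm (- \<omega> * \<eta> + \<omega> * y q s \<epsilon>)"
      unfolding field_def x1 k_def prod.case by (rule norm_triple_le)
    also have "\<dots> \<le> R0 + (k * R0 + \<bar>C\<bar> * (K\<psi> + R0) * Bn + \<kappa>\<^sup>2 / m\<^sup>2 * Bu) + (\<omega> * R0 + \<omega> * K\<psi>)"
    proof (intro add_mono q(2))
      have 1: "norm (- k *\<^sub>R v) \<le> k * R0" using k q(2) by (simp add: mult_left_mono)
      have 2: "norm ((C * (y q s \<epsilon> - \<eta>)) *\<^sub>R n s) \<le> \<bar>C\<bar> * (K\<psi> + R0) * Bn"
        unfolding norm_scaleR abs_mult
        using q(3) yK Bn K\<psi>(1) R0' abs_triangle_ineq4[of "y q s \<epsilon>" \<eta>] by (intro mult_mono) auto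
      have 3: "norm ((\<kappa>\<^sup>2 / m\<^sup>2) *\<^sub>R u s) \<le> \<kappa>\<^sup>2 / m\<^sup>2 * Bu" using Bu(2)[of s] by (simp add: mult_left_mono divide_right_mono)
      show "norm (- k *\<^sub>R v + (C * (y q s \<epsilon> - \<eta>)) *\<^sub>R n s + (\<kappa>\<^sup>2 / m\<^sup>2) *\<^sub>R u s)
          \<le> k * R0 + \<bar>C\<bar> * (K\<psi> + R0) * Bn + \<kappa>\<^sup>2 / m\<^sup>2 * Bu"
        by (rule norm_triangle_mono[OF norm_triangle_mono[OF 1 2] 3])
      have "norm (- \<omega> * \<eta>) \<le> \<omega> * R0" "norm (\<omega> * y q s \<epsilon>) \<le> \<omega> * K\<psi>"
        using \<omega> q(3) yK by (simp_all add: abs_mult mult_left_mono)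
      then show "norm (- \<omega> * \<eta> + \<omega> * y q s \<epsilon>) \<le> \<omega> * R0 + \<omega> * K\<psi>" by (rule norm_triangle_mono)
    qed
    also have "\<dots> = K" by (simp add: K_def algebra_simps)
    finally show ?thesis .
  qed
  show ?thesis
  proof (intro exI ballI allI conjI)
    fix \<epsilon> s x x' assume *: "\<epsilon> \<in> {0..1::real}" "x \<in> cball xs R" "x' \<in> cball xs R"
    show "norm (field x s \<epsilon> - field x' s \<epsilon>) \<le> L * norm (x - x')" using diff[OF *(2,3,1,1)] by simp
    show "norm (field x s \<epsilon>) \<le> K" by (rule bound[OF *(2,1)])
    show "norm (field x s \<epsilon> - field x s 0) \<le> B * \<epsilon>" using diff[OF *(2,2,1), of 0] * by simp
  qed
qed

text \<open>The divergence theorem for the constant function 1. It removes the filter state from the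
  averaged velocity equation and so creates the cascade.\<close>

lemma n_integral_zero: "(n has_integral 0) {0..T}"
proof -
  have "C1_grad (\<lambda>_. 1) (\<lambda>_. 0 :: real^2)" by (simp add: C1_grad_def)
  from divergence_theorem[OF this] have "integral {0..T} n = 0" by (simp add: n_def[abs_def])
  moreover have "n integrable_on {0..T}" by (intro integrable_continuous_real n_cont)
  ultimately show ?thesis by (metis integrable_integral)
qed

text \<open>The divergence theorem for the translate of \<open>\<psi>\<close> by \<open>q\<close>:
  this is how values of \<open>\<psi>\<close> along the curve produce a gradient.\<close>

lemma \<psi>_n_integral: "((\<lambda>s. \<psi> (q + u s) *\<^sub>R n s) has_integral integral M (\<lambda>p. \<psi>' (q + p))) {0..T}"
proof -
  have "(\<lambda>s. \<psi> (q + u s) *\<^sub>R n s) integrable_on {0..T}"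
    by (intro integrable_continuous_real continuous_intros n_cont u_cont continuous_on_compose2[OF \<psi>_cont[of UNIV]]) auto
  then show ?thesis
    using divergence_theorem[OF C1_grad_translate[OF \<psi>, of q]] by (simp add: n_def[symmetric] has_integral_iff)
qed

text \<open>With the flux integral \<open>I\<close> one has \<open>C *\<^sub>R I = (T * c / m)
  *\<^sub>R grad (psi_bar M \<psi>) q\<close>, which accounts for the factor
  \<open>T / area M\<close> in the gain. The terms with \<open>\<eta>\<close> and with
  \<open>u\<close> in the velocity equation have mean zero.\<close>

lemma field_mean: "((\<lambda>s. field x s 0) has_integral T *\<^sub>R mean_field x) {0..T}"
proof -
  obtain q v \<eta> where x: "x = (q, v, \<eta>)" by (cases x)
  have const: "((\<lambda>s. w) has_integral T *\<^sub>R w) {0..T}" for w :: "'b::euclidean_space"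
    using has_integral_const_real[of w 0 T] T_pos by simp
  have u0: "(u has_integral 0) {0..T}"
    using integrable_integral[OF integrable_continuous_real[OF u_cont]] u_mean by metis
  define I where "I = integral M (\<lambda>p. \<psi>' (q + p))"
  have "((\<lambda>s. - (\<kappa> / m) *\<^sub>R v + (C *\<^sub>R (\<psi> (q + u s) *\<^sub>R n s) - (C * \<eta>) *\<^sub>R n s) + (\<kappa>\<^sup>2 / m\<^sup>2) *\<^sub>R u s)
      has_integral T *\<^sub>R (- (\<kappa> / m) *\<^sub>R v) + (C *\<^sub>R I - (C * \<eta>) *\<^sub>R 0) + (\<kappa>\<^sup>2 / m\<^sup>2) *\<^sub>R 0) {0..T}"
    unfolding I_def
    by (intro has_integral_add has_integral_diff has_integral_cmul const \<psi>_n_integral n_integral_zero u0)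
  moreover have "T *\<^sub>R (- (\<kappa> / m) *\<^sub>R v) + (C *\<^sub>R I - (C * \<eta>) *\<^sub>R 0) + (\<kappa>\<^sup>2 / m\<^sup>2) *\<^sub>R 0 =
      T *\<^sub>R ((1 / m) *\<^sub>R (- \<kappa> *\<^sub>R v + c *\<^sub>R grad (psi_bar M \<psi>) q))"
    by (simp add: grad_psi_bar[OF \<psi> M_compact] C_def I_def scaleR_add_right scaleR_diff_right mult.commute)
  moreover have "(\<lambda>s. - (\<kappa> / m) *\<^sub>R v + (C *\<^sub>R (\<psi> (q + u s) *\<^sub>R n s) - (C * \<eta>) *\<^sub>R n s) + (\<kappa>\<^sup>2 / m\<^sup>2) *\<^sub>R u s) =
      (\<lambda>s. - (\<kappa> / m) *\<^sub>R v + (C * (y q s 0 - \<eta>)) *\<^sub>R n s + (\<kappa>\<^sup>2 / m\<^sup>2) *\<^sub>R u s)"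
    by (rule ext) (simp add: y_def algebra_simps)
  ultimately have 2: "((\<lambda>s. - (\<kappa> / m) *\<^sub>R v + (C * (y q s 0 - \<eta>)) *\<^sub>R n s + (\<kappa>\<^sup>2 / m\<^sup>2) *\<^sub>R u s)
      has_integral T *\<^sub>R ((1 / m) *\<^sub>R (- \<kappa> *\<^sub>R v + c *\<^sub>R grad (psi_bar M \<psi>) q))) {0..T}" by simp
  have "((\<lambda>s. \<psi> (q + u s)) has_integral T * z_bar T u \<psi> q) {0..T}"
  proof -
    have "(\<lambda>s. \<psi> (q + u s)) integrable_on {0..T}"
      by (intro integrable_continuous_real continuous_intros u_cont continuous_on_compose2[OF \<psi>_cont[of UNIV]]) auto
    then show ?thesis using T_pos by (simp add: has_integral_iff z_bar_def)
  qed
  then have "((\<lambda>s. - \<omega> * \<eta> + \<omega> * y q s 0) has_integral T *\<^sub>R (- \<omega> * \<eta>) + \<omega> * (T * z_bar T u \<psi> q)) {0..T}"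
    by (intro has_integral_add const has_integral_mult_right) (simp add: y_def)
  moreover have "T *\<^sub>R (- \<omega> * \<eta>) + \<omega> * (T * z_bar T u \<psi> q) = T *\<^sub>R (- \<omega> * \<eta> + \<omega> * z_bar T u \<psi> q)"
    by (simp add: algebra_simps)
  ultimately have 3: "((\<lambda>s. - \<omega> * \<eta> + \<omega> * y q s 0) has_integral T *\<^sub>R (- \<omega> * \<eta> + \<omega> * z_bar T u \<psi> q)) {0..T}"
    by simp
  show ?thesis
    using has_integral_Pair[OF const[of v] has_integral_Pair[OF 2 3]]
    by (simp add: x field_def mean_field_def)
qed

lemma z_bar_cont: "continuous_on UNIV (z_bar T u \<psi>)"
proof -
  have "continuous_on (UNIV \<times> cbox 0 T) (\<lambda>(q, s). \<psi> (q + u s))"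
    unfolding case_prod_unfold
    by (intro continuous_on_compose2[OF \<psi>_cont[of UNIV]] continuous_intros continuous_on_compose2[OF u_cont[of UNIV]]) auto
  then have "continuous_on UNIV (\<lambda>q. integral (cbox 0 T) (\<lambda>s. \<psi> (q + u s)))"
    by (rule integral_continuous_on_param)
  then show ?thesis unfolding z_bar_def[abs_def] using T_pos by (auto intro!: continuous_intros)
qed

text \<open>In \<open>mean_field\<close> the filter state does not act back on position and
  velocity. A solution of the double integrator is therefore completed by an explicitly known filter
  trajectory, and the bounds of both parts are added.\<close>

lemma mean_field_solutions:
  assumes "GAS (double_integrator m \<kappa> c (psi_bar M \<psi>)) (qs, 0)"
  obtains \<beta> where "\<beta> \<in> class_KL"
    "\<And>x0. \<exists>x. solves_forward (\<lambda>z t. mean_field z) 0 x0 x \<and>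
      (\<forall>t\<ge>0. norm (x t - (qs, 0, z_bar T u \<psi> qs)) \<le> \<beta> (norm (x0 - (qs, 0, z_bar T u \<psi> qs))) t)"
proof -
  define D where "D = double_integrator m \<kappa> c (psi_bar M \<psi>)"
  obtain \<beta> where \<beta>: "\<beta> \<in> class_KL"
    and all: "\<forall>w0 t0. (\<exists>w. solves_forward (\<lambda>y t. D y) t0 w0 w) \<and>
      (\<forall>w. solves_forward (\<lambda>y t. D y) t0 w0 w \<longrightarrow>
        (\<forall>t\<ge>t0. norm (w t - (qs, 0)) \<le> \<beta> (norm (w0 - (qs, 0))) (t - t0)))"
    using assms unfolding GAS_iff D_def by blast
  have sol: "\<exists>w. solves_forward (\<lambda>y t. D y) 0 w0 w" for w0 using all by blast
  have bound: "norm (w t - (qs, 0)) \<le> \<beta> (norm (w0 - (qs, 0))) t"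
    if "solves_forward (\<lambda>y t. D y) 0 w0 w" "0 \<le> t" for w0 w t
    using all that by (metis diff_zero)
  define z where "z w = z_bar T u \<psi> (fst w)" for w :: "(real^2) \<times> (real^2)"
  have z: "continuous_on UNIV z"
    unfolding z_def by (rule continuous_on_compose2[OF z_bar_cont]) (auto intro!: continuous_intros)
  obtain \<gamma> where \<gamma>: "continuous_on {0..} \<gamma>" "mono_on {0..} \<gamma>" "\<gamma> 0 = 0"
    "\<And>w. \<bar>z w - z (qs, 0)\<bar> \<le> \<gamma> (norm (w - (qs, 0)))"
    using modulus_of_continuity_at[OF z] by blast
  define \<beta>' where "\<beta>' = (\<lambda>r t. \<beta> r t + exp (- \<omega> * t) * r + exp (- \<omega> * t / 2) * \<gamma> (\<beta> r 0) + \<gamma> (\<beta> r (t / 2)))"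
  have KL: "\<beta>' \<in> class_KL" unfolding \<beta>'_def by (rule class_KL_cascade[OF \<beta> \<omega> \<gamma>(1-3)])
  have mono: "\<beta> r t \<le> \<beta> r' t" if "0 \<le> r" "r \<le> r'" "0 \<le> t" for r r' t
    using \<beta> that unfolding class_KL_def
    by (cases "r = r'") (auto simp: strict_mono_on_def intro: less_imp_le)
  have nn: "0 \<le> \<beta> r t" if "0 \<le> r" "0 \<le> t" for r t using \<beta> that by (auto simp: class_KL_def)
  have "\<exists>x. solves_forward (\<lambda>z t. mean_field z) 0 x0 x \<and>
      (\<forall>t\<ge>0. norm (x t - (qs, 0, z_bar T u \<psi> qs)) \<le> \<beta>' (norm (x0 - (qs, 0, z_bar T u \<psi> qs))) t)" for x0
  proof -
    obtain q0 v0 \<eta>0 where x0: "x0 = (q0, v0, \<eta>0)" by (cases x0)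
    obtain w where w: "solves_forward (\<lambda>y t. D y) 0 (q0, v0) w"
      using sol by blast
    define r1 where "r1 = norm ((q0, v0) - (qs, 0))"
    define r where "r = norm (x0 - (qs, 0, z_bar T u \<psi> qs))"
    have r: "r1 \<le> r" "\<bar>\<eta>0 - z (qs, 0)\<bar> \<le> r" "0 \<le> r1" "0 \<le> r"
      using norm_triple_pair[of "q0 - qs" v0 "\<eta>0 - z (qs, 0)"] norm_triple_thd[of "\<eta>0 - z (qs, 0)" "q0 - qs" v0]
      by (simp_all add: r_def r1_def x0 z_def)
    \<comment> \<open>The distance \<open>r1\<close> of position and velocity is replaced by the
      distance \<open>r\<close> of the full state, so that all summands of \<open>\<beta>'\<close>
      are evaluated at the same radius.\<close>
    have wb: "norm (w t - (qs, 0)) \<le> \<beta> r t" if "0 \<le> t" for t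
      using bound[OF w that] mono[OF r(3,1) that] by (simp add: r1_def)
    obtain \<eta> where \<eta>: "\<eta> 0 = \<eta>0"
      "\<And>t. 0 \<le> t \<Longrightarrow> (\<eta> has_real_derivative - \<omega> * \<eta> t + \<omega> * z (w t)) (at t within {0..})"
      "\<And>t. 0 \<le> t \<Longrightarrow> \<bar>\<eta> t - z (qs, 0)\<bar> \<le> exp (- \<omega> * t) * \<bar>\<eta>0 - z (qs, 0)\<bar> +
        exp (- \<omega> * t / 2) * \<gamma> (\<beta> r 0) + \<gamma> (\<beta> r (t / 2))"
      using cascade_filter_solution[OF \<beta> \<omega> \<gamma>(2,4) z solves_forward_continuous_on[OF w] r(4) wb] by blast
    define x where "x t = (fst (w t), snd (w t), \<eta> t)" for t
    have "solves_forward (\<lambda>z t. mean_field z) 0 x0 x"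
      unfolding solves_forward_def
    proof (intro conjI allI impI)
      show "x 0 = x0" using w \<eta>(1) by (simp add: x_def x0 solves_forward_def)
      fix t :: real assume t: "0 \<le> t"
      have d: "(w has_vector_derivative D (w t)) (at t within {0..})"
        using w t by (simp add: solves_forward_def)
      have "(x has_vector_derivative (fst (D (w t)),
          snd (D (w t)), - \<omega> * \<eta> t + \<omega> * z (w t))) (at t within {0..})"
        unfolding x_def
        using \<eta>(2)[OF t]
        by (intro has_vector_derivative_Pair bounded_linear.has_vector_derivative[OF bounded_linear_fst d]
            bounded_linear.has_vector_derivative[OF bounded_linear_snd d])
           (simp add: has_real_derivative_iff_has_vector_derivative)
      then show "(x has_vector_derivative mean_field (x t)) (at t within {0..})"
        by (simp add: x_def mean_field_def D_def double_integrator_def case_prod_unfold z_def)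
    qed
    moreover have "norm (x t - (qs, 0, z_bar T u \<psi> qs)) \<le> \<beta>' r t" if t: "0 \<le> t" for t
    proof -
      have "norm (x t - (qs, 0, z_bar T u \<psi> qs)) \<le> norm (w t - (qs, 0)) + \<bar>\<eta> t - z (qs, 0)\<bar>"
      proof -
        have "norm (a, b, h) \<le> norm (a, b) + \<bar>h\<bar>" for a b :: "real^2" and h :: real
        proof -
          have "(norm (a, b, h))\<^sup>2 = (norm (a, b))\<^sup>2 + \<bar>h\<bar>\<^sup>2" by (simp add: norm_Pair)
          also have "\<dots> \<le> (norm (a, b) + \<bar>h\<bar>)\<^sup>2" by (simp add: power2_sum)
          finally show ?thesis by (rule power2_le_imp_le) simp
        qed
        from this[of "fst (w t) - qs" "snd (w t)" "\<eta> t - z (qs, 0)"] show ?thesis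
          by (simp add: x_def z_def minus_prod_def)
      qed
      also have "\<dots> \<le> \<beta> r t + (exp (- \<omega> * t) * r + exp (- \<omega> * t / 2) * \<gamma> (\<beta> r 0) + \<gamma> (\<beta> r (t / 2)))"
      proof (rule add_mono[OF wb[OF t] order_trans[OF \<eta>(3)[OF t]]])
        show "exp (- \<omega> * t) * \<bar>\<eta>0 - z (qs, 0)\<bar> + exp (- \<omega> * t / 2) * \<gamma> (\<beta> r 0) + \<gamma> (\<beta> r (t / 2))
            \<le> exp (- \<omega> * t) * r + exp (- \<omega> * t / 2) * \<gamma> (\<beta> r 0) + \<gamma> (\<beta> r (t / 2))"
          by (intro add_right_mono mult_left_mono r) simp
      qed
      finally show ?thesis by (simp add: \<beta>'_def)
    qed
    ultimately show ?thesis by (auto simp: r_def)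
  qed
  with KL show thesis by (rule that)
qed

lemma SGPUAS_field:
  assumes "GAS (double_integrator m \<kappa> c (psi_bar M \<psi>)) (qs, 0)"
  shows "SGPUAS (\<lambda>x t \<epsilon> \<delta>. field x (t / \<epsilon>) \<epsilon>) (qs, 0, z_bar T u \<psi> qs)"
proof -
  obtain \<beta> where \<beta>: "\<beta> \<in> class_KL"
    "\<And>x0. \<exists>x. solves_forward (\<lambda>z t. mean_field z) 0 x0 x \<and>
      (\<forall>t\<ge>0. norm (x t - (qs, 0, z_bar T u \<psi> qs)) \<le> \<beta> (norm (x0 - (qs, 0, z_bar T u \<psi> qs))) t)"
    using mean_field_solutions[OF assms] by blast
  interpret averaged_system field mean_field T "(qs, 0, z_bar T u \<psi> qs)" \<beta>
    by unfold_locales (rule T_pos field_cont field_bounds field_periodic field_mean \<beta>)+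
  show ?thesis by (rule averaging_SGPUAS)
qed

end

theorem theorem2:
  fixes m \<kappa> c \<omega>\<^sub>H T :: real
    and \<psi> :: "real^2 \<Rightarrow> real"
    and M :: "(real^2) set"
    and \<nu> :: "real^2 \<Rightarrow> real^2"
    and u U :: "real \<Rightarrow> real^2"
    and qs :: "real^2"
  assumes "m > 0" and "\<kappa> > 0" and "c > 0" and "\<omega>\<^sub>H > 0" and "T > 0"
    and "smooth_on UNIV \<psi>"
    and "compact M" and "smooth_submanifold_with_boundary M"
    and "connected (manifold_boundary M)"
    and "\<forall>p\<in>manifold_boundary M. outward_unit_normal M p (\<nu> p)"
    and "smooth_on UNIV u"
    and "\<forall>t. u t \<in> manifold_boundary M"
    and "\<forall>t. u (t + T) = u t"
    and "integral {0..T} u = 0"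
    and "\<forall>t. vector_derivative u (at t) \<noteq> 0"
    and "inj_on u {0<..<T}"
    and "\<forall>t. (U has_vector_derivative u t) (at t)"
    and "integral {0..T} U = 0"
    and "GAS (double_integrator m \<kappa> c (psi_bar M \<psi>)) (qs, 0)"
  shows "SGPUAS (\<lambda>x t \<epsilon> \<delta>. source_seeking_system m \<kappa> c \<omega>\<^sub>H T \<psi> M \<nu> u U x t \<epsilon>)
           (qs, 0, z_bar T u \<psi> qs)"
proof -
  obtain \<psi>' where \<psi>': "C1_grad \<psi> \<psi>'" by (rule smooth_on_C1_grad[OF assms(6)])
  have "u differentiable (at t)" for t
    using smooth_on_has_derivative[OF assms(11), of t] by (auto simp: differentiable_def)
  then have u': "(u has_vector_derivative vector_derivative u (at t)) (at t)" for t
    by (simp add: vector_derivative_works)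
  \<comment> \<open>Smoothness yields continuity of the Frechet derivative along the direction 1,
    which is the velocity of the curve.\<close>
  have "frechet_derivative u (at t) 1 = vector_derivative u (at t)" for t
    using frechet_derivative_at[OF u'[of t, unfolded has_vector_derivative_def]] by (metis scaleR_one)
  then have u'_cont: "continuous_on UNIV (\<lambda>t. vector_derivative u (at t))"
    using smooth_on_frechet_derivative_continuous[OF assms(11), of 1] by simp
  interpret source_seeking M \<nu> u "\<lambda>t. vector_derivative u (at t)" T m \<kappa> c \<omega>\<^sub>H \<psi> \<psi>' U
    by unfold_locales (use assms \<psi>' u' u'_cont in auto)
  \<comment> \<open>Multiplying out the division by the mass gives \<open>C\<close> and the
    coefficient \<open>\<kappa>\<^sup>2 / m\<^sup>2\<close> of \<open>u\<close>.\<close>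
  have "source_seeking_system m \<kappa> c \<omega>\<^sub>H T \<psi> M \<nu> u U x t \<epsilon> = field x (t / \<epsilon>) \<epsilon>" for x t \<epsilon>
    using assms(1)
    by (cases x) (simp add: source_seeking_system_def field_def y_def n_def C_def Let_def algebra_simps power2_eq_square)
  then show ?thesis using SGPUAS_field[OF assms(19)] by simp
qed

end
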